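(* Let $F\colon \mathcal{K}\to\mathcal{L}$ be a weak equivalence of $\infty$-cosmoi. Then the following notions are preserved and reflected by $F$, i.e.: (i) For all functors $f\colon B\to A$ and $u\colon A\to B$ in $\mathcal{K}$: $f$ is left adjoint to $u$ in $\mathfrak{h}\mathcal{K}$ if and only if $Ff$ is left adjoint to $Fu$ in $\mathfrak{h}\mathcal{L}$. (ii) For every functor $u\colon A\to B$ in $\mathcal{K}$: $u$ admits a left (respectively, right) adjoint in $\mathfrak{h}\mathcal{K}$ if and only if $Fu$ admits a left (respectively, right) adjoint in $\mathfrak{h}\mathcal{L}$. (iii) For every simplicial set $J$, $\infty$-category $A\in\mathcal{K}$, diagram $d\colon 1\to A^J$ and element $\ell\colon 1\to A$: $\ell$ defines a limit (respectively, colimit) of $d$ if and only if $F\ell\colon 1\cong F1\to FA$ defines a limit (respectively, colimit) of $Fd\colon 1\cong F1\to F(A^J)\cong (FA)^J$. (iv) For every simplicial set $J$, $\infty$-category $A\in\mathcal{K}$ and diagram $d\colon 1\to A^J$: $d$ admits a limit (respectively, colimit) in $A$ if and only if $Fd\colon 1\to (FA)^J$ admits a limit (respectively, colimit) in $FA$.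
   Context: Quasi-categories. A quasi-category is a simplicial set in which every inner horn $\Lambda^{n,k}\to\Delta^n$, $0<k<n$, has a filler. Let $\mathbb{I}$ be the nerve of the category with two objects and a unique isomorphism between them. An isofibration of quasi-categories is a map with the right lifting property against inner horn inclusions and against the inclusion $\Delta^0\to\mathbb{I}$ of either endpoint. A map $f\colon A\to B$ of quasi-categories is an equivalence if there are $g\colon B\to A$ and maps $A\to A^{\mathbb{I}}$, $B\to B^{\mathbb{I}}$ restricting along the two vertices of $\mathbb{I}$ to $\mathrm{id}_A, gf$ and to $fg,\mathrm{id}_B$ respectively. $\infty$-cosmoi. An $\infty$-cosmos is a simplicially enriched category $\mathcal{K}$ (objects are called $\infty$-categories, vertices of hom simplicial sets are called functors) whose hom simplicial sets $\mathrm{Fun}(A,B)$ are all quasi-categories, equipped with a specified subcategory of isofibrations, such that: (a) in the simplicially enriched sense $\mathcal{K}$ has a terminal object $1$, cotensors $A^U$ of objects $A$ by simplicial sets $U$, and pullbacks of isofibrations along any functor; (b) isofibrations include the isomorphisms and all functors $A\to 1$, are stable under pullback along all functors, and for every isofibration $p\colon E\to B$ and inclusion of simplicial sets $U\hookrightarrow V$ the induced map $E^V\to E^U\times_{B^U}B^V$ is an isofibration; moreover for every object $X$ and isofibration $p\colon E\to B$, $\mathrm{Fun}(X,p)$ is an isofibration of quasi-categories. A functor $f\colon A\to B$ is an equivalence if $\mathrm{Fun}(X,f)$ is an equivalence of quasi-categories for all $X\in\mathcal{K}$. Homotopy 2-category. $\mathfrak{h}\mathcal{K}$ is the strict 2-category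 with the same objects as $\mathcal{K}$ and hom-categories $\hom(A,B):=\mathrm{ho}(\mathrm{Fun}(A,B))$, the homotopy categories of the mapping quasi-categories. So 1-cells are functors and 2-cells are represented by 1-simplices of $\mathrm{Fun}(A,B)$, two parallel 1-simplices representing the same 2-cell iff they bound a 2-simplex whose remaining outer face is degenerate. An adjunction $f\dashv u$ between $\infty$-categories is an adjunction in the 2-category $\mathfrak{h}\mathcal{K}$ (unit and counit 2-cells satisfying the triangle identities). Functors and weak equivalences of $\infty$-cosmoi. A functor of $\infty$-cosmoi $F\colon\mathcal{K}\to\mathcal{L}$ is a simplicial functor preserving isofibrations and the limits listed in (a); it induces a 2-functor $\mathfrak{h}\mathcal{K}\to\mathfrak{h}\mathcal{L}$. It is a weak equivalence if for every $X\in\mathcal{L}$ there is $A\in\mathcal{K}$ with $FA\simeq X$ in $\mathcal{L}$, and for all $A,B\in\mathcal{K}$ the map $\mathrm{Fun}(A,B)\to\mathrm{Fun}(FA,FB)$ is an equivalence of quasi-categories. Limits. An element of $A$ is a functor $1\to A$. For a simplicial set $J$, $\Delta\colon A\to A^J$ is the constant diagram functor induced by $J\to\Delta^0$. Given functors $g\colon C\to A$, $f\colon B\to A$, a functor $\ell\colon C\to B$ with a 2-cell $\lambda\colon f\ell\Rightarrow g$ is an absolute right lifting of $g$ through $f$ if for all $c\colon X\to C$, $b\colon X\to B$ and every 2-cell $\chi\colon fb\Rightarrow gc$ there is a unique 2-cell $\zeta\colon b\Rightarrow \ell c$ with $\chi=\lambda c\cdot f\zeta$. Absolute left liftings are defined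 dually by reversing all 2-cells. An element $\ell\colon 1\to A$ defines a limit (colimit) of $d\colon 1\to A^J$ if there is a 2-cell $\Delta\ell\Rightarrow d$ (respectively $d\Rightarrow\Delta\ell$) making $\ell$ an absolute right (respectively left) lifting of $d$ through $\Delta$. *)

theory Defs
  imports Main "HOL-Library.FuncSet" "HOL-Library.Infinite_Typeclass"
begin

section \<open>Simplicial sets\<close>

text \<open>
  The ordinal \<open>[n]\<close> is \<open>{..n}\<close>; a morphism \<open>[m] \<rightarrow> [n]\<close> of the simplex category is an
  extensional monotone function, so that morphisms are equal iff they are equal as HOL functions.
\<close>

definition Op :: "nat \<Rightarrow> nat \<Rightarrow> (nat \<Rightarrow> nat) set" where
  "Op m n = {\<alpha> \<in> {..m} \<rightarrow>\<^sub>E {..n}. mono_on {..m} \<alpha>}"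

text \<open>
  \<open>act X m n \<alpha>\<close> is the map from \<open>n\<close>-simplices to \<open>m\<close>-simplices given by \<open>\<alpha> \<in> Op m n\<close>.
\<close>

record 'a sset =
  simplices :: "nat \<Rightarrow> 'a set"
  act :: "nat \<Rightarrow> nat \<Rightarrow> (nat \<Rightarrow> nat) \<Rightarrow> 'a \<Rightarrow> 'a"

locale simplicial_set =
  fixes X :: "'a sset"
  assumes act_closed:
      "\<lbrakk>\<alpha> \<in> Op m n; x \<in> simplices X n\<rbrakk> \<Longrightarrow> act X m n \<alpha> x \<in> simplices X m"
    and act_id:
      "x \<in> simplices X n \<Longrightarrow> act X n n (\<lambda>i\<in>{..n}. i) x = x"
    and act_compose:
      "\<lbrakk>\<alpha> \<in> Op m n; \<beta> \<in> Op k m; x \<in> simplices X n\<rbrakk>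
        \<Longrightarrow> act X k n (compose {..k} \<alpha> \<beta>) x = act X k m \<beta> (act X m n \<alpha> x)"

definition simplicial_map :: "'a sset \<Rightarrow> 'b sset \<Rightarrow> (nat \<Rightarrow> 'a \<Rightarrow> 'b) \<Rightarrow> bool" where
  "simplicial_map X Y f \<longleftrightarrow>
     (\<forall>n. f n \<in> simplices X n \<rightarrow> simplices Y n) \<and>
     (\<forall>m n. \<forall>\<alpha>\<in>Op m n. \<forall>x\<in>simplices X n. f m (act X m n \<alpha> x) = act Y m n \<alpha> (f n x))"

definition sset_iso :: "'a sset \<Rightarrow> 'b sset \<Rightarrow> (nat \<Rightarrow> 'a \<Rightarrow> 'b) \<Rightarrow> bool" where
  "sset_iso X Y f \<longleftrightarrow>
     simplicial_map X Y f \<and> (\<forall>n. bij_betw (f n) (simplices X n) (simplices Y n))"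

definition sset_mono :: "'a sset \<Rightarrow> 'b sset \<Rightarrow> (nat \<Rightarrow> 'a \<Rightarrow> 'b) \<Rightarrow> bool" where
  "sset_mono X Y f \<longleftrightarrow> simplicial_map X Y f \<and> (\<forall>n. inj_on (f n) (simplices X n))"

definition face :: "'a sset \<Rightarrow> nat \<Rightarrow> nat \<Rightarrow> 'a \<Rightarrow> 'a" where
  "face X n i x = act X (n - 1) n (\<lambda>j\<in>{..n - 1}. if j < i then j else Suc j) x"

text \<open>The totally degenerate \<open>n\<close>-simplex at a vertex.\<close>

definition degen :: "'a sset \<Rightarrow> nat \<Rightarrow> 'a \<Rightarrow> 'a" where
  "degen X n x = act X n 0 (\<lambda>i\<in>{..n}. 0) x"

definition Delta :: "nat \<Rightarrow> (nat \<Rightarrow> nat) sset" where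
  "Delta n = \<lparr>simplices = (\<lambda>m. Op m n), act = (\<lambda>k m \<beta> \<alpha>. compose {..k} \<alpha> \<beta>)\<rparr>"

definition horn :: "nat \<Rightarrow> nat \<Rightarrow> (nat \<Rightarrow> nat) sset" where
  "horn n k =
    \<lparr>simplices = (\<lambda>m. {\<alpha> \<in> Op m n. \<exists>j\<le>n. j \<noteq> k \<and> j \<notin> \<alpha> ` {..m}}),
     act = (\<lambda>k m \<beta> \<alpha>. compose {..k} \<alpha> \<beta>)\<rparr>"

text \<open>
  The nerve of the category with object set \<open>bool\<close> and exactly one morphism between any two
  objects: a functor from \<open>[n]\<close> to it is just a function on objects.
\<close>

definition walking_iso :: "(nat \<Rightarrow> bool) sset" where
  "walking_iso =
    \<lparr>simplices = (\<lambda>n. {..n} \<rightarrow>\<^sub>E (UNIV :: bool set)),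
     act = (\<lambda>m n \<alpha> s. compose {..m} s \<alpha>)\<rparr>"

definition walking_iso_vertex :: "bool \<Rightarrow> nat \<Rightarrow> nat \<Rightarrow> bool" where
  "walking_iso_vertex e n = (\<lambda>i\<in>{..n}. e)"

definition sprod :: "'a sset \<Rightarrow> 'b sset \<Rightarrow> ('a \<times> 'b) sset" where
  "sprod X Y =
    \<lparr>simplices = (\<lambda>n. simplices X n \<times> simplices Y n),
     act = (\<lambda>m n \<alpha> (x, y). (act X m n \<alpha> x, act Y m n \<alpha> y))\<rparr>"

text \<open>
  The exponential \<open>Y\<^sup>U\<close>: its \<open>n\<close>-simplices are the simplicial maps \<open>U \<times> \<Delta>\<^sup>n \<rightarrow> Y\<close>, taken
  extensional so that equality of simplices is equality in HOL.
\<close>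

definition sexp :: "'b sset \<Rightarrow> 'a sset \<Rightarrow> (nat \<Rightarrow> 'a \<times> (nat \<Rightarrow> nat) \<Rightarrow> 'b) sset" where
  "sexp Y U =
    \<lparr>simplices = (\<lambda>n. {\<phi>. simplicial_map (sprod U (Delta n)) Y \<phi> \<and>
                         (\<forall>k. \<phi> k \<in> extensional (simplices (sprod U (Delta n)) k))}),
     act = (\<lambda>m n \<alpha> \<phi> k. \<lambda>(u, \<beta>)\<in>simplices (sprod U (Delta m)) k.
              \<phi> k (u, compose {..k} \<alpha> \<beta>))\<rparr>"


section \<open>Quasi-categories\<close>

locale quasi_category = simplicial_set X for X :: "'a sset" +
  assumes inner_horn_filler:
    "\<lbrakk>0 < k; k < n; simplicial_map (horn n k) X h\<rbrakk>
      \<Longrightarrow> \<exists>s. simplicial_map (Delta n) X s \<and>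
            (\<forall>m. \<forall>\<alpha>\<in>simplices (horn n k) m. s m \<alpha> = h m \<alpha>)"

definition has_rlp ::
  "'u sset \<Rightarrow> 'v sset \<Rightarrow> (nat \<Rightarrow> 'u \<Rightarrow> 'v) \<Rightarrow> 'x sset \<Rightarrow> 'y sset \<Rightarrow> (nat \<Rightarrow> 'x \<Rightarrow> 'y) \<Rightarrow> bool" where
  "has_rlp U V j X Y p \<longleftrightarrow>
    (\<forall>u v. simplicial_map U X u \<and> simplicial_map V Y v \<and>
           (\<forall>n. \<forall>a\<in>simplices U n. p n (u n a) = v n (j n a)) \<longrightarrow>
       (\<exists>w. simplicial_map V X w \<and>
            (\<forall>n. \<forall>a\<in>simplices U n. w n (j n a) = u n a) \<and>
            (\<forall>n. \<forall>b\<in>simplices V n. p n (w n b) = v n b)))"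

definition qcat_isofibration :: "'x sset \<Rightarrow> 'y sset \<Rightarrow> (nat \<Rightarrow> 'x \<Rightarrow> 'y) \<Rightarrow> bool" where
  "qcat_isofibration X Y p \<longleftrightarrow>
     simplicial_map X Y p \<and>
     (\<forall>n k. 0 < k \<and> k < n \<longrightarrow> has_rlp (horn n k) (Delta n) (\<lambda>m \<alpha>. \<alpha>) X Y p) \<and>
     (\<forall>e. has_rlp (Delta 0) walking_iso (\<lambda>m \<alpha>. walking_iso_vertex e m) X Y p)"

text \<open>
  Restriction \<open>A\<^sup>\<I> \<rightarrow> A\<^sup>\<Delta>\<^sup>0 \<cong> A\<close> along a vertex of the walking isomorphism \<open>\<I>\<close>.
\<close>

definition walking_iso_ev ::
  "bool \<Rightarrow> nat \<Rightarrow> (nat \<Rightarrow> (nat \<Rightarrow> bool) \<times> (nat \<Rightarrow> nat) \<Rightarrow> 'a) \<Rightarrow> 'a" where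
  "walking_iso_ev e n \<phi> = \<phi> n (walking_iso_vertex e n, \<lambda>i\<in>{..n}. i)"

definition qcat_equivalence :: "'a sset \<Rightarrow> 'b sset \<Rightarrow> (nat \<Rightarrow> 'a \<Rightarrow> 'b) \<Rightarrow> bool" where
  "qcat_equivalence A B f \<longleftrightarrow>
     simplicial_map A B f \<and>
     (\<exists>g. simplicial_map B A g \<and>
        (\<exists>h. simplicial_map A (sexp A walking_iso) h \<and>
           (\<forall>n. \<forall>a\<in>simplices A n. walking_iso_ev False n (h n a) = a \<and>
                                 walking_iso_ev True n (h n a) = g n (f n a))) \<and>
        (\<exists>k. simplicial_map B (sexp B walking_iso) k \<and>
           (\<forall>n. \<forall>b\<in>simplices B n. walking_iso_ev False n (k n b) = f n (g n b) \<and>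
                                 walking_iso_ev True n (k n b) = b)))"


subsection \<open>Homotopy categories\<close>

definition edges :: "'a sset \<Rightarrow> 'a \<Rightarrow> 'a \<Rightarrow> 'a set" where
  "edges X x y = {e \<in> simplices X 1. face X 1 1 e = x \<and> face X 1 0 e = y}"

text \<open>
  In a quasi-category this is an equivalence relation on parallel edges, and swapping the roles of
  the two edges or of the two outer faces gives the same relation.
\<close>

definition homotopic :: "'a sset \<Rightarrow> 'a \<Rightarrow> 'a \<Rightarrow> bool" where
  "homotopic X e e' \<longleftrightarrow>
     (\<exists>x\<in>simplices X 0. \<exists>y\<in>simplices X 0. e \<in> edges X x y \<and> e' \<in> edges X x y \<and>
       (\<exists>\<sigma>\<in>simplices X 2. face X 2 2 \<sigma> = e \<and> face X 2 1 \<sigma> = e' \<and> face X 2 0 \<sigma> = degen X 1 y))"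

definition ho_class :: "'a sset \<Rightarrow> 'a \<Rightarrow> 'a set" where
  "ho_class X e = {e'. homotopic X e e'}"

definition ho_hom :: "'a sset \<Rightarrow> 'a \<Rightarrow> 'a \<Rightarrow> 'a set set" where
  "ho_hom X x y = ho_class X ` edges X x y"

definition ho_id :: "'a sset \<Rightarrow> 'a \<Rightarrow> 'a set" where
  "ho_id X x = ho_class X (degen X 1 x)"

text \<open>
  \<open>ho_comp X b a\<close> is the composite of \<open>a\<close> followed by \<open>b\<close>. The inner faces of all 2-simplices with
  outer faces in \<open>a\<close> and \<open>b\<close> form exactly one homotopy class when \<open>X\<close> is a quasi-category.
\<close>

definition ho_comp :: "'a sset \<Rightarrow> 'a set \<Rightarrow> 'a set \<Rightarrow> 'a set" where
  "ho_comp X b a = {face X 2 1 \<sigma> |\<sigma>. \<sigma> \<in> simplices X 2 \<and> face X 2 2 \<sigma> \<in> a \<and> face X 2 0 \<sigma> \<in> b}"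


section \<open>Adjunctions and absolute liftings in a 2-category\<close>

text \<open>
  Cells need not determine their boundary, so operations take the objects involved as arguments:
  \<open>comp1 T A B C g f\<close> is \<open>g \<circ> f\<close> for \<open>f : A \<rightarrow> B\<close> and \<open>g : B \<rightarrow> C\<close>, \<open>vcomp T A B \<beta> \<alpha>\<close> is
  \<open>\<alpha>\<close> followed by \<open>\<beta>\<close> in the hom-category from \<open>A\<close> to \<open>B\<close>, and \<open>hcomp T A B C \<beta> \<alpha>\<close> is the
  horizontal composite of \<open>\<alpha>\<close> between 1-cells \<open>A \<rightarrow> B\<close> with \<open>\<beta>\<close> between 1-cells \<open>B \<rightarrow> C\<close>.
\<close>

record ('o, 'f, 'c) two_cat =
  ob2 :: "'o set"
  cells1 :: "'o \<Rightarrow> 'o \<Rightarrow> 'f set"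
  cells2 :: "'o \<Rightarrow> 'o \<Rightarrow> 'f \<Rightarrow> 'f \<Rightarrow> 'c set"
  id1 :: "'o \<Rightarrow> 'f"
  comp1 :: "'o \<Rightarrow> 'o \<Rightarrow> 'o \<Rightarrow> 'f \<Rightarrow> 'f \<Rightarrow> 'f"
  id2 :: "'o \<Rightarrow> 'o \<Rightarrow> 'f \<Rightarrow> 'c"
  vcomp :: "'o \<Rightarrow> 'o \<Rightarrow> 'c \<Rightarrow> 'c \<Rightarrow> 'c"
  hcomp :: "'o \<Rightarrow> 'o \<Rightarrow> 'o \<Rightarrow> 'c \<Rightarrow> 'c \<Rightarrow> 'c"

definition lwhisker ::
  "('o, 'f, 'c) two_cat \<Rightarrow> 'o \<Rightarrow> 'o \<Rightarrow> 'o \<Rightarrow> 'f \<Rightarrow> 'c \<Rightarrow> 'c" where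
  "lwhisker T A B C g \<alpha> = hcomp T A B C (id2 T B C g) \<alpha>"

definition rwhisker ::
  "('o, 'f, 'c) two_cat \<Rightarrow> 'o \<Rightarrow> 'o \<Rightarrow> 'o \<Rightarrow> 'c \<Rightarrow> 'f \<Rightarrow> 'c" where
  "rwhisker T A B C \<beta> f = hcomp T A B C \<beta> (id2 T A B f)"

text \<open>The dual with the 2-cells reversed.\<close>

definition co_dual :: "('o, 'f, 'c) two_cat \<Rightarrow> ('o, 'f, 'c) two_cat" where
  "co_dual T = T\<lparr>cells2 := (\<lambda>A B f g. cells2 T A B g f),
                 vcomp := (\<lambda>A B \<beta> \<alpha>. vcomp T A B \<alpha> \<beta>)\<rparr>"

definition is_adjunction ::
  "('o, 'f, 'c) two_cat \<Rightarrow> 'o \<Rightarrow> 'o \<Rightarrow> 'f \<Rightarrow> 'f \<Rightarrow> 'c \<Rightarrow> 'c \<Rightarrow> bool" where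
  "is_adjunction T A B f u \<eta> \<epsilon> \<longleftrightarrow>
     A \<in> ob2 T \<and> B \<in> ob2 T \<and> f \<in> cells1 T B A \<and> u \<in> cells1 T A B \<and>
     \<eta> \<in> cells2 T B B (id1 T B) (comp1 T B A B u f) \<and>
     \<epsilon> \<in> cells2 T A A (comp1 T A B A f u) (id1 T A) \<and>
     vcomp T B A (rwhisker T B A A \<epsilon> f) (lwhisker T B B A f \<eta>) = id2 T B A f \<and>
     vcomp T A B (lwhisker T A A B u \<epsilon>) (rwhisker T A B B \<eta> u) = id2 T A B u"

text \<open>\<open>f : B \<rightarrow> A\<close> is left adjoint to \<open>u : A \<rightarrow> B\<close>.\<close>

definition left_adjoint_to :: "('o, 'f, 'c) two_cat \<Rightarrow> 'o \<Rightarrow> 'o \<Rightarrow> 'f \<Rightarrow> 'f \<Rightarrow> bool" where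
  "left_adjoint_to T A B f u \<longleftrightarrow> (\<exists>\<eta> \<epsilon>. is_adjunction T A B f u \<eta> \<epsilon>)"

definition admits_left_adjoint :: "('o, 'f, 'c) two_cat \<Rightarrow> 'o \<Rightarrow> 'o \<Rightarrow> 'f \<Rightarrow> bool" where
  "admits_left_adjoint T A B u \<longleftrightarrow> (\<exists>f\<in>cells1 T B A. left_adjoint_to T A B f u)"

definition admits_right_adjoint :: "('o, 'f, 'c) two_cat \<Rightarrow> 'o \<Rightarrow> 'o \<Rightarrow> 'f \<Rightarrow> bool" where
  "admits_right_adjoint T A B u \<longleftrightarrow> (\<exists>r\<in>cells1 T B A. left_adjoint_to T B A u r)"

text \<open>\<open>(l, \<lambda>)\<close> is an absolute right lifting of \<open>g : C \<rightarrow> A\<close> through \<open>f : B \<rightarrow> A\<close>.\<close>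

definition absolute_right_lifting ::
  "('o, 'f, 'c) two_cat \<Rightarrow> 'o \<Rightarrow> 'o \<Rightarrow> 'o \<Rightarrow> 'f \<Rightarrow> 'f \<Rightarrow> 'f \<Rightarrow> 'c \<Rightarrow> bool" where
  "absolute_right_lifting T C B A g f l lam \<longleftrightarrow>
     C \<in> ob2 T \<and> B \<in> ob2 T \<and> A \<in> ob2 T \<and>
     g \<in> cells1 T C A \<and> f \<in> cells1 T B A \<and> l \<in> cells1 T C B \<and>
     lam \<in> cells2 T C A (comp1 T C B A f l) g \<and>
     (\<forall>X\<in>ob2 T. \<forall>c\<in>cells1 T X C. \<forall>b\<in>cells1 T X B.
        \<forall>\<chi>\<in>cells2 T X A (comp1 T X B A f b) (comp1 T X C A g c).
          \<exists>!\<zeta>. \<zeta> \<in> cells2 T X B b (comp1 T X C B l c) \<and>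
               \<chi> = vcomp T X A (rwhisker T X C A lam c) (lwhisker T X B A f \<zeta>))"

definition absolute_left_lifting ::
  "('o, 'f, 'c) two_cat \<Rightarrow> 'o \<Rightarrow> 'o \<Rightarrow> 'o \<Rightarrow> 'f \<Rightarrow> 'f \<Rightarrow> 'f \<Rightarrow> 'c \<Rightarrow> bool" where
  "absolute_left_lifting T = absolute_right_lifting (co_dual T)"


section \<open>Simplicially enriched categories\<close>

text \<open>
  \<open>cmp K A B C n g f\<close> is the composite of \<open>f \<in> Fun(A,B)\<^sub>n\<close> and \<open>g \<in> Fun(B,C)\<^sub>n\<close>.
\<close>

record ('o, 's) scat =
  ob :: "'o set"
  Fun :: "'o \<Rightarrow> 'o \<Rightarrow> 's sset"
  cmp :: "'o \<Rightarrow> 'o \<Rightarrow> 'o \<Rightarrow> nat \<Rightarrow> 's \<Rightarrow> 's \<Rightarrow> 's"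
  idn :: "'o \<Rightarrow> 's"

abbreviation functors :: "('o, 's, 'm) scat_scheme \<Rightarrow> 'o \<Rightarrow> 'o \<Rightarrow> 's set" where
  "functors K A B \<equiv> simplices (Fun K A B) 0"

locale simplicial_category =
  fixes K :: "('o, 's, 'm) scat_scheme"
  assumes Fun_sset: "\<lbrakk>A \<in> ob K; B \<in> ob K\<rbrakk> \<Longrightarrow> simplicial_set (Fun K A B)"
    and cmp_simplicial: "\<lbrakk>A \<in> ob K; B \<in> ob K; C \<in> ob K\<rbrakk>
      \<Longrightarrow> simplicial_map (sprod (Fun K B C) (Fun K A B)) (Fun K A C)
            (\<lambda>n (g, f). cmp K A B C n g f)"
    and idn_closed: "A \<in> ob K \<Longrightarrow> idn K A \<in> functors K A A"
    and cmp_assoc: "\<lbrakk>A \<in> ob K; B \<in> ob K; C \<in> ob K; D \<in> ob K;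
        f \<in> simplices (Fun K A B) n; g \<in> simplices (Fun K B C) n; h \<in> simplices (Fun K C D) n\<rbrakk>
      \<Longrightarrow> cmp K A C D n h (cmp K A B C n g f) = cmp K A B D n (cmp K B C D n h g) f"
    and cmp_idn_left: "\<lbrakk>A \<in> ob K; B \<in> ob K; f \<in> simplices (Fun K A B) n\<rbrakk>
      \<Longrightarrow> cmp K A B B n (degen (Fun K B B) n (idn K B)) f = f"
    and cmp_idn_right: "\<lbrakk>A \<in> ob K; B \<in> ob K; f \<in> simplices (Fun K A B) n\<rbrakk>
      \<Longrightarrow> cmp K A A B n f (degen (Fun K A A) n (idn K A)) = f"

text \<open>The map \<open>Fun(X,f) : Fun(X,A) \<rightarrow> Fun(X,B)\<close> for a functor \<open>f : A \<rightarrow> B\<close>.\<close>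

definition postcomp ::
  "('o, 's, 'm) scat_scheme \<Rightarrow> 'o \<Rightarrow> 'o \<Rightarrow> 'o \<Rightarrow> 's \<Rightarrow> nat \<Rightarrow> 's \<Rightarrow> 's" where
  "postcomp K X A B f n x = cmp K X A B n (degen (Fun K A B) n f) x"

definition is_isomorphism :: "('o, 's, 'm) scat_scheme \<Rightarrow> 'o \<Rightarrow> 'o \<Rightarrow> 's \<Rightarrow> bool" where
  "is_isomorphism K A B f \<longleftrightarrow>
     f \<in> functors K A B \<and>
     (\<exists>g\<in>functors K B A. cmp K A B A 0 g f = idn K A \<and> cmp K B A B 0 f g = idn K B)"

definition is_equivalence :: "('o, 's, 'm) scat_scheme \<Rightarrow> 'o \<Rightarrow> 'o \<Rightarrow> 's \<Rightarrow> bool" where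
  "is_equivalence K A B f \<longleftrightarrow>
     f \<in> functors K A B \<and>
     (\<forall>X\<in>ob K. qcat_equivalence (Fun K X A) (Fun K X B) (postcomp K X A B f))"

definition homotopy_2_category ::
  "('o, 's, 'm) scat_scheme \<Rightarrow> ('o, 's, 's set) two_cat" where
  "homotopy_2_category K =
    \<lparr>ob2 = ob K,
     cells1 = functors K,
     cells2 = (\<lambda>A B. ho_hom (Fun K A B)),
     id1 = idn K,
     comp1 = (\<lambda>A B C. cmp K A B C 0),
     id2 = (\<lambda>A B. ho_id (Fun K A B)),
     vcomp = (\<lambda>A B. ho_comp (Fun K A B)),
     hcomp = (\<lambda>A B C b a. \<Union>\<beta>\<in>b. \<Union>\<alpha>\<in>a. ho_class (Fun K A C) (cmp K A B C 1 \<beta> \<alpha>))\<rparr>"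


subsection \<open>Enriched limits\<close>

definition is_terminal :: "('o, 's, 'm) scat_scheme \<Rightarrow> 'o \<Rightarrow> bool" where
  "is_terminal K T \<longleftrightarrow>
     T \<in> ob K \<and> (\<forall>X\<in>ob K. sset_iso (Fun K X T) (Delta 0) (\<lambda>n x. \<lambda>i\<in>{..n}. 0))"

text \<open>
  \<open>P\<close> with \<open>q : P \<rightarrow> E\<close> and \<open>r : P \<rightarrow> A\<close> is a pullback of \<open>p : E \<rightarrow> B\<close> along \<open>f : A \<rightarrow> B\<close>, in
  the sense that \<open>Fun(X,P)\<close> is the pullback of simplicial sets for every \<open>X\<close>.
\<close>

definition is_pullback ::
  "('o, 's, 'm) scat_scheme \<Rightarrow> 'o \<Rightarrow> 'o \<Rightarrow> 'o \<Rightarrow> 's \<Rightarrow> 's \<Rightarrow> 'o \<Rightarrow> 's \<Rightarrow> 's \<Rightarrow> bool" where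
  "is_pullback K E A B p f P q r \<longleftrightarrow>
     E \<in> ob K \<and> A \<in> ob K \<and> B \<in> ob K \<and> P \<in> ob K \<and>
     p \<in> functors K E B \<and> f \<in> functors K A B \<and> q \<in> functors K P E \<and> r \<in> functors K P A \<and>
     cmp K P E B 0 p q = cmp K P A B 0 f r \<and>
     (\<forall>X\<in>ob K. \<forall>n.
        bij_betw (\<lambda>x. (postcomp K X P E q n x, postcomp K X P A r n x))
          (simplices (Fun K X P) n)
          {(e, a). e \<in> simplices (Fun K X E) n \<and> a \<in> simplices (Fun K X A) n \<and>
                   postcomp K X E B p n e = postcomp K X A B f n a})"

text \<open>
  \<open>P\<close> with \<open>\<kappa> : U \<rightarrow> Fun(P,A)\<close> is a cotensor of \<open>A\<close> by \<open>U\<close>: composition with \<open>\<kappa>\<close> is an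
  isomorphism \<open>Fun(X,P) \<cong> Fun(X,A)\<^sup>U\<close>, natural in \<open>X\<close>. By the Yoneda lemma every simplicially
  natural isomorphism arises from such a \<open>\<kappa>\<close>.
\<close>

definition cotensor_transpose ::
  "('o, 's, 'm) scat_scheme \<Rightarrow> 'u sset \<Rightarrow> 'o \<Rightarrow> 'o \<Rightarrow> (nat \<Rightarrow> 'u \<Rightarrow> 's) \<Rightarrow> 'o \<Rightarrow>
     nat \<Rightarrow> 's \<Rightarrow> (nat \<Rightarrow> 'u \<times> (nat \<Rightarrow> nat) \<Rightarrow> 's)" where
  "cotensor_transpose K U A P \<kappa> X n x =
     (\<lambda>m. \<lambda>(u, \<alpha>)\<in>simplices (sprod U (Delta n)) m.
        cmp K X P A m (\<kappa> m u) (act (Fun K X P) m n \<alpha> x))"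

definition is_cotensor ::
  "('o, 's, 'm) scat_scheme \<Rightarrow> 'u sset \<Rightarrow> 'o \<Rightarrow> 'o \<Rightarrow> (nat \<Rightarrow> 'u \<Rightarrow> 's) \<Rightarrow> bool" where
  "is_cotensor K U A P \<kappa> \<longleftrightarrow>
     A \<in> ob K \<and> P \<in> ob K \<and> simplicial_map U (Fun K P A) \<kappa> \<and>
     (\<forall>X\<in>ob K. sset_iso (Fun K X P) (sexp (Fun K X A) U) (cotensor_transpose K U A P \<kappa> X))"


section \<open>Infinity-cosmoi\<close>

text \<open>
  \<open>isofib K A B\<close> is the set of isofibrations \<open>A \<rightarrow> B\<close>; \<open>one\<close> is the terminal object;
  \<open>cotensor K A U\<close> is \<open>A\<^sup>U\<close>, with universal map \<open>cone K A U : U \<rightarrow> Fun(A\<^sup>U,A)\<close>.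

  The type \<open>'u\<close> plays the role of the universe of the simplicial sets used as cotensoring objects.
  It is kept apart from the type \<open>'s\<close> of simplices of the mapping spaces: powers indexed by
  a set of the size of \<open>'s\<close> itself would, for cardinality reasons, exist only if all \<open>Fun(A,B)\<close>
  were trivial. It is infinite so that \<open>\<Delta>\<^sup>n\<close>, \<open>\<I>\<close> and all countable simplicial sets occur.
\<close>

record ('o, 's, 'u) cosmos = "('o, 's) scat" +
  isofib :: "'o \<Rightarrow> 'o \<Rightarrow> 's set"
  one :: "'o"
  cotensor :: "'o \<Rightarrow> 'u sset \<Rightarrow> 'o"
  cone :: "'o \<Rightarrow> 'u sset \<Rightarrow> nat \<Rightarrow> 'u \<Rightarrow> 's"

text \<open>The functor \<open>X \<rightarrow> A\<^sup>U\<close> induced by a simplicial map \<open>\<phi> : U \<rightarrow> Fun(X,A)\<close>.\<close>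

definition cot_ind ::
  "('o, 's, 'u) cosmos \<Rightarrow> 'o \<Rightarrow> 'o \<Rightarrow> 'u sset \<Rightarrow> (nat \<Rightarrow> 'u \<Rightarrow> 's) \<Rightarrow> 's" where
  "cot_ind K X A U \<phi> =
     (THE h. h \<in> functors K X (cotensor K A U) \<and>
        (\<forall>n. \<forall>u\<in>simplices U n.
           cmp K X (cotensor K A U) A n (cone K A U n u) (degen (Fun K X (cotensor K A U)) n h) = \<phi> n u))"

text \<open>The functor \<open>p\<^sup>U : E\<^sup>U \<rightarrow> B\<^sup>U\<close> for \<open>p : E \<rightarrow> B\<close>.\<close>

definition cot_map :: "('o, 's, 'u) cosmos \<Rightarrow> 'o \<Rightarrow> 'o \<Rightarrow> 'u sset \<Rightarrow> 's \<Rightarrow> 's" where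
  "cot_map K E B U p =
     cot_ind K (cotensor K E U) B U (\<lambda>n u. postcomp K (cotensor K E U) E B p n (cone K E U n u))"

text \<open>The functor \<open>A\<^sup>i : A\<^sup>V \<rightarrow> A\<^sup>U\<close> for \<open>i : U \<rightarrow> V\<close>.\<close>

definition cot_res ::
  "('o, 's, 'u) cosmos \<Rightarrow> 'o \<Rightarrow> 'u sset \<Rightarrow> 'u sset \<Rightarrow> (nat \<Rightarrow> 'u \<Rightarrow> 'u) \<Rightarrow> 's" where
  "cot_res K A U V i = cot_ind K (cotensor K A V) A U (\<lambda>n u. cone K A V n (i n u))"

locale infinity_cosmos = simplicial_category K
  for K :: "('o, 's, 'u :: infinite) cosmos" +
  assumes Fun_qcat: "\<lbrakk>A \<in> ob K; B \<in> ob K\<rbrakk> \<Longrightarrow> quasi_category (Fun K A B)"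
    and isofib_functor: "\<lbrakk>A \<in> ob K; B \<in> ob K\<rbrakk> \<Longrightarrow> isofib K A B \<subseteq> functors K A B"
    and isofib_cmp: "\<lbrakk>A \<in> ob K; B \<in> ob K; C \<in> ob K; p \<in> isofib K A B; q \<in> isofib K B C\<rbrakk>
      \<Longrightarrow> cmp K A B C 0 q p \<in> isofib K A C"
    and one_terminal: "is_terminal K (one K)"
    and cot_cotensor: "\<lbrakk>A \<in> ob K; simplicial_set U\<rbrakk>
      \<Longrightarrow> is_cotensor K U A (cotensor K A U) (cone K A U)"
    and pullback_ex: "\<lbrakk>E \<in> ob K; A \<in> ob K; B \<in> ob K; p \<in> isofib K E B; f \<in> functors K A B\<rbrakk>
      \<Longrightarrow> \<exists>P q r. is_pullback K E A B p f P q r"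
    and isofib_iso: "\<lbrakk>A \<in> ob K; B \<in> ob K; is_isomorphism K A B f\<rbrakk> \<Longrightarrow> f \<in> isofib K A B"
    and isofib_one: "\<lbrakk>A \<in> ob K; f \<in> functors K A (one K)\<rbrakk> \<Longrightarrow> f \<in> isofib K A (one K)"
    and isofib_pullback: "\<lbrakk>p \<in> isofib K E B; is_pullback K E A B p f P q r\<rbrakk>
      \<Longrightarrow> r \<in> isofib K P A"
    and isofib_cotensor: "\<lbrakk>E \<in> ob K; B \<in> ob K; p \<in> isofib K E B;
        simplicial_set U; simplicial_set V; sset_mono U V i;
        is_pullback K (cotensor K E U) (cotensor K B V) (cotensor K B U)
          (cot_map K E B U p) (cot_res K B U V i) P q r;
        h \<in> functors K (cotensor K E V) P;
        cmp K (cotensor K E V) P (cotensor K E U) 0 q h = cot_res K E U V i;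
        cmp K (cotensor K E V) P (cotensor K B V) 0 r h = cot_map K E B V p\<rbrakk>
      \<Longrightarrow> h \<in> isofib K (cotensor K E V) P"
    and isofib_Fun: "\<lbrakk>X \<in> ob K; E \<in> ob K; B \<in> ob K; p \<in> isofib K E B\<rbrakk>
      \<Longrightarrow> qcat_isofibration (Fun K X E) (Fun K X B) (postcomp K X E B p)"


subsection \<open>Limits and colimits of diagrams\<close>

text \<open>
  \<open>\<Delta> : A \<rightarrow> A\<^sup>J\<close>, induced by the composite of \<open>J \<rightarrow> \<Delta>\<^sup>0\<close> with the vertex \<open>id\<^sub>A\<close> of \<open>Fun(A,A)\<close>.
\<close>

definition const_diagram :: "('o, 's, 'u) cosmos \<Rightarrow> 'u sset \<Rightarrow> 'o \<Rightarrow> 's" where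
  "const_diagram K J A = cot_ind K A A J (\<lambda>n u. degen (Fun K A A) n (idn K A))"

definition defines_limit ::
  "('o, 's, 'u) cosmos \<Rightarrow> 'u sset \<Rightarrow> 'o \<Rightarrow> 's \<Rightarrow> 's \<Rightarrow> bool" where
  "defines_limit K J A d l \<longleftrightarrow>
     (\<exists>lam. absolute_right_lifting (homotopy_2_category K)
              (one K) A (cotensor K A J) d (const_diagram K J A) l lam)"

definition defines_colimit ::
  "('o, 's, 'u) cosmos \<Rightarrow> 'u sset \<Rightarrow> 'o \<Rightarrow> 's \<Rightarrow> 's \<Rightarrow> bool" where
  "defines_colimit K J A d l \<longleftrightarrow>
     (\<exists>lam. absolute_left_lifting (homotopy_2_category K)
              (one K) A (cotensor K A J) d (const_diagram K J A) l lam)"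

definition admits_limit :: "('o, 's, 'u) cosmos \<Rightarrow> 'u sset \<Rightarrow> 'o \<Rightarrow> 's \<Rightarrow> bool" where
  "admits_limit K J A d \<longleftrightarrow> (\<exists>l\<in>functors K (one K) A. defines_limit K J A d l)"

definition admits_colimit :: "('o, 's, 'u) cosmos \<Rightarrow> 'u sset \<Rightarrow> 'o \<Rightarrow> 's \<Rightarrow> bool" where
  "admits_colimit K J A d \<longleftrightarrow> (\<exists>l\<in>functors K (one K) A. defines_colimit K J A d l)"


section \<open>Functors of infinity-cosmoi\<close>

record ('k, 'l, 's, 't) sfunctor =
  omap :: "'k \<Rightarrow> 'l"
  hmap :: "'k \<Rightarrow> 'k \<Rightarrow> nat \<Rightarrow> 's \<Rightarrow> 't"

locale simplicial_functor =
  K: simplicial_category K + L: simplicial_category L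
  for K :: "('k, 's, 'm) scat_scheme" and L :: "('l, 't, 'n) scat_scheme" +
  fixes F :: "('k, 'l, 's, 't) sfunctor"
  assumes omap_closed: "A \<in> ob K \<Longrightarrow> omap F A \<in> ob L"
    and hmap_simplicial: "\<lbrakk>A \<in> ob K; B \<in> ob K\<rbrakk>
      \<Longrightarrow> simplicial_map (Fun K A B) (Fun L (omap F A) (omap F B)) (hmap F A B)"
    and hmap_idn: "A \<in> ob K \<Longrightarrow> hmap F A A 0 (idn K A) = idn L (omap F A)"
    and hmap_cmp: "\<lbrakk>A \<in> ob K; B \<in> ob K; C \<in> ob K;
        f \<in> simplices (Fun K A B) n; g \<in> simplices (Fun K B C) n\<rbrakk>
      \<Longrightarrow> hmap F A C n (cmp K A B C n g f) =
          cmp L (omap F A) (omap F B) (omap F C) n (hmap F B C n g) (hmap F A B n f)"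

locale cosmos_functor =
  K: infinity_cosmos K + L: infinity_cosmos L + simplicial_functor K L F
  for K :: "('k, 's, 'u :: infinite) cosmos" and L :: "('l, 't, 'u) cosmos"
    and F :: "('k, 'l, 's, 't) sfunctor" +
  assumes preserves_isofib: "\<lbrakk>A \<in> ob K; B \<in> ob K; p \<in> isofib K A B\<rbrakk>
      \<Longrightarrow> hmap F A B 0 p \<in> isofib L (omap F A) (omap F B)"
    and preserves_terminal: "is_terminal L (omap F (one K))"
    and preserves_cotensor: "\<lbrakk>A \<in> ob K; simplicial_set U\<rbrakk>
      \<Longrightarrow> is_cotensor L U (omap F A) (omap F (cotensor K A U))
            (\<lambda>n u. hmap F (cotensor K A U) A n (cone K A U n u))"
    and preserves_pullback: "\<lbrakk>p \<in> isofib K E B; is_pullback K E A B p f P q r\<rbrakk>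
      \<Longrightarrow> is_pullback L (omap F E) (omap F A) (omap F B) (hmap F E B 0 p) (hmap F A B 0 f)
            (omap F P) (hmap F P E 0 q) (hmap F P A 0 r)"

locale cosmos_weak_equivalence = cosmos_functor K L F
  for K :: "('k, 's, 'u :: infinite) cosmos" and L :: "('l, 't, 'u) cosmos"
    and F :: "('k, 'l, 's, 't) sfunctor" +
  assumes essentially_surjective:
      "X \<in> ob L \<Longrightarrow> \<exists>A\<in>ob K. \<exists>e. is_equivalence L (omap F A) X e"
    and local_equivalence: "\<lbrakk>A \<in> ob K; B \<in> ob K\<rbrakk>
      \<Longrightarrow> qcat_equivalence (Fun K A B) (Fun L (omap F A) (omap F B)) (hmap F A B)"

text \<open>The canonical comparison \<open>1 \<cong> F1\<close>.\<close>

definition one_comparison ::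
  "('k, 's, 'u) cosmos \<Rightarrow> ('l, 't, 'u) cosmos \<Rightarrow> ('k, 'l, 's, 't) sfunctor \<Rightarrow> 't" where
  "one_comparison K L F = (THE t. t \<in> functors L (one L) (omap F (one K)))"

text \<open>The canonical comparison \<open>F(A\<^sup>J) \<cong> (FA)\<^sup>J\<close>.\<close>

definition cot_comparison ::
  "('k, 's, 'u) cosmos \<Rightarrow> ('l, 't, 'u) cosmos \<Rightarrow> ('k, 'l, 's, 't) sfunctor \<Rightarrow>
     'u sset \<Rightarrow> 'k \<Rightarrow> 't" where
  "cot_comparison K L F J A =
     cot_ind L (omap F (cotensor K A J)) (omap F A) J
       (\<lambda>n u. hmap F (cotensor K A J) A n (cone K A J n u))"

text \<open>For \<open>l : 1 \<rightarrow> A\<close>, the element \<open>1 \<cong> F1 \<rightarrow> FA\<close>.\<close>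

definition element_image ::
  "('k, 's, 'u) cosmos \<Rightarrow> ('l, 't, 'u) cosmos \<Rightarrow> ('k, 'l, 's, 't) sfunctor \<Rightarrow>
     'k \<Rightarrow> 's \<Rightarrow> 't" where
  "element_image K L F A l =
     cmp L (one L) (omap F (one K)) (omap F A) 0 (hmap F (one K) A 0 l) (one_comparison K L F)"

text \<open>For \<open>d : 1 \<rightarrow> A\<^sup>J\<close>, the diagram \<open>1 \<cong> F1 \<rightarrow> F(A\<^sup>J) \<cong> (FA)\<^sup>J\<close>.\<close>

definition diagram_image ::
  "('k, 's, 'u) cosmos \<Rightarrow> ('l, 't, 'u) cosmos \<Rightarrow> ('k, 'l, 's, 't) sfunctor \<Rightarrow>
     'u sset \<Rightarrow> 'k \<Rightarrow> 's \<Rightarrow> 't" where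
  "diagram_image K L F J A d =
     cmp L (one L) (omap F (cotensor K A J)) (cotensor L (omap F A) J) 0
       (cot_comparison K L F J A) (element_image K L F (cotensor K A J) d)"

end

theory Submission
  imports Defs
begin

text \<open>
  A weak equivalence of cosmoi induces a biequivalence of homotopy 2-categories: an equivalence of
  quasi-categories is fully faithful and essentially surjective on homotopy categories, and every
  object \<open>X\<close> of \<open>L\<close> is, up to an invertible 2-cell, a retract of some \<open>FA\<close>. Adjunctions and absolute
  liftings only involve whiskering and vertical composition. They are reflected since \<open>F\<close> is locally
  fully faithful, and absolute liftings are preserved since the bijection of 2-cells expressing the
  universal property can be tested on objects \<open>FA\<close> and 1-cells \<open>Ff\<close>: it transfers along invertible
  2-cells and along retracts. Right adjoints and colimits are the same statements in the dual
  2-category.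
\<close>

section \<open>Simplices, faces and horns\<close>

text \<open>2-cells are sets of edges, and every operation on them is a union over representatives.
  Each law is therefore reduced to statements about triangles with prescribed edges
  (\<open>tri\<close>), and these come from filling inner horns of dimensions 2 and 3. The retract
  arises because an equivalence \<open>e\<close> from \<open>FA\<close> to \<open>X\<close> is
  tested through \<open>Fun(X, e)\<close>: essential surjectivity of that map at the identity of
  \<open>X\<close> yields \<open>e'\<close> with \<open>e e'\<close> isomorphic to the identity.
  This one composite suffices, so no pseudo-inverse of \<open>e\<close> is built. Two kinds of
  comparison are kept apart. A functor between images under \<open>F\<close> is itself an image only
  up to an invertible 2-cell, which calls for the invariance of adjunctions and liftings under such
  2-cells. The comparisons of \<open>1\<close> with \<open>F1\<close> and of the two cotensors are
  isomorphisms on the nose, so liftings cross them by composition with strict inverses.\<close>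

lemma OpI: "\<lbrakk>\<And>i. i \<le> m \<Longrightarrow> f i \<le> n; \<And>i j. i \<le> j \<Longrightarrow> j \<le> m \<Longrightarrow> f i \<le> f j\<rbrakk>
  \<Longrightarrow> (\<lambda>i\<in>{..m}. f i) \<in> Op m n"
  by (auto simp: Op_def mono_on_def)

lemma Op_le: "\<alpha> \<in> Op m n \<Longrightarrow> i \<le> m \<Longrightarrow> \<alpha> i \<le> n"
  by (auto simp: Op_def)

lemma Op_mono: "\<alpha> \<in> Op m n \<Longrightarrow> i \<le> j \<Longrightarrow> j \<le> m \<Longrightarrow> \<alpha> i \<le> \<alpha> j"
  by (auto simp: Op_def mono_on_def)

lemma Op_restrict: "\<alpha> \<in> Op m n \<Longrightarrow> (\<lambda>i\<in>{..m}. \<alpha> i) = \<alpha>"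
  by (auto simp: Op_def PiE_def extensional_restrict)

lemma compose_Op: "\<lbrakk>\<alpha> \<in> Op m n; \<beta> \<in> Op k m\<rbrakk> \<Longrightarrow> compose {..k} \<alpha> \<beta> \<in> Op k n"
  unfolding compose_def by (rule OpI) (auto intro: Op_le Op_mono)

lemma id_Op: "(\<lambda>i\<in>{..n}. i) \<in> Op n n"
  by (rule OpI) auto

lemma zero_Op: "(\<lambda>i\<in>{..n}. 0) \<in> Op n m"
  by (rule OpI) auto

lemma Op_0: "\<alpha> \<in> Op n 0 \<Longrightarrow> \<alpha> = (\<lambda>i\<in>{..n}. 0)"
  by (metis (no_types, lifting) Op_le Op_restrict atMost_iff le_zero_eq restrict_ext)

text \<open>Indexed by the dimension of its source, so that the truncated subtraction in
  \<open>face\<close> is avoided; \<open>face_Suc\<close> is the translation.\<close>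

definition coface :: "nat \<Rightarrow> nat \<Rightarrow> nat \<Rightarrow> nat" where
  "coface m i = (\<lambda>j\<in>{..m}. if j < i then j else Suc j)"

lemma coface_Op: "coface m i \<in> Op m (Suc m)"
  unfolding coface_def by (rule OpI) auto

text \<open>Omitting vertex 1 of \<open>[1]\<close> leaves vertex 0 and conversely, so face 1 of an
  edge is its source and face 0 its target.\<close>

lemma coface_0_eq: "coface 0 (Suc 0) = (\<lambda>i\<in>{..0}. 0)" "coface 0 0 = (\<lambda>i\<in>{..0}. 1)"
  by (auto simp: coface_def fun_eq_iff)

lemma face_Suc: "face X (Suc m) i x = act X m (Suc m) (coface m i) x"
  by (simp add: face_def coface_def)

lemma face_2: "face X 2 i x = act X 1 2 (coface 1 i) x"
  using face_Suc[of X 1] by (simp add: numeral_2_eq_2)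

lemma simplicial_mapD:
  assumes "simplicial_map X Y f"
  shows "x \<in> simplices X n \<Longrightarrow> f n x \<in> simplices Y n"
    and "\<alpha> \<in> Op m n \<Longrightarrow> x \<in> simplices X n \<Longrightarrow> f m (act X m n \<alpha> x) = act Y m n \<alpha> (f n x)"
  using assms by (auto simp: simplicial_map_def)

lemma simplicial_map_face:
  assumes "simplicial_map X Y f" "x \<in> simplices X (Suc m)"
  shows "f m (face X (Suc m) i x) = face Y (Suc m) i (f (Suc m) x)"
  using assms coface_Op by (simp add: face_Suc simplicial_mapD(2))

lemma simplicial_map_degen:
  assumes "simplicial_map X Y f" "x \<in> simplices X 0"
  shows "f m (degen X m x) = degen Y m (f 0 x)"
  using assms zero_Op by (simp add: degen_def simplicial_mapD(2))

lemma simplicial_map_comp: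
  assumes "simplicial_map X Y f" "simplicial_map Y Z g"
  shows "simplicial_map X Z (\<lambda>n x. g n (f n x))"
  using assms by (auto simp: simplicial_map_def Pi_def)

context simplicial_set
begin

lemma act_act:
  "\<lbrakk>\<alpha> \<in> Op m n; \<beta> \<in> Op k m; x \<in> simplices X n\<rbrakk>
    \<Longrightarrow> act X k m \<beta> (act X m n \<alpha> x) = act X k n (compose {..k} \<alpha> \<beta>) x"
  by (simp add: act_compose)

lemma face_closed: "x \<in> simplices X (Suc m) \<Longrightarrow> face X (Suc m) i x \<in> simplices X m"
  by (simp add: face_Suc act_closed coface_Op)

lemma degen_closed: "x \<in> simplices X 0 \<Longrightarrow> degen X m x \<in> simplices X m"
  by (simp add: degen_def act_closed zero_Op)

lemma act_degen: 
  assumes "\<alpha> \<in> Op k m" "x \<in> simplices X 0"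
  shows "act X k m \<alpha> (degen X m x) = degen X k x"
proof -
  have "compose {..k} (\<lambda>i\<in>{..m}. 0) \<alpha> = (\<lambda>i\<in>{..k}. 0 :: nat)"
    using Op_le[OF assms(1)] by (auto simp: compose_def fun_eq_iff)
  then show ?thesis
    using assms by (simp add: degen_def act_act zero_Op)
qed

lemma degen_0: "x \<in> simplices X 0 \<Longrightarrow> degen X 0 x = x"
  using act_id[of x 0] Op_0[OF id_Op[of 0]] by (simp add: degen_def)

end

text \<open>A simplex of a horn misses some vertex \<open>j\<close> and therefore factors through the \<open>j\<close>-th coface;
  the compatibility of the faces makes the value independent of \<open>j\<close>.\<close>

lemma (in quasi_category) horn_filler_faces:
  assumes k: "0 < k" "k < Suc n"
    and y: "\<And>j. j \<le> Suc n \<Longrightarrow> j \<noteq> k \<Longrightarrow> y j \<in> simplices X n"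
    and compat: "\<And>i j. i < j \<Longrightarrow> j \<le> Suc n \<Longrightarrow> i \<noteq> k \<Longrightarrow> j \<noteq> k
                   \<Longrightarrow> face X n i (y j) = face X n (j - 1) (y i)"
  shows "\<exists>\<sigma>\<in>simplices X (Suc n). \<forall>j\<le>Suc n. j \<noteq> k \<longrightarrow> face X (Suc n) j \<sigma> = y j"
proof -
  \<comment> \<open>If \<open>\<alpha>\<close> misses \<open>j\<close>, closing the gap at
    \<open>j\<close> loses nothing: \<open>fac m \<alpha> j\<close> is then the factor of
    \<open>\<alpha>\<close> through the \<open>j\<close>-th coface.\<close>
  define fac where "fac m \<alpha> j = (\<lambda>i\<in>{..m}. if \<alpha> i < j then \<alpha> i else \<alpha> i - 1)"
    for m :: nat and \<alpha> :: "nat \<Rightarrow> nat" and j :: nat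
  have fac_Op: "fac m \<alpha> j \<in> Op m n" if "\<alpha> \<in> Op m (Suc n)" "j \<le> Suc n" "j \<notin> \<alpha> ` {..m}" for m \<alpha> j
    unfolding fac_def
  proof (rule OpI)
    fix i assume "i \<le> m"
    then have "\<alpha> i \<noteq> j" "\<alpha> i \<le> Suc n" using that Op_le[OF that(1)] by auto
    then show "(if \<alpha> i < j then \<alpha> i else \<alpha> i - 1) \<le> n" using that(2) by auto
  next
    fix i i' assume *: "i \<le> i'" "i' \<le> m"
    then have "\<alpha> i \<noteq> j" "\<alpha> i' \<noteq> j" "\<alpha> i \<le> \<alpha> i'" using that Op_mono[OF that(1)] by auto
    then show "(if \<alpha> i < j then \<alpha> i else \<alpha> i - 1) \<le> (if \<alpha> i' < j then \<alpha> i' else \<alpha> i' - 1)"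
      by auto
  qed
  have indep: "act X m n (fac m \<alpha> i) (y i) = act X m n (fac m \<alpha> j) (y j)"
    if "\<alpha> \<in> Op m (Suc n)" "i < j" "j \<le> Suc n" "i \<noteq> k" "j \<noteq> k" "i \<notin> \<alpha> ` {..m}" "j \<notin> \<alpha> ` {..m}" for m \<alpha> i j
  proof -
    have "n \<noteq> 0" using k that by auto
    then obtain p where p: "n = Suc p" by (cases n) auto
    \<comment> \<open>\<open>\<alpha>\<close> misses both \<open>i\<close> and \<open>j\<close>, so
      it factors through the face of codimension two omitting them, and \<open>\<gamma>\<close> is
      that factor. Facts 1 and 2 reach it through either face, and \<open>compat\<close> equates the
      two restrictions.\<close>
    define \<gamma> where "\<gamma> = (\<lambda>l\<in>{..m}. if \<alpha> l < i then \<alpha> l else if \<alpha> l < j then \<alpha> l - 1 else \<alpha> l - 2)"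
    have ne: "\<alpha> l \<noteq> i \<and> \<alpha> l \<noteq> j \<and> \<alpha> l \<le> Suc n" if "l \<le> m" for l
      using that \<open>i \<notin> \<alpha> ` {..m}\<close> \<open>j \<notin> \<alpha> ` {..m}\<close> Op_le[OF \<open>\<alpha> \<in> Op m (Suc n)\<close>] by auto
    have \<gamma>: "\<gamma> \<in> Op m p"
      unfolding \<gamma>_def
    proof (rule OpI)
      fix l assume "l \<le> m"
      from ne[OF this] show "(if \<alpha> l < i then \<alpha> l else if \<alpha> l < j then \<alpha> l - 1 else \<alpha> l - 2) \<le> p"
        using that(2,3) p by auto
    next
      fix l l' assume "l \<le> l'" "l' \<le> m"
      then have "\<alpha> l \<le> \<alpha> l'" using Op_mono[OF that(1)] by auto
      then show "(if \<alpha> l < i then \<alpha> l else if \<alpha> l < j then \<alpha> l - 1 else \<alpha> l - 2)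
        \<le> (if \<alpha> l' < i then \<alpha> l' else if \<alpha> l' < j then \<alpha> l' - 1 else \<alpha> l' - 2)"
        using ne[of l] ne[of l'] \<open>l \<le> l'\<close> \<open>l' \<le> m\<close> that(2) by auto
    qed
    have \<gamma>_le: "\<gamma> l \<le> p" if "l \<le> m" for l using Op_le[OF \<gamma> that] .
    have 1: "fac m \<alpha> i = compose {..m} (coface p (j - 1)) \<gamma>"
    proof
      fix l show "fac m \<alpha> i l = compose {..m} (coface p (j - 1)) \<gamma> l"
      proof (cases "l \<le> m")
        case True
        then show ?thesis using ne[OF True] \<gamma>_le[OF True] that(2)
          by (auto simp: fac_def compose_def coface_def \<gamma>_def)
      qed (simp add: fac_def compose_def)
    qed
    have 2: "fac m \<alpha> j = compose {..m} (coface p i) \<gamma>"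
    proof
      fix l show "fac m \<alpha> j l = compose {..m} (coface p i) \<gamma> l"
      proof (cases "l \<le> m")
        case True
        then show ?thesis using ne[OF True] \<gamma>_le[OF True] that(2)
          by (auto simp: fac_def compose_def coface_def \<gamma>_def)
      qed (simp add: fac_def compose_def)
    qed
    have "act X m n (fac m \<alpha> i) (y i) = act X m p \<gamma> (face X n (j - 1) (y i))"
      unfolding 1 p face_Suc using that y[of i] p by (intro act_compose coface_Op \<gamma>) auto
    also have "\<dots> = act X m p \<gamma> (face X n i (y j))"
      using compat that by simp
    also have "\<dots> = act X m n (fac m \<alpha> j) (y j)"
      unfolding 2 p face_Suc using that y[of j] p by (intro act_compose[symmetric] coface_Op \<gamma>) auto
    finally show ?thesis .
  qed
  define miss where "miss m \<alpha> j \<longleftrightarrow> j \<le> Suc n \<and> j \<noteq> k \<and> j \<notin> \<alpha> ` {..m}"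
    for m :: nat and \<alpha> :: "nat \<Rightarrow> nat" and j
  define h where "h m \<alpha> = act X m n (fac m \<alpha> (SOME j. miss m \<alpha> j)) (y (SOME j. miss m \<alpha> j))" for m \<alpha>
  have h: "h m \<alpha> = act X m n (fac m \<alpha> j) (y j)" if "\<alpha> \<in> Op m (Suc n)" "miss m \<alpha> j" for m \<alpha> j
  proof -
    obtain j' where j': "j' = (SOME j. miss m \<alpha> j)" by blast
    have "miss m \<alpha> j'" unfolding j' using that(2) by (rule someI)
    have "act X m n (fac m \<alpha> j') (y j') = act X m n (fac m \<alpha> j) (y j)"
    proof (cases j j' rule: linorder_cases)
      case less
      with indep[OF that(1) less] that(2) \<open>miss m \<alpha> j'\<close> show ?thesis by (auto simp: miss_def)
    next
      case greater
      with indep[OF that(1) greater] that(2) \<open>miss m \<alpha> j'\<close> show ?thesis by (auto simp: miss_def)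
    qed simp
    then show ?thesis unfolding h_def j' .
  qed
  have smap: "simplicial_map (horn (Suc n) k) X h"
    unfolding simplicial_map_def
  proof (intro conjI allI ballI)
    fix m
    show "h m \<in> simplices (horn (Suc n) k) m \<rightarrow> simplices X m"
    proof
      fix \<alpha> assume "\<alpha> \<in> simplices (horn (Suc n) k) m"
      then obtain j where a: "\<alpha> \<in> Op m (Suc n)" "miss m \<alpha> j" by (auto simp: horn_def miss_def)
      then have "act X m n (fac m \<alpha> j) (y j) \<in> simplices X m"
        by (intro act_closed fac_Op y) (auto simp: miss_def)
      then show "h m \<alpha> \<in> simplices X m" by (simp add: h[OF a])
    qed
  next
    fix l m \<beta> \<alpha> assume \<beta>: "\<beta> \<in> Op l m" and "\<alpha> \<in> simplices (horn (Suc n) k) m"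
    then obtain j where a: "\<alpha> \<in> Op m (Suc n)" "miss m \<alpha> j" by (auto simp: horn_def miss_def)
    have c: "compose {..l} \<alpha> \<beta> \<in> Op l (Suc n)" using a(1) \<beta> by (rule compose_Op)
    have mi: "miss l (compose {..l} \<alpha> \<beta>) j"
      using a(2) Op_le[OF \<beta>] by (auto simp: miss_def compose_def)
    have e: "fac l (compose {..l} \<alpha> \<beta>) j = compose {..l} (fac m \<alpha> j) \<beta>"
      using Op_le[OF \<beta>] by (auto simp: fac_def compose_def fun_eq_iff)
    have "h l (compose {..l} \<alpha> \<beta>) = act X l m \<beta> (h m \<alpha>)"
      unfolding h[OF c mi] h[OF a] e using a \<beta>
      by (intro act_compose fac_Op y) (auto simp: miss_def)
    then show "h l (act (horn (Suc n) k) l m \<beta> \<alpha>) = act X l m \<beta> (h m \<alpha>)"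
      by (simp add: horn_def)
  qed
  obtain s where s: "simplicial_map (Delta (Suc n)) X s"
    and sh: "\<And>m \<alpha>. \<alpha>\<in>simplices (horn (Suc n) k) m \<Longrightarrow> s m \<alpha> = h m \<alpha>"
    using inner_horn_filler[OF k smap] by blast
  \<comment> \<open>By the Yoneda lemma the filler is determined by its value at the identity of
    \<open>[n + 1]\<close>, whose \<open>j\<close>-th face is the value at the \<open>j\<close>-th
    coface.\<close>
  let ?\<iota> = "\<lambda>i\<in>{..Suc n}. i"
  have \<iota>: "?\<iota> \<in> simplices (Delta (Suc n)) (Suc n)" by (simp add: Delta_def id_Op)
  show ?thesis
  proof (intro bexI allI impI)
    show "s (Suc n) ?\<iota> \<in> simplices X (Suc n)" using s \<iota> by (rule simplicial_mapD(1))
    fix j assume j: "j \<le> Suc n" "j \<noteq> k"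
    have miss: "miss n (coface n j) j" using j by (auto simp: miss_def coface_def)
    have "compose {..n} ?\<iota> (coface n j) = coface n j"
      by (auto simp: compose_def coface_def fun_eq_iff)
    then have "face X (Suc n) j (s (Suc n) ?\<iota>) = s n (coface n j)"
      using simplicial_mapD(2)[OF s coface_Op[of n j] \<iota>] by (simp add: face_Suc Delta_def)
    also have "\<dots> = h n (coface n j)"
      using miss by (intro sh) (auto simp: horn_def coface_Op miss_def)
    also have "\<dots> = act X n n (fac n (coface n j) j) (y j)"
      using miss by (intro h coface_Op)
    also have "fac n (coface n j) j = (\<lambda>i\<in>{..n}. i)"
      by (auto simp: fac_def coface_def fun_eq_iff)
    finally show "face X (Suc n) j (s (Suc n) ?\<iota>) = y j" unfolding act_id[OF y[OF j]] .
  qed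
qed

section \<open>The homotopy category of a quasi-category\<close>

text \<open>The edge \<open>c\<close> is a composite of \<open>a\<close> followed by \<open>b\<close>.\<close>

definition tri :: "'a sset \<Rightarrow> 'a \<Rightarrow> 'a \<Rightarrow> 'a \<Rightarrow> bool" where
  "tri X a b c \<longleftrightarrow>
     (\<exists>\<sigma>\<in>simplices X 2. face X 2 2 \<sigma> = a \<and> face X 2 0 \<sigma> = b \<and> face X 2 1 \<sigma> = c)"

lemma triI: "\<lbrakk>\<sigma> \<in> simplices X 2; face X 2 2 \<sigma> = a; face X 2 0 \<sigma> = b; face X 2 1 \<sigma> = c\<rbrakk> \<Longrightarrow> tri X a b c"
  by (auto simp: tri_def)

lemma triE:
  assumes "tri X a b c"
  obtains \<sigma> where "\<sigma> \<in> simplices X 2" "face X 2 2 \<sigma> = a" "face X 2 0 \<sigma> = b" "face X 2 1 \<sigma> = c"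
  using assms by (auto simp: tri_def)

lemma simplicial_map_tri:
  assumes f: "simplicial_map X Y f" and t: "tri X a b c"
  shows "tri Y (f 1 a) (f 1 b) (f 1 c)"
proof -
  obtain \<sigma> where \<sigma>: "\<sigma> \<in> simplices X 2" "face X 2 2 \<sigma> = a" "face X 2 0 \<sigma> = b" "face X 2 1 \<sigma> = c"
    using t by (rule triE)
  have "face Y 2 i (f 2 \<sigma>) = f 1 (face X 2 i \<sigma>)" for i
    using simplicial_map_face[OF f, of \<sigma> 1] \<sigma>(1) by (simp add: numeral_2_eq_2)
  then show ?thesis
    using \<sigma> simplicial_mapD(1)[OF f \<sigma>(1)] by (intro triI[of "f 2 \<sigma>"]) simp_all
qed

lemma simplicial_map_edges:
  "simplicial_map X Y f \<Longrightarrow> e \<in> edges X x y \<Longrightarrow> f 1 e \<in> edges Y (f 0 x) (f 0 y)"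
  using simplicial_map_face[of X Y f _ 0] by (auto simp: edges_def dest: simplicial_mapD(1))

lemma act_sprod: "act (sprod X Y) m n \<alpha> (x, y) = (act X m n \<alpha> x, act Y m n \<alpha> y)"
  by (simp add: sprod_def)

lemma simplices_sprod: "simplices (sprod X Y) n = simplices X n \<times> simplices Y n"
  by (simp add: sprod_def)

lemma face_sprod: "face (sprod X Y) n i (x, y) = (face X n i x, face Y n i y)"
  by (simp add: face_def act_sprod)

lemma degen_sprod: "degen (sprod X Y) n (x, y) = (degen X n x, degen Y n y)"
  by (simp add: degen_def act_sprod)

lemma tri_sprod: "tri X a b c \<Longrightarrow> tri Y a' b' c' \<Longrightarrow> tri (sprod X Y) (a, a') (b, b') (c, c')"
  by (auto simp: tri_def simplices_sprod face_sprod)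

lemma edges_sprod: "(e, e') \<in> edges (sprod X Y) (x, x') (y, y') \<longleftrightarrow> e \<in> edges X x y \<and> e' \<in> edges Y x' y'"
  by (auto simp: edges_def simplices_sprod face_sprod)

lemma (in simplicial_set) face_face:
  assumes "x \<in> simplices X (Suc (Suc m))" "i < j" "j \<le> Suc (Suc m)"
  shows "face X (Suc m) i (face X (Suc (Suc m)) j x) = face X (Suc m) (j - 1) (face X (Suc (Suc m)) i x)"
proof -
  have "compose {..m} (coface (Suc m) j) (coface m i) = compose {..m} (coface (Suc m) i) (coface m (j - 1))"
    using assms(2,3) by (auto simp: coface_def compose_def fun_eq_iff)
  then show ?thesis
    using assms(1) by (simp add: face_Suc act_act coface_Op)
qed

section \<open>Boundaries of triangles and degenerate triangles\<close>

context simplicial_set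
begin

lemma face_face_2:
  assumes "\<sigma> \<in> simplices X 2"
  shows "face X 1 1 (face X 2 2 \<sigma>) = face X 1 1 (face X 2 1 \<sigma>)"
    and "face X 1 0 (face X 2 2 \<sigma>) = face X 1 1 (face X 2 0 \<sigma>)"
    and "face X 1 0 (face X 2 1 \<sigma>) = face X 1 0 (face X 2 0 \<sigma>)"
  using face_face[of \<sigma> 0 1 2] face_face[of \<sigma> 0 0 2] face_face[of \<sigma> 0 0 1] assms
  by (simp_all add: numeral_2_eq_2)

lemma edges_vertices: "e \<in> edges X x y \<Longrightarrow> x \<in> simplices X 0 \<and> y \<in> simplices X 0"
  using face_closed[of e 0] by (auto simp: edges_def)

lemma tri_edges:
  assumes "tri X a b c" "a \<in> edges X x y"
  obtains z where "b \<in> edges X y z" "c \<in> edges X x z"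
proof -
  obtain \<sigma> where \<sigma>: "\<sigma> \<in> simplices X 2" "face X 2 2 \<sigma> = a" "face X 2 0 \<sigma> = b" "face X 2 1 \<sigma> = c"
    using assms(1) by (rule triE)
  have "b \<in> simplices X 1" "c \<in> simplices X 1"
    using face_closed[of \<sigma> 1] \<sigma> by (auto simp: numeral_2_eq_2)
  then show thesis
    using that[of "face X 1 0 b"] face_face_2[OF \<sigma>(1)] \<sigma>(2-4) assms(2) by (simp add: edges_def)
qed

lemma tri_third_edge: "\<lbrakk>tri X a b c; a \<in> edges X x y; b \<in> edges X y z\<rbrakk> \<Longrightarrow> c \<in> edges X x z"
  by (erule (1) tri_edges) (auto simp: edges_def)

text \<open>Rewrites the degenerate edge at an endpoint as an action on \<open>e\<close> itself, the
  form in which the faces of the degenerate triangles in \<open>tri_degen\<close> appear.\<close>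

lemma degen_face_1:
  assumes "e \<in> simplices X 1"
  shows "degen X 1 (face X 1 1 e) = act X 1 1 (\<lambda>i\<in>{..1}. 0) e"
    and "degen X 1 (face X 1 0 e) = act X 1 1 (\<lambda>i\<in>{..1}. 1) e"
proof -
  have "compose {..1} (\<lambda>i\<in>{..0::nat}. 0) (\<lambda>i\<in>{..1}. 0) = (\<lambda>i\<in>{..1::nat}. 0::nat)"
       "compose {..1} (\<lambda>i\<in>{..0::nat}. 1) (\<lambda>i\<in>{..1}. 0) = (\<lambda>i\<in>{..1::nat}. 1::nat)"
    by (simp_all add: compose_def restrict_def fun_eq_iff)
  moreover have "(\<lambda>i\<in>{..0::nat}. 0) \<in> Op 0 1" "(\<lambda>i\<in>{..0::nat}. 1) \<in> Op 0 1"
    by (rule OpI; simp)+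
  ultimately show "degen X 1 (face X 1 1 e) = act X 1 1 (\<lambda>i\<in>{..1}. 0) e"
    and "degen X 1 (face X 1 0 e) = act X 1 1 (\<lambda>i\<in>{..1}. 1) e"
    using assms zero_Op[of 1 0] by (simp_all add: degen_def face_Suc coface_0_eq act_act)
qed

lemma degen_edge: 
  assumes "x \<in> simplices X 0" shows "degen X 1 x \<in> edges X x x"
  using assms degen_closed[OF assms, of 1]
  by (simp add: edges_def face_Suc act_degen coface_Op degen_0)

lemma tri_degen:
  assumes "e \<in> edges X x y"
  shows "tri X (degen X 1 x) e e" and "tri X e (degen X 1 y) e"
proof -
  have e: "e \<in> simplices X 1" "face X 1 1 e = x" "face X 1 0 e = y" using assms by (auto simp: edges_def)
  \<comment> \<open>\<open>s 1\<close> and \<open>s 0\<close> are the two codegeneracies from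
    \<open>[2]\<close> to \<open>[1]\<close>, repeating vertex 0 and vertex 1 respectively.\<close>
  define s where "s k = (\<lambda>i\<in>{..2}. if i \<le> k then 0 else 1 :: nat)" for k :: nat
  have s: "s k \<in> Op 2 1" for k unfolding s_def by (rule OpI) auto
  have c: "coface 1 j \<in> Op 1 2" for j using coface_Op[of 1 j] by (simp add: numeral_2_eq_2)
  have faces: "face X 2 j (act X 2 1 (s k) e) = act X 1 1 (compose {..1} (s k) (coface 1 j)) e" for j k
    using e(1) s c by (simp add: face_2 act_act)
  have eqs: "compose {..1} (s 1) (coface 1 0) = (\<lambda>i\<in>{..1}. i)"
       "compose {..1} (s 1) (coface 1 1) = (\<lambda>i\<in>{..1}. i)"
       "compose {..1} (s 1) (coface 1 2) = (\<lambda>i\<in>{..1}. 0)"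
       "compose {..1} (s 0) (coface 1 0) = (\<lambda>i\<in>{..1}. 1)"
       "compose {..1} (s 0) (coface 1 1) = (\<lambda>i\<in>{..1}. i)"
       "compose {..1} (s 0) (coface 1 2) = (\<lambda>i\<in>{..1}. i)"
    by (auto simp: compose_def fun_eq_iff s_def coface_def le_Suc_eq)
  show "tri X (degen X 1 x) e e"
    using act_closed[OF s e(1), of 1] degen_face_1[OF e(1)] e act_id[OF e(1)]
    by (intro triI[of "act X 2 1 (s 1) e"]) (simp_all only: faces eqs)
  show "tri X e (degen X 1 y) e"
    using act_closed[OF s e(1), of 0] degen_face_1[OF e(1)] e act_id[OF e(1)]
    by (intro triI[of "act X 2 1 (s 0) e"]) (simp_all only: faces eqs)
qed

end

section \<open>Composition of edges from fillers of inner horns\<close>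

context quasi_category
begin

text \<open>The inner horn of dimension 2 has \<open>b\<close> as face 0 and \<open>a\<close> as
  face 2; face 1 of a filler is the composite.\<close>

lemma tri_fill:
  assumes "a \<in> edges X x y" "b \<in> edges X y z"
  obtains c where "tri X a b c" "c \<in> edges X x z"
proof -
  have "\<exists>\<sigma>\<in>simplices X (Suc 1). \<forall>j\<le>Suc 1. j \<noteq> 1 \<longrightarrow> face X (Suc 1) j \<sigma> = (if j = 0 then b else a)"
  proof (rule horn_filler_faces)
    fix i j :: nat assume "i < j" "j \<le> Suc 1" "i \<noteq> 1" "j \<noteq> 1"
    then have "i = 0" "j = 2" by auto
    then show "face X 1 i (if j = 0 then b else a) = face X 1 (j - 1) (if i = 0 then b else a)"
      using assms by (simp add: edges_def)
  qed (use assms in \<open>auto simp: edges_def\<close>)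
  then obtain \<sigma> where "\<sigma> \<in> simplices X 2" "face X 2 2 \<sigma> = a" "face X 2 0 \<sigma> = b"
    by (auto simp: numeral_2_eq_2)
  then have "tri X a b (face X 2 1 \<sigma>)" by (auto simp: tri_def)
  with that tri_third_edge assms show thesis by blast
qed

text \<open>\<open>eij\<close> is the edge from vertex \<open>i\<close> to vertex \<open>j\<close>
  of a 3-simplex. The assumptions are its faces 3, 0 and 2, which form the inner horn at 1; the
  conclusion is the missing face of a filler.\<close>

lemma tri_horn_1:
  assumes "tri X e01 e12 e02" "tri X e12 e23 e13" "tri X e01 e13 e03"
  shows "tri X e02 e23 e03"
proof -
  obtain \<sigma>3 where 3: "\<sigma>3 \<in> simplices X 2" "face X 2 2 \<sigma>3 = e01" "face X 2 0 \<sigma>3 = e12" "face X 2 1 \<sigma>3 = e02"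
    using assms(1) by (rule triE)
  obtain \<sigma>0 where 0: "\<sigma>0 \<in> simplices X 2" "face X 2 2 \<sigma>0 = e12" "face X 2 0 \<sigma>0 = e23" "face X 2 1 \<sigma>0 = e13"
    using assms(2) by (rule triE)
  obtain \<sigma>2 where 2: "\<sigma>2 \<in> simplices X 2" "face X 2 2 \<sigma>2 = e01" "face X 2 0 \<sigma>2 = e13" "face X 2 1 \<sigma>2 = e03"
    using assms(3) by (rule triE)
  define y where "y j = (if j = 0 then \<sigma>0 else if j = 2 then \<sigma>2 else \<sigma>3)" for j :: nat
  have "\<exists>\<tau>\<in>simplices X (Suc 2). \<forall>j\<le>Suc 2. j \<noteq> 1 \<longrightarrow> face X (Suc 2) j \<tau> = y j"
  proof (rule horn_filler_faces)
    fix i j :: nat assume "i < j" "j \<le> Suc 2" "i \<noteq> 1" "j \<noteq> 1"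
    then have "(i,j) \<in> {(0,2),(0,3),(2,3)}" by auto
    then show "face X 2 i (y j) = face X 2 (j - 1) (y i)"
      using 0 2 3 by (auto simp: y_def)
  qed (use 0 2 3 in \<open>auto simp: y_def\<close>)
  then obtain \<tau> where \<tau>: "\<tau> \<in> simplices X (Suc (Suc 1))" "face X 3 0 \<tau> = \<sigma>0" "face X 3 2 \<tau> = \<sigma>2" "face X 3 3 \<tau> = \<sigma>3"
    by (auto simp: y_def numeral_eq_Suc) 
  show ?thesis
  proof (rule triI[of "face X 3 1 \<tau>"])
    show "face X 3 1 \<tau> \<in> simplices X 2" using face_closed[of \<tau> 2 1] \<tau> by (simp add: numeral_eq_Suc)
  qed (use 0 2 3 \<tau> face_face[OF \<tau>(1), of 1 3] face_face[OF \<tau>(1), of 0 1] face_face[OF \<tau>(1), of 1 2] in \<open>simp_all add: numeral_eq_Suc\<close>)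
qed

text \<open>The companion for the inner horn at 2: faces 3, 0 and 1 are given and face 2 is
  obtained. With \<open>tri_horn_1\<close> it carries uniqueness, congruence and associativity of
  composition.\<close>

lemma tri_horn_2:
  assumes "tri X e01 e12 e02" "tri X e12 e23 e13" "tri X e02 e23 e03"
  shows "tri X e01 e13 e03"
proof -
  obtain \<sigma>3 where 3: "\<sigma>3 \<in> simplices X 2" "face X 2 2 \<sigma>3 = e01" "face X 2 0 \<sigma>3 = e12" "face X 2 1 \<sigma>3 = e02"
    using assms(1) by (rule triE)
  obtain \<sigma>0 where 0: "\<sigma>0 \<in> simplices X 2" "face X 2 2 \<sigma>0 = e12" "face X 2 0 \<sigma>0 = e23" "face X 2 1 \<sigma>0 = e13"
    using assms(2) by (rule triE)
  obtain \<sigma>1 where 1: "\<sigma>1 \<in> simplices X 2" "face X 2 2 \<sigma>1 = e02" "face X 2 0 \<sigma>1 = e23" "face X 2 1 \<sigma>1 = e03"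
    using assms(3) by (rule triE)
  define y where "y j = (if j = 0 then \<sigma>0 else if j = 1 then \<sigma>1 else \<sigma>3)" for j :: nat
  have "\<exists>\<tau>\<in>simplices X (Suc 2). \<forall>j\<le>Suc 2. j \<noteq> 2 \<longrightarrow> face X (Suc 2) j \<tau> = y j"
  proof (rule horn_filler_faces)
    fix i j :: nat assume "i < j" "j \<le> Suc 2" "i \<noteq> 2" "j \<noteq> 2"
    then have "(i,j) \<in> {(0,1),(0,3),(1,3)}" by auto
    then show "face X 2 i (y j) = face X 2 (j - 1) (y i)"
      using 0 1 3 by (auto simp: y_def)
  qed (use 0 1 3 in \<open>auto simp: y_def\<close>)
  then obtain \<tau> where \<tau>: "\<tau> \<in> simplices X (Suc (Suc 1))" "face X 3 0 \<tau> = \<sigma>0" "face X 3 1 \<tau> = \<sigma>1" "face X 3 3 \<tau> = \<sigma>3"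
    by (auto simp: y_def numeral_eq_Suc) 
  show ?thesis
  proof (rule triI[of "face X 3 2 \<tau>"])
    show "face X 3 2 \<tau> \<in> simplices X 2" using face_closed[of \<tau> 2 2] \<tau> by (simp add: numeral_eq_Suc)
  qed (use 0 1 3 \<tau> face_face[OF \<tau>(1), of 2 3] face_face[OF \<tau>(1), of 0 2] face_face[OF \<tau>(1), of 1 2] in \<open>simp_all add: numeral_eq_Suc\<close>)
qed

text \<open>A 3-simplex whose last edge is degenerate compares the two composites.\<close>

lemma tri_unique:
  assumes "b \<in> edges X y z" "tri X a b c" "tri X a b c'"
  shows "tri X c (degen X 1 z) c'"
  using tri_horn_1 assms(2) tri_degen(2)[OF assms(1)] assms(3) .

text \<open>The sides are exchanged for homotopic ones in the order \<open>c\<close>,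
  \<open>b\<close>, \<open>a\<close>, each inside one filled horn of dimension 3 that has the
  relevant homotopy as a face.\<close>

lemma tri_cong:
  assumes "a \<in> edges X x y" "b \<in> edges X y z" "tri X a b c"
    and "tri X a (degen X 1 y) a'" "tri X b (degen X 1 z) b'" "tri X c (degen X 1 z) c'"
  shows "tri X a' b' c'"
proof -
  have c: "c \<in> edges X x z" using tri_third_edge assms by blast
  have "tri X a b c'" by (rule tri_horn_2[OF assms(3) tri_degen(2)[OF assms(2)] assms(6)])
  have c': "c' \<in> edges X x z" using c assms(6) tri_third_edge degen_edge edges_vertices by blast
  have "tri X a b' c'" by (rule tri_horn_2[OF \<open>tri X a b c'\<close> assms(5) tri_degen(2)[OF c']])
  have "b' \<in> edges X y z" using assms(2,5) tri_third_edge degen_edge edges_vertices by blast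
  then show ?thesis using tri_horn_1[OF assms(4) tri_degen(1) \<open>tri X a b' c'\<close>] by blast
qed

text \<open>Both \<open>c'\<close> and \<open>c\<close> are composites of \<open>c\<close> with the
  degenerate edge, and \<open>tri_unique\<close> compares two composites in either order.\<close>

lemma tri_sym:
  assumes "c \<in> edges X x y" "tri X c (degen X 1 y) c'"
  shows "tri X c' (degen X 1 y) c"
  by (rule tri_unique[OF degen_edge assms(2) tri_degen(2)[OF assms(1)]])
    (use assms edges_vertices in blast)

text \<open>Once reversed, the first homotopy makes \<open>c\<close> a composite of
  \<open>c'\<close> with the degenerate edge, just as \<open>c''\<close> is one.\<close>

lemma tri_trans:
  assumes "c \<in> edges X x y" "tri X c (degen X 1 y) c'" "tri X c' (degen X 1 y) c''"
  shows "tri X c (degen X 1 y) c''"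
proof -
  have c': "c' \<in> edges X x y" using assms(1,2) tri_third_edge degen_edge edges_vertices by blast
  show ?thesis
    by (rule tri_unique[OF degen_edge tri_sym[OF assms(1,2)] assms(3)])
      (use assms edges_vertices in blast)
qed

section \<open>Homotopy classes of edges as morphisms of a category\<close>

lemma mem_ho_class:
  assumes "e \<in> edges X x y"
  shows "e' \<in> ho_class X e \<longleftrightarrow> tri X e (degen X 1 y) e'"
proof
  assume "e' \<in> ho_class X e"
  then show "tri X e (degen X 1 y) e'"
    using assms by (auto simp: ho_class_def homotopic_def edges_def tri_def)
next
  assume "tri X e (degen X 1 y) e'"
  moreover have "e' \<in> edges X x y"
    using calculation assms tri_third_edge degen_edge edges_vertices by blast
  ultimately show "e' \<in> ho_class X e"
    using assms edges_vertices[OF assms] by (auto simp: ho_class_def homotopic_def tri_def)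
qed

lemma ho_class_edges: "e \<in> edges X x y \<Longrightarrow> e' \<in> ho_class X e \<Longrightarrow> e' \<in> edges X x y"
  by (auto simp: ho_class_def homotopic_def edges_def)

lemma ho_class_self: "e \<in> edges X x y \<Longrightarrow> e \<in> ho_class X e"
  using mem_ho_class tri_degen(2) by blast

lemma ho_class_eqI:
  assumes "e \<in> edges X x y" "tri X e (degen X 1 y) e'"
  shows "ho_class X e = ho_class X e'"
proof -
  have e': "e' \<in> edges X x y" using assms tri_third_edge degen_edge edges_vertices by blast
  show ?thesis
    using mem_ho_class[OF assms(1)] mem_ho_class[OF e'] tri_trans tri_sym assms e' by blast
qed

lemma ho_homI: "e \<in> edges X x y \<Longrightarrow> ho_class X e \<in> ho_hom X x y"
  by (simp add: ho_hom_def)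

lemma ho_homE:
  assumes "\<alpha> \<in> ho_hom X x y"
  obtains e where "e \<in> edges X x y" "\<alpha> = ho_class X e"
  using assms by (auto simp: ho_hom_def)

text \<open>\<open>ho_comp\<close> runs over all representatives. A triangle on homotopic sides is
  moved back to the sides \<open>a\<close> and \<open>b\<close> by \<open>tri_cong\<close>, so its
  inner face is homotopic to \<open>c\<close>; conversely every edge homotopic to \<open>c\<close>
  is itself an inner face over \<open>a\<close> and \<open>b\<close>.\<close>

lemma ho_comp_class:
  assumes a: "a \<in> edges X x y" and b: "b \<in> edges X y z" and t: "tri X a b c"
  shows "ho_comp X (ho_class X b) (ho_class X a) = ho_class X c"
proof -
  have c: "c \<in> edges X x z" using tri_third_edge assms by blast
  have "c' \<in> ho_comp X (ho_class X b) (ho_class X a) \<longleftrightarrow> tri X c (degen X 1 z) c'" for c'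
  proof
    assume "c' \<in> ho_comp X (ho_class X b) (ho_class X a)"
    then obtain a' b' where *: "a' \<in> ho_class X a" "b' \<in> ho_class X b" "tri X a' b' c'"
      by (auto simp: ho_comp_def tri_def)
    have "a' \<in> edges X x y" "b' \<in> edges X y z" using * a b ho_class_edges by blast+
    moreover have "c' \<in> edges X x z" using calculation * tri_third_edge by blast
    ultimately have "tri X a b c'"
      using tri_cong[OF _ _ *(3) tri_sym[OF a] tri_sym[OF b] tri_degen(2)] *(1,2) mem_ho_class[OF a] mem_ho_class[OF b]
      by blast
    then show "tri X c (degen X 1 z) c'" using tri_unique[OF b t] by blast
  next
    assume "tri X c (degen X 1 z) c'"
    then have "tri X a b c'" using tri_horn_2[OF t tri_degen(2)[OF b]] by blast
    then show "c' \<in> ho_comp X (ho_class X b) (ho_class X a)"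
      using ho_class_self[OF a] ho_class_self[OF b] by (fastforce simp: ho_comp_def tri_def)
  qed
  then show ?thesis using mem_ho_class[OF c] by blast
qed

lemma ho_comp_closed:
  assumes "\<alpha> \<in> ho_hom X x y" "\<beta> \<in> ho_hom X y z"
  shows "ho_comp X \<beta> \<alpha> \<in> ho_hom X x z"
proof -
  obtain a b where e: "a \<in> edges X x y" "\<alpha> = ho_class X a" "b \<in> edges X y z" "\<beta> = ho_class X b"
    using assms by (meson ho_homE)
  obtain c where "tri X a b c" "c \<in> edges X x z" using e(1,3) by (rule tri_fill)
  then show ?thesis unfolding e by (simp add: ho_comp_class[OF e(1,3)] ho_homI)
qed

lemma ho_id_closed: "x \<in> simplices X 0 \<Longrightarrow> ho_id X x \<in> ho_hom X x x"
  unfolding ho_id_def by (intro ho_homI degen_edge)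

lemma ho_comp_id_right:
  assumes "\<alpha> \<in> ho_hom X x y" shows "ho_comp X \<alpha> (ho_id X x) = \<alpha>"
proof -
  obtain a where "a \<in> edges X x y" "\<alpha> = ho_class X a" using assms by (rule ho_homE)
  then show ?thesis
    unfolding ho_id_def using ho_comp_class[OF degen_edge _ tri_degen(1)] edges_vertices by blast
qed

lemma ho_comp_id_left:
  assumes "\<alpha> \<in> ho_hom X x y" shows "ho_comp X (ho_id X y) \<alpha> = \<alpha>"
proof -
  obtain a where "a \<in> edges X x y" "\<alpha> = ho_class X a" using assms by (rule ho_homE)
  then show ?thesis
    unfolding ho_id_def using ho_comp_class[OF _ degen_edge tri_degen(2)] edges_vertices by blast
qed

text \<open>\<open>tri_horn_2\<close> shows that a composite of \<open>ab\<close> with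
  \<open>c\<close> is also one of \<open>a\<close> with \<open>bc\<close>, so the two bracketings
  share a representative.\<close>

lemma ho_comp_assoc:
  assumes "\<alpha> \<in> ho_hom X w x" "\<beta> \<in> ho_hom X x y" "\<gamma> \<in> ho_hom X y z"
  shows "ho_comp X \<gamma> (ho_comp X \<beta> \<alpha>) = ho_comp X (ho_comp X \<gamma> \<beta>) \<alpha>"
proof -
  obtain a b c where e: "a \<in> edges X w x" "\<alpha> = ho_class X a" "b \<in> edges X x y" "\<beta> = ho_class X b"
    "c \<in> edges X y z" "\<gamma> = ho_class X c"
    using assms by (metis ho_homE)
  obtain ab where ab: "tri X a b ab" "ab \<in> edges X w y" using e tri_fill by blast
  obtain bc where bc: "tri X b c bc" "bc \<in> edges X x z" using e tri_fill by blast
  obtain abc where abc: "tri X ab c abc" using e ab tri_fill by blast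
  have "tri X a bc abc" by (rule tri_horn_2[OF ab(1) bc(1) abc])
  then show ?thesis
    using e ab bc abc by (simp add: ho_comp_class[of a w x b y ab] ho_comp_class[of b x y c z bc]
      ho_comp_class[of a w x bc z abc] ho_comp_class[of ab w y c z abc])
qed

end

section \<open>Absolute liftings and adjunctions in a 2-category\<close>

text \<open>Whiskerings stand in for horizontal composition, with \<open>interchange\<close> as
  their compatibility. Reversing 2-cells permutes the laws up to exchanging sides of equations, so
  the dual is again an instance.\<close>

locale two_category =
  fixes T :: "('o, 'f, 'c) two_cat"
  assumes id1_closed: "A \<in> ob2 T \<Longrightarrow> id1 T A \<in> cells1 T A A"
    and comp1_closed: "\<lbrakk>A \<in> ob2 T; B \<in> ob2 T; C \<in> ob2 T; f \<in> cells1 T A B; g \<in> cells1 T B C\<rbrakk>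
      \<Longrightarrow> comp1 T A B C g f \<in> cells1 T A C"
    and comp1_assoc: "\<lbrakk>A \<in> ob2 T; B \<in> ob2 T; C \<in> ob2 T; D \<in> ob2 T;
        f \<in> cells1 T A B; g \<in> cells1 T B C; h \<in> cells1 T C D\<rbrakk>
      \<Longrightarrow> comp1 T A C D h (comp1 T A B C g f) = comp1 T A B D (comp1 T B C D h g) f"
    and comp1_id_left: "\<lbrakk>A \<in> ob2 T; B \<in> ob2 T; f \<in> cells1 T A B\<rbrakk>
      \<Longrightarrow> comp1 T A B B (id1 T B) f = f"
    and comp1_id_right: "\<lbrakk>A \<in> ob2 T; B \<in> ob2 T; f \<in> cells1 T A B\<rbrakk>
      \<Longrightarrow> comp1 T A A B f (id1 T A) = f"
    and cells2_boundary: "\<lbrakk>A \<in> ob2 T; B \<in> ob2 T; \<alpha> \<in> cells2 T A B f g\<rbrakk>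
      \<Longrightarrow> f \<in> cells1 T A B \<and> g \<in> cells1 T A B"
    and id2_closed: "\<lbrakk>A \<in> ob2 T; B \<in> ob2 T; f \<in> cells1 T A B\<rbrakk>
      \<Longrightarrow> id2 T A B f \<in> cells2 T A B f f"
    and vcomp_closed: "\<lbrakk>A \<in> ob2 T; B \<in> ob2 T; \<alpha> \<in> cells2 T A B f g; \<beta> \<in> cells2 T A B g h\<rbrakk>
      \<Longrightarrow> vcomp T A B \<beta> \<alpha> \<in> cells2 T A B f h"
    and vcomp_assoc: "\<lbrakk>A \<in> ob2 T; B \<in> ob2 T;
        \<alpha> \<in> cells2 T A B f g; \<beta> \<in> cells2 T A B g h; \<gamma> \<in> cells2 T A B h k\<rbrakk>
      \<Longrightarrow> vcomp T A B \<gamma> (vcomp T A B \<beta> \<alpha>) = vcomp T A B (vcomp T A B \<gamma> \<beta>) \<alpha>"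
    and vcomp_id_left: "\<lbrakk>A \<in> ob2 T; B \<in> ob2 T; \<alpha> \<in> cells2 T A B f g\<rbrakk>
      \<Longrightarrow> vcomp T A B (id2 T A B g) \<alpha> = \<alpha>"
    and vcomp_id_right: "\<lbrakk>A \<in> ob2 T; B \<in> ob2 T; \<alpha> \<in> cells2 T A B f g\<rbrakk>
      \<Longrightarrow> vcomp T A B \<alpha> (id2 T A B f) = \<alpha>"
    and lwhisker_closed: "\<lbrakk>A \<in> ob2 T; B \<in> ob2 T; C \<in> ob2 T; \<alpha> \<in> cells2 T A B f g; h \<in> cells1 T B C\<rbrakk>
      \<Longrightarrow> lwhisker T A B C h \<alpha> \<in> cells2 T A C (comp1 T A B C h f) (comp1 T A B C h g)"
    and lwhisker_id: "\<lbrakk>A \<in> ob2 T; B \<in> ob2 T; C \<in> ob2 T; f \<in> cells1 T A B; h \<in> cells1 T B C\<rbrakk>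
      \<Longrightarrow> lwhisker T A B C h (id2 T A B f) = id2 T A C (comp1 T A B C h f)"
    and lwhisker_vcomp: "\<lbrakk>A \<in> ob2 T; B \<in> ob2 T; C \<in> ob2 T; h \<in> cells1 T B C;
        \<alpha> \<in> cells2 T A B f g; \<beta> \<in> cells2 T A B g k\<rbrakk>
      \<Longrightarrow> lwhisker T A B C h (vcomp T A B \<beta> \<alpha>) =
          vcomp T A C (lwhisker T A B C h \<beta>) (lwhisker T A B C h \<alpha>)"
    and lwhisker_comp: "\<lbrakk>A \<in> ob2 T; B \<in> ob2 T; C \<in> ob2 T; D \<in> ob2 T;
        \<alpha> \<in> cells2 T A B f g; h \<in> cells1 T B C; k \<in> cells1 T C D\<rbrakk>
      \<Longrightarrow> lwhisker T A B D (comp1 T B C D k h) \<alpha> = lwhisker T A C D k (lwhisker T A B C h \<alpha>)"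
    and lwhisker_id1: "\<lbrakk>A \<in> ob2 T; B \<in> ob2 T; \<alpha> \<in> cells2 T A B f g\<rbrakk>
      \<Longrightarrow> lwhisker T A B B (id1 T B) \<alpha> = \<alpha>"
    and rwhisker_closed: "\<lbrakk>A \<in> ob2 T; B \<in> ob2 T; C \<in> ob2 T; \<alpha> \<in> cells2 T B C f g; h \<in> cells1 T A B\<rbrakk>
      \<Longrightarrow> rwhisker T A B C \<alpha> h \<in> cells2 T A C (comp1 T A B C f h) (comp1 T A B C g h)"
    and rwhisker_id: "\<lbrakk>A \<in> ob2 T; B \<in> ob2 T; C \<in> ob2 T; f \<in> cells1 T B C; h \<in> cells1 T A B\<rbrakk>
      \<Longrightarrow> rwhisker T A B C (id2 T B C f) h = id2 T A C (comp1 T A B C f h)"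
    and rwhisker_vcomp: "\<lbrakk>A \<in> ob2 T; B \<in> ob2 T; C \<in> ob2 T; h \<in> cells1 T A B;
        \<alpha> \<in> cells2 T B C f g; \<beta> \<in> cells2 T B C g k\<rbrakk>
      \<Longrightarrow> rwhisker T A B C (vcomp T B C \<beta> \<alpha>) h =
          vcomp T A C (rwhisker T A B C \<beta> h) (rwhisker T A B C \<alpha> h)"
    and rwhisker_comp: "\<lbrakk>A \<in> ob2 T; B \<in> ob2 T; C \<in> ob2 T; D \<in> ob2 T;
        \<alpha> \<in> cells2 T C D f g; k \<in> cells1 T A B; h \<in> cells1 T B C\<rbrakk>
      \<Longrightarrow> rwhisker T A C D \<alpha> (comp1 T A B C h k) = rwhisker T A B D (rwhisker T B C D \<alpha> h) k"
    and rwhisker_id1: "\<lbrakk>A \<in> ob2 T; B \<in> ob2 T; \<alpha> \<in> cells2 T A B f g\<rbrakk>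
      \<Longrightarrow> rwhisker T A A B \<alpha> (id1 T A) = \<alpha>"
    and lwhisker_rwhisker: "\<lbrakk>A \<in> ob2 T; B \<in> ob2 T; C \<in> ob2 T; D \<in> ob2 T;
        \<alpha> \<in> cells2 T B C f g; k \<in> cells1 T A B; h \<in> cells1 T C D\<rbrakk>
      \<Longrightarrow> lwhisker T A C D h (rwhisker T A B C \<alpha> k) = rwhisker T A B D (lwhisker T B C D h \<alpha>) k"
    and interchange: "\<lbrakk>A \<in> ob2 T; B \<in> ob2 T; C \<in> ob2 T;
        \<alpha> \<in> cells2 T A B h k; \<beta> \<in> cells2 T B C f g\<rbrakk>
      \<Longrightarrow> vcomp T A C (rwhisker T A B C \<beta> k) (lwhisker T A B C f \<alpha>) =
          vcomp T A C (lwhisker T A B C g \<alpha>) (rwhisker T A B C \<beta> h)"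

section \<open>Invertible 2-cells and duality\<close>

definition inverse2 :: "('o, 'f, 'c) two_cat \<Rightarrow> 'o \<Rightarrow> 'o \<Rightarrow> 'f \<Rightarrow> 'f \<Rightarrow> 'c \<Rightarrow> 'c \<Rightarrow> bool" where
  "inverse2 T A B f g \<kappa> \<kappa>' \<longleftrightarrow>
     \<kappa> \<in> cells2 T A B f g \<and> \<kappa>' \<in> cells2 T A B g f \<and>
     vcomp T A B \<kappa>' \<kappa> = id2 T A B f \<and> vcomp T A B \<kappa> \<kappa>' = id2 T A B g"

lemma co_dual_simps [simp]:
  "ob2 (co_dual T) = ob2 T" "cells1 (co_dual T) = cells1 T" "id1 (co_dual T) = id1 T"
  "comp1 (co_dual T) = comp1 T" "id2 (co_dual T) = id2 T" "hcomp (co_dual T) = hcomp T"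
  "cells2 (co_dual T) A B f g = cells2 T A B g f"
  "vcomp (co_dual T) A B \<beta> \<alpha> = vcomp T A B \<alpha> \<beta>"
  "lwhisker (co_dual T) = lwhisker T" "rwhisker (co_dual T) = rwhisker T"
  by (auto simp: co_dual_def lwhisker_def rwhisker_def fun_eq_iff)

lemma inverse2_co_dual: "inverse2 (co_dual T) A B f g \<kappa> \<kappa>' \<longleftrightarrow> inverse2 T A B f g \<kappa>' \<kappa>"
  by (auto simp: inverse2_def)

lemma inverse2_sym: "inverse2 T A B f g \<kappa> \<kappa>' \<longleftrightarrow> inverse2 T A B g f \<kappa>' \<kappa>"
  by (auto simp: inverse2_def)

lemma two_category_co_dual:
  assumes "two_category T" shows "two_category (co_dual T)"
proof -
  interpret two_category T by fact
  show ?thesis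
    by unfold_locales
      (auto intro: id1_closed comp1_closed comp1_assoc comp1_id_left comp1_id_right id2_closed
         vcomp_closed vcomp_assoc[symmetric] vcomp_id_left vcomp_id_right lwhisker_closed lwhisker_id
         lwhisker_vcomp lwhisker_comp lwhisker_id1 rwhisker_closed rwhisker_id rwhisker_vcomp
         rwhisker_comp rwhisker_id1 lwhisker_rwhisker interchange[symmetric]
         dest: cells2_boundary)
qed

lemma is_adjunction_co_dual:
  "is_adjunction (co_dual T) A B f u \<eta> \<epsilon> \<longleftrightarrow> is_adjunction T B A u f \<epsilon> \<eta>"
  by (auto simp: is_adjunction_def)

lemma admits_right_adjoint_co_dual:
  "admits_right_adjoint T A B u \<longleftrightarrow> admits_left_adjoint (co_dual T) A B u"
  by (auto simp: admits_right_adjoint_def admits_left_adjoint_def left_adjoint_to_def is_adjunction_co_dual)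

text \<open>Turns the unique existence in \<open>absolute_right_lifting\<close> into bijectivity,
  which can be composed with and cancelled against other bijections.\<close>

lemma bij_betw_iff_ex1:
  assumes "h \<in> S \<rightarrow> R"
  shows "bij_betw h S R \<longleftrightarrow> (\<forall>y\<in>R. \<exists>!x. x \<in> S \<and> y = h x)"
proof
  assume b: "bij_betw h S R"
  show "\<forall>y\<in>R. \<exists>!x. x \<in> S \<and> y = h x"
  proof
    fix y assume "y \<in> R"
    then obtain x where "x \<in> S" "y = h x" using b by (auto simp: bij_betw_def)
    then show "\<exists>!x. x \<in> S \<and> y = h x" using b by (auto simp: bij_betw_def inj_on_def)
  qed
next
  assume e: "\<forall>y\<in>R. \<exists>!x. x \<in> S \<and> y = h x"
  have "inj_on h S" using e assms by (intro inj_onI) (metis funcset_mem)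
  moreover have "R \<subseteq> h ` S" using e by blast
  ultimately show "bij_betw h S R" using assms by (auto simp: bij_betw_def)
qed

section \<open>Absolute liftings as families of bijections\<close>

definition lift_map ::
  "('o, 'f, 'c) two_cat \<Rightarrow> 'o \<Rightarrow> 'o \<Rightarrow> 'o \<Rightarrow> 'o \<Rightarrow> 'f \<Rightarrow> 'c \<Rightarrow> 'f \<Rightarrow> 'c \<Rightarrow> 'c" where
  "lift_map T X C B A f lam c \<zeta> = vcomp T X A (rwhisker T X C A lam c) (lwhisker T X B A f \<zeta>)"

text \<open>The universal property at one test object and one pair of test 1-cells, the unit in
  which it is transferred.\<close>

definition lifts_at ::
  "('o, 'f, 'c) two_cat \<Rightarrow> 'o \<Rightarrow> 'o \<Rightarrow> 'o \<Rightarrow> 'f \<Rightarrow> 'f \<Rightarrow> 'f \<Rightarrow> 'c \<Rightarrow> 'o \<Rightarrow> 'f \<Rightarrow> 'f \<Rightarrow> bool" where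
  "lifts_at T C B A g f l lam X c b \<longleftrightarrow>
     bij_betw (lift_map T X C B A f lam c)
       (cells2 T X B b (comp1 T X C B l c)) (cells2 T X A (comp1 T X B A f b) (comp1 T X C A g c))"

locale lifting_data = two_category +
  fixes C B A g f l lam
  assumes obs: "C \<in> ob2 T" "B \<in> ob2 T" "A \<in> ob2 T"
    and ones: "g \<in> cells1 T C A" "f \<in> cells1 T B A" "l \<in> cells1 T C B"
    and lam: "lam \<in> cells2 T C A (comp1 T C B A f l) g"
begin

abbreviation "lift \<equiv> (\<lambda>X. lift_map T X C B A f lam)"

lemma lam_whisker:
  assumes "X \<in> ob2 T" "c \<in> cells1 T X C"
  shows "rwhisker T X C A lam c \<in> cells2 T X A (comp1 T X B A f (comp1 T X C B l c)) (comp1 T X C A g c)"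
  using rwhisker_closed[OF assms(1) obs(1,3) lam assms(2)]
  by (simp add: comp1_assoc[OF assms(1) obs assms(2) ones(3,2)])

lemma lift_closed:
  assumes "X \<in> ob2 T" "c \<in> cells1 T X C" "\<zeta> \<in> cells2 T X B b (comp1 T X C B l c)"
  shows "lift X c \<zeta> \<in> cells2 T X A (comp1 T X B A f b) (comp1 T X C A g c)"
  unfolding lift_map_def
  by (rule vcomp_closed[OF assms(1) obs(3) lwhisker_closed[OF assms(1) obs(2,3) assms(3) ones(2)]
        lam_whisker[OF assms(1,2)]])

lemma absolute_right_lifting_iff:
  "absolute_right_lifting T C B A g f l lam \<longleftrightarrow>
    (\<forall>X\<in>ob2 T. \<forall>c\<in>cells1 T X C. \<forall>b\<in>cells1 T X B. lifts_at T C B A g f l lam X c b)"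
proof -
  have "(\<forall>\<chi>\<in>cells2 T X A (comp1 T X B A f b) (comp1 T X C A g c).
          \<exists>!\<zeta>. \<zeta> \<in> cells2 T X B b (comp1 T X C B l c) \<and>
               \<chi> = vcomp T X A (rwhisker T X C A lam c) (lwhisker T X B A f \<zeta>))
      \<longleftrightarrow> lifts_at T C B A g f l lam X c b" if "X \<in> ob2 T" "c \<in> cells1 T X C" for X c b
    unfolding lifts_at_def lift_map_def[symmetric]
    by (rule bij_betw_iff_ex1[symmetric]) (use lift_closed[OF that] in blast)
  then show ?thesis
    using obs ones lam by (auto simp: absolute_right_lifting_def)
qed

text \<open>Pasting with \<open>lam\<close> is natural in both test 1-cells, covariantly in
  \<open>c\<close> and contravariantly in \<open>b\<close>; through this, invertible 2-cells act on
  lifting problems.\<close>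

lemma lift_natural:
  assumes X: "X \<in> ob2 T" and \<gamma>: "\<gamma> \<in> cells2 T X C c' c" and \<delta>: "\<delta> \<in> cells2 T X B b b'"
    and \<zeta>: "\<zeta> \<in> cells2 T X B b' (comp1 T X C B l c')"
  shows "lift X c (vcomp T X B (lwhisker T X C B l \<gamma>) (vcomp T X B \<zeta> \<delta>)) =
    vcomp T X A (lwhisker T X C A g \<gamma>) (vcomp T X A (lift X c' \<zeta>) (lwhisker T X B A f \<delta>))"
proof -
  let ?v = "vcomp T X A"
  have c: "c' \<in> cells1 T X C" "c \<in> cells1 T X C" using cells2_boundary[OF X obs(1) \<gamma>] by auto
  have lg: "lwhisker T X C B l \<gamma> \<in> cells2 T X B (comp1 T X C B l c') (comp1 T X C B l c)"
    by (rule lwhisker_closed[OF X obs(1,2) \<gamma> ones(3)])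
  have flg: "lwhisker T X B A f (lwhisker T X C B l \<gamma>)
      \<in> cells2 T X A (comp1 T X B A f (comp1 T X C B l c')) (comp1 T X B A f (comp1 T X C B l c))"
    by (rule lwhisker_closed[OF X obs(2,3) lg ones(2)])
  have gg: "lwhisker T X C A g \<gamma> \<in> cells2 T X A (comp1 T X C A g c') (comp1 T X C A g c)"
    by (rule lwhisker_closed[OF X obs(1,3) \<gamma> ones(1)])
  note f\<zeta> = lwhisker_closed[OF X obs(2,3) \<zeta> ones(2)]
  note f\<delta> = lwhisker_closed[OF X obs(2,3) \<delta> ones(2)]
  note fz = vcomp_closed[OF X obs(3) f\<delta> f\<zeta>]
  note \<zeta>\<delta> = vcomp_closed[OF X obs(2) \<delta> \<zeta>]
  have "lift X c (vcomp T X B (lwhisker T X C B l \<gamma>) (vcomp T X B \<zeta> \<delta>)) =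
    ?v (rwhisker T X C A lam c) (?v (lwhisker T X B A f (lwhisker T X C B l \<gamma>))
      (?v (lwhisker T X B A f \<zeta>) (lwhisker T X B A f \<delta>)))"
    by (simp add: lift_map_def lwhisker_vcomp[OF X obs(2,3) ones(2) \<zeta>\<delta> lg]
        lwhisker_vcomp[OF X obs(2,3) ones(2) \<delta> \<zeta>])
  also have "\<dots> = ?v (?v (rwhisker T X C A lam c) (lwhisker T X B A f (lwhisker T X C B l \<gamma>)))
      (?v (lwhisker T X B A f \<zeta>) (lwhisker T X B A f \<delta>))"
    by (rule vcomp_assoc[OF X obs(3) fz flg lam_whisker[OF X c(2)]])
  \<comment> \<open>The only place where \<open>\<gamma>\<close> passes \<open>lam\<close>:
    interchange turns whiskering by \<open>f l\<close> into whiskering by \<open>g\<close>. The rest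
    is reassociation.\<close>
  also have "?v (rwhisker T X C A lam c) (lwhisker T X B A f (lwhisker T X C B l \<gamma>))
      = ?v (lwhisker T X C A g \<gamma>) (rwhisker T X C A lam c')"
    using interchange[OF X obs(1,3) \<gamma> lam]
    by (simp add: lwhisker_comp[OF X obs \<gamma> ones(3,2)])
  also have "?v \<dots> (?v (lwhisker T X B A f \<zeta>) (lwhisker T X B A f \<delta>))
    = ?v (lwhisker T X C A g \<gamma>) (?v (rwhisker T X C A lam c')
         (?v (lwhisker T X B A f \<zeta>) (lwhisker T X B A f \<delta>)))"
    by (rule vcomp_assoc[OF X obs(3) fz lam_whisker[OF X c(1)] gg, symmetric])
  also have "?v (rwhisker T X C A lam c') (?v (lwhisker T X B A f \<zeta>) (lwhisker T X B A f \<delta>))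
    = ?v (lift X c' \<zeta>) (lwhisker T X B A f \<delta>)"
    unfolding lift_map_def by (rule vcomp_assoc[OF X obs(3) f\<delta> f\<zeta> lam_whisker[OF X c(1)]])
  finally show ?thesis .
qed

text \<open>Naturality in the test object: restriction along \<open>e\<close> commutes with pasting,
  so the lifting problem at \<open>X\<close> can be compared with one at \<open>Y\<close>.\<close>

lemma lift_rwhisker:
  assumes X: "X \<in> ob2 T" and Y: "Y \<in> ob2 T" and e: "e \<in> cells1 T Y X" and c: "c \<in> cells1 T X C"
    and \<zeta>: "\<zeta> \<in> cells2 T X B b (comp1 T X C B l c)"
  shows "lift Y (comp1 T Y X C c e) (rwhisker T Y X B \<zeta> e) = rwhisker T Y X A (lift X c \<zeta>) e"
  unfolding lift_map_def
  by (simp add: rwhisker_vcomp[OF Y X obs(3) e lwhisker_closed[OF X obs(2,3) \<zeta> ones(2)] lam_whisker[OF X c]]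
      lwhisker_rwhisker[OF Y X obs(2,3) \<zeta> e ones(2)] rwhisker_comp[OF Y X obs(1,3) lam e c])

end

context two_category
begin

lemma inverse2_cancel:
  assumes "A \<in> ob2 T" "B \<in> ob2 T" "inverse2 T A B f g \<kappa> \<kappa>'"
  shows "\<alpha> \<in> cells2 T A B h f \<Longrightarrow> vcomp T A B \<kappa>' (vcomp T A B \<kappa> \<alpha>) = \<alpha>"
    and "\<alpha> \<in> cells2 T A B f h \<Longrightarrow> vcomp T A B (vcomp T A B \<alpha> \<kappa>') \<kappa> = \<alpha>"
  using assms vcomp_assoc[OF assms(1,2), of \<alpha> h f \<kappa> g \<kappa>' f] vcomp_id_left[OF assms(1,2)]
    vcomp_assoc[OF assms(1,2), of \<kappa> f g \<kappa>' f \<alpha> h] vcomp_id_right[OF assms(1,2)]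
  by (simp_all add: inverse2_def)

lemma inverse2_lwhisker:
  assumes "A \<in> ob2 T" "B \<in> ob2 T" "C \<in> ob2 T" "inverse2 T A B f g \<kappa> \<kappa>'" "h \<in> cells1 T B C"
  shows "inverse2 T A C (comp1 T A B C h f) (comp1 T A B C h g)
           (lwhisker T A B C h \<kappa>) (lwhisker T A B C h \<kappa>')"
proof -
  have k: "\<kappa> \<in> cells2 T A B f g" "\<kappa>' \<in> cells2 T A B g f" using assms(4) by (auto simp: inverse2_def)
  then have "f \<in> cells1 T A B" "g \<in> cells1 T A B" using cells2_boundary assms(1,2) by blast+
  then show ?thesis
    using assms lwhisker_closed[OF assms(1-3) k(1) assms(5)] lwhisker_closed[OF assms(1-3) k(2) assms(5)]
      lwhisker_vcomp[OF assms(1-3,5) k] lwhisker_vcomp[OF assms(1-3,5) k(2,1)]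
    by (simp add: inverse2_def lwhisker_id)
qed

lemma inverse2_rwhisker:
  assumes "A \<in> ob2 T" "B \<in> ob2 T" "C \<in> ob2 T" "inverse2 T B C f g \<kappa> \<kappa>'" "h \<in> cells1 T A B"
  shows "inverse2 T A C (comp1 T A B C f h) (comp1 T A B C g h)
           (rwhisker T A B C \<kappa> h) (rwhisker T A B C \<kappa>' h)"
proof -
  have k: "\<kappa> \<in> cells2 T B C f g" "\<kappa>' \<in> cells2 T B C g f" using assms(4) by (auto simp: inverse2_def)
  then have "f \<in> cells1 T B C" "g \<in> cells1 T B C" using cells2_boundary assms(2,3) by blast+
  then show ?thesis
    using assms rwhisker_closed[OF assms(1-3) k(1) assms(5)] rwhisker_closed[OF assms(1-3) k(2) assms(5)]
      rwhisker_vcomp[OF assms(1-3,5) k] rwhisker_vcomp[OF assms(1-3,5) k(2,1)]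
    by (simp add: inverse2_def rwhisker_id)
qed

lemma conjugate_bij:
  assumes X: "X \<in> ob2 T" and B: "B \<in> ob2 T"
    and \<kappa>: "inverse2 T X B p p' \<kappa> \<kappa>'" and \<mu>: "inverse2 T X B q q' \<mu> \<mu>'"
  shows "bij_betw (\<lambda>\<zeta>. vcomp T X B \<mu> (vcomp T X B \<zeta> \<kappa>')) (cells2 T X B p q) (cells2 T X B p' q')"
proof -
  \<comment> \<open>One-sided cancellation for arbitrary data: used once as given and once with both
    inverse pairs reversed, it yields the two halves of the bijection.\<close>
  have *: "(\<lambda>\<zeta>. vcomp T X B \<mu> (vcomp T X B \<zeta> \<kappa>')) \<in> cells2 T X B p q \<rightarrow> cells2 T X B p' q' \<and>
     (\<forall>\<zeta>\<in>cells2 T X B p q. vcomp T X B \<mu>' (vcomp T X B (vcomp T X B \<mu> (vcomp T X B \<zeta> \<kappa>')) \<kappa>) = \<zeta>)"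
    if \<kappa>: "inverse2 T X B p p' \<kappa> \<kappa>'" and \<mu>: "inverse2 T X B q q' \<mu> \<mu>'" for p p' q q' \<kappa> \<kappa>' \<mu> \<mu>'
  proof (intro conjI ballI)
    note k = that[unfolded inverse2_def]
    show "(\<lambda>\<zeta>. vcomp T X B \<mu> (vcomp T X B \<zeta> \<kappa>')) \<in> cells2 T X B p q \<rightarrow> cells2 T X B p' q'"
      using k vcomp_closed[OF X B] by blast
    fix \<zeta> assume \<zeta>: "\<zeta> \<in> cells2 T X B p q"
    then have "vcomp T X B \<zeta> \<kappa>' \<in> cells2 T X B p' q" using k vcomp_closed[OF X B] by blast
    then have "vcomp T X B (vcomp T X B \<mu> (vcomp T X B \<zeta> \<kappa>')) \<kappa> = vcomp T X B \<mu> (vcomp T X B (vcomp T X B \<zeta> \<kappa>') \<kappa>)"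
      using vcomp_assoc[OF X B] k by metis
    also have "vcomp T X B (vcomp T X B \<zeta> \<kappa>') \<kappa> = \<zeta>" by (rule inverse2_cancel(2)[OF X B \<kappa> \<zeta>])
    finally show "vcomp T X B \<mu>' (vcomp T X B (vcomp T X B \<mu> (vcomp T X B \<zeta> \<kappa>')) \<kappa>) = \<zeta>"
      using inverse2_cancel(1)[OF X B \<mu> \<zeta>] by simp
  qed
  have k: "\<kappa> \<in> cells2 T X B p p'" "\<mu>' \<in> cells2 T X B q' q" "\<kappa>' \<in> cells2 T X B p' p" "\<mu> \<in> cells2 T X B q q'"
    using \<kappa> \<mu> by (auto simp: inverse2_def)
  have a: "vcomp T X B \<mu>' (vcomp T X B \<zeta> \<kappa>) = vcomp T X B (vcomp T X B \<mu>' \<zeta>) \<kappa>" 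
    if "\<zeta> \<in> cells2 T X B p' q'" for \<zeta> using vcomp_assoc[OF X B k(1) that k(2)] .
  show ?thesis
    using *[OF \<kappa> \<mu>] *[OF \<kappa>[unfolded inverse2_sym[of T X B p]] \<mu>[unfolded inverse2_sym[of T X B q]]]
    by (intro bij_betwI[where g = "\<lambda>\<zeta>. vcomp T X B \<mu>' (vcomp T X B \<zeta> \<kappa>)"]) auto
qed

end

context lifting_data
begin

text \<open>The pasting maps at the two pairs are opposite sides of a square that commutes by
  \<open>lift_natural\<close>; its other sides are conjugations by invertible 2-cells, hence
  bijections.\<close>

lemma lifts_at_iso:
  assumes X: "X \<in> ob2 T" and \<gamma>: "inverse2 T X C c' c \<gamma> \<gamma>'" and \<delta>: "inverse2 T X B b' b \<delta> \<delta>'"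
    and L: "lifts_at T C B A g f l lam X c' b'"
  shows "lifts_at T C B A g f l lam X c b"
proof -
  let ?m = "\<lambda>Z w w' \<zeta>. vcomp T X Z w (vcomp T X Z \<zeta> w')"
  have gd: "\<gamma> \<in> cells2 T X C c' c" "\<delta>' \<in> cells2 T X B b b'"
    using \<gamma> \<delta> by (auto simp: inverse2_def)
  have b1: "bij_betw (?m B (lwhisker T X C B l \<gamma>) \<delta>')
      (cells2 T X B b' (comp1 T X C B l c')) (cells2 T X B b (comp1 T X C B l c))"
    by (rule conjugate_bij[OF X obs(2) \<delta> inverse2_lwhisker[OF X obs(1,2) \<gamma> ones(3)]])
  have b2: "bij_betw (?m A (lwhisker T X C A g \<gamma>) (lwhisker T X B A f \<delta>'))
      (cells2 T X A (comp1 T X B A f b') (comp1 T X C A g c')) (cells2 T X A (comp1 T X B A f b) (comp1 T X C A g c))"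
    by (rule conjugate_bij[OF X obs(3) inverse2_lwhisker[OF X obs(2,3) \<delta> ones(2)] inverse2_lwhisker[OF X obs(1,3) \<gamma> ones(1)]])
  have "bij_betw (lift X c \<circ> ?m B (lwhisker T X C B l \<gamma>) \<delta>')
     (cells2 T X B b' (comp1 T X C B l c')) (cells2 T X A (comp1 T X B A f b) (comp1 T X C A g c))"
    using bij_betw_trans[OF L[unfolded lifts_at_def] b2] 
    by (rule bij_betw_cong[THEN iffD1, rotated]) (simp add: lift_natural[OF X gd])
  then show ?thesis
    unfolding lifts_at_def using bij_betw_comp_iff[OF b1] by blast
qed

end

context two_category
begin

text \<open>Whiskering by \<open>e\<close> and then by \<open>e'\<close> is whiskering by
  \<open>e e'\<close>; interchange moves \<open>\<chi>\<close> past \<open>\<theta>'\<close>, after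
  which \<open>\<theta>\<close> and \<open>\<theta>'\<close> cancel. So a 2-cell out of
  \<open>X\<close> is recovered from its restriction along \<open>e\<close>.\<close>

lemma retract_conjugate:
  assumes X: "X \<in> ob2 T" and Y: "Y \<in> ob2 T" and Z: "Z \<in> ob2 T"
    and e: "e \<in> cells1 T Y X" and e': "e' \<in> cells1 T X Y"
    and \<theta>: "inverse2 T X X (comp1 T X Y X e e') (id1 T X) \<theta> \<theta>'"
    and \<chi>: "\<chi> \<in> cells2 T X Z p q"
  shows "vcomp T X Z (lwhisker T X X Z q \<theta>)
      (vcomp T X Z (rwhisker T X Y Z (rwhisker T Y X Z \<chi> e) e') (lwhisker T X X Z p \<theta>')) = \<chi>"
proof -
  have pq: "p \<in> cells1 T X Z" "q \<in> cells1 T X Z" using cells2_boundary[OF X Z \<chi>] by auto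
  have \<theta>': "\<theta>' \<in> cells2 T X X (id1 T X) (comp1 T X Y X e e')" using \<theta> by (auto simp: inverse2_def)
  have "vcomp T X Z (rwhisker T X Y Z (rwhisker T Y X Z \<chi> e) e') (lwhisker T X X Z p \<theta>')
      = vcomp T X Z (lwhisker T X X Z q \<theta>') \<chi>"
    using interchange[OF X X Z \<theta>' \<chi>]
    by (simp add: rwhisker_comp[OF X Y X Z \<chi> e' e] rwhisker_id1[OF X Z \<chi>])
  moreover have "inverse2 T X Z q (comp1 T X X Z q (comp1 T X Y X e e')) 
      (lwhisker T X X Z q \<theta>') (lwhisker T X X Z q \<theta>)"
    using inverse2_lwhisker[OF X X Z _ pq(2), of "id1 T X" "comp1 T X Y X e e'" \<theta>' \<theta>] \<theta>
    by (simp add: inverse2_sym[of T X X "id1 T X"] comp1_id_right[OF X Z pq(2)])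
  ultimately show ?thesis using inverse2_cancel(1)[OF X Z _ \<chi>] by simp
qed

end

context lifting_data
begin

text \<open>Restriction along \<open>e\<close> makes the pasting map at \<open>X\<close> a retract
  of the one at \<open>Y\<close>, with \<open>retract_conjugate\<close> as the retraction identity;
  a retract of a bijection is a bijection.\<close>

lemma lifts_at_retract:
  assumes X: "X \<in> ob2 T" and Y: "Y \<in> ob2 T"
    and e: "e \<in> cells1 T Y X" and e': "e' \<in> cells1 T X Y"
    and \<theta>: "inverse2 T X X (comp1 T X Y X e e') (id1 T X) \<theta> \<theta>'"
    and c: "c \<in> cells1 T X C" and b: "b \<in> cells1 T X B"
    and L: "lifts_at T C B A g f l lam Y (comp1 T Y X C c e) (comp1 T Y X B b e)"
  shows "lifts_at T C B A g f l lam X c b"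
proof -
  let ?lc = "comp1 T X C B l c" and ?fb = "comp1 T X B A f b" and ?gc = "comp1 T X C A g c"
  let ?ce = "comp1 T Y X C c e" and ?be = "comp1 T Y X B b e"
  let ?ee = "comp1 T X Y X e e'"
  note XCB = comp1_closed[OF X obs(1,2) c ones(3)]
  have assoc: "comp1 T Y X B ?lc e = comp1 T Y C B l ?ce" "comp1 T Y X A ?fb e = comp1 T Y B A f ?be"
     "comp1 T Y X A ?gc e = comp1 T Y C A g ?ce"
    by (simp_all add: comp1_assoc[OF Y X obs(1,2) e c ones(3)] comp1_assoc[OF Y X obs(2,3) e b ones(2)]
       comp1_assoc[OF Y X obs(1,3) e c ones(1)])
  have cf: "?ce \<in> cells1 T Y C" "?be \<in> cells1 T Y B"
    using comp1_closed[OF Y X obs(1) e c] comp1_closed[OF Y X obs(2) e b] by auto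
  have fgc: "?fb \<in> cells1 T X A" "?gc \<in> cells1 T X A"
    using comp1_closed[OF X obs(2,3) b ones(2)] comp1_closed[OF X obs(1,3) c ones(1)] by auto
  have \<theta>c: "\<theta> \<in> cells2 T X X ?ee (id1 T X)" "\<theta>' \<in> cells2 T X X (id1 T X) ?ee"
    using \<theta> by (auto simp: inverse2_def)
  have inj: "inj_on (lift X c) (cells2 T X B b ?lc)"
  proof (rule inj_onI)
    fix \<zeta> \<zeta>' assume z: "\<zeta> \<in> cells2 T X B b ?lc" "\<zeta>' \<in> cells2 T X B b ?lc" and "lift X c \<zeta> = lift X c \<zeta>'"
    then have "lift Y ?ce (rwhisker T Y X B \<zeta> e) = lift Y ?ce (rwhisker T Y X B \<zeta>' e)"
      by (simp add: lift_rwhisker[OF X Y e c])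
    moreover have "rwhisker T Y X B \<zeta> e \<in> cells2 T Y B ?be (comp1 T Y C B l ?ce)"
      "rwhisker T Y X B \<zeta>' e \<in> cells2 T Y B ?be (comp1 T Y C B l ?ce)"
      using rwhisker_closed[OF Y X obs(2) z(1) e] rwhisker_closed[OF Y X obs(2) z(2) e] assoc by simp_all
    ultimately have *: "rwhisker T Y X B \<zeta> e = rwhisker T Y X B \<zeta>' e"
      using bij_betw_imp_inj_on[OF L[unfolded lifts_at_def]] by (simp add: inj_on_eq_iff)
    show "\<zeta> = \<zeta>'"
      using retract_conjugate[OF X Y obs(2) e e' \<theta> z(1), unfolded *]
        retract_conjugate[OF X Y obs(2) e e' \<theta> z(2)] by (rule trans[OF sym])
  qed
  have surj: "\<chi> \<in> lift X c ` cells2 T X B b ?lc" if \<chi>: "\<chi> \<in> cells2 T X A ?fb ?gc" for \<chi>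
  proof -
    have "rwhisker T Y X A \<chi> e \<in> cells2 T Y A (comp1 T Y B A f ?be) (comp1 T Y C A g ?ce)"
      using rwhisker_closed[OF Y X obs(3) \<chi> e] assoc by simp
    then obtain \<omega> where \<omega>: "\<omega> \<in> cells2 T Y B ?be (comp1 T Y C B l ?ce)"
      "rwhisker T Y X A \<chi> e = lift Y ?ce \<omega>"
      using L by (auto simp: lifts_at_def bij_betw_def)
    have \<gamma>: "lwhisker T X X C c \<theta> \<in> cells2 T X C (comp1 T X Y C ?ce e') c"
      using lwhisker_closed[OF X X obs(1) \<theta>c(1) c] comp1_assoc[OF X Y X obs(1) e' e c]
      by (simp add: comp1_id_right[OF X obs(1) c])
    have \<delta>: "lwhisker T X X B b \<theta>' \<in> cells2 T X B b (comp1 T X Y B ?be e')"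
      using lwhisker_closed[OF X X obs(2) \<theta>c(2) b] comp1_assoc[OF X Y X obs(2) e' e b]
      by (simp add: comp1_id_right[OF X obs(2) b])
    have \<omega>e: "rwhisker T X Y B \<omega> e' \<in> cells2 T X B (comp1 T X Y B ?be e') (comp1 T X C B l (comp1 T X Y C ?ce e'))"
      using rwhisker_closed[OF X Y obs(2) \<omega>(1) e'] comp1_assoc[OF X Y obs(1,2) e' cf(1) ones(3)] by simp
    \<comment> \<open>The solution \<open>\<omega>\<close> found over \<open>Y\<close>, restricted
      along \<open>e'\<close> and conjugated back to \<open>b\<close> and \<open>l c\<close> by the
      whiskered \<open>\<theta>'\<close> and \<open>\<theta>\<close>.\<close>
    let ?\<zeta> = "vcomp T X B (lwhisker T X C B l (lwhisker T X X C c \<theta>))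
       (vcomp T X B (rwhisker T X Y B \<omega> e') (lwhisker T X X B b \<theta>'))"
    have "lift X c ?\<zeta> = vcomp T X A (lwhisker T X X A ?gc \<theta>)
      (vcomp T X A (rwhisker T X Y A (rwhisker T Y X A \<chi> e) e') (lwhisker T X X A ?fb \<theta>'))"
      by (simp add: lift_natural[OF X \<gamma> \<delta> \<omega>e] lift_rwhisker[OF Y X e' cf(1) \<omega>(1)] \<omega>(2)
          lwhisker_comp[OF X X obs(1,3) \<theta>c(1) c ones(1)] lwhisker_comp[OF X X obs(2,3) \<theta>c(2) b ones(2)])
    also have "\<dots> = \<chi>" by (rule retract_conjugate[OF X Y obs(3) e e' \<theta> \<chi>])
    finally have "lift X c ?\<zeta> = \<chi>" .
    moreover have "?\<zeta> \<in> cells2 T X B b ?lc"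
      by (rule vcomp_closed[OF X obs(2) vcomp_closed[OF X obs(2) \<delta> \<omega>e] lwhisker_closed[OF X obs(1,2) \<gamma> ones(3)]])
    ultimately show ?thesis by blast
  qed
  show ?thesis
    using inj surj lift_closed[OF X c] unfolding lifts_at_def bij_betw_def by blast
qed

end

context two_category
begin

lemma lifting_dataI:
  assumes "absolute_right_lifting T C B A g f l lam"
  shows "lifting_data T C B A g f l lam"
  by unfold_locales (use assms in \<open>auto simp: absolute_right_lifting_def\<close>)

text \<open>Replacing \<open>l\<close> by an isomorphic 1-cell precomposes each pasting map with the
  bijection given by the whiskered \<open>\<kappa>\<close>.\<close>

lemma absolute_right_lifting_iso:
  assumes L: "absolute_right_lifting T C B A g f l lam" and \<kappa>: "inverse2 T C B l' l \<kappa> \<kappa>'"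
  shows "absolute_right_lifting T C B A g f l' (vcomp T C A lam (lwhisker T C B A f \<kappa>))"
proof -
  interpret L: lifting_data T C B A g f l lam using L by (rule lifting_dataI)
  have k: "\<kappa> \<in> cells2 T C B l' l" "\<kappa>' \<in> cells2 T C B l l'" using \<kappa> by (auto simp: inverse2_def)
  have fk: "lwhisker T C B A f \<kappa> \<in> cells2 T C A (comp1 T C B A f l') (comp1 T C B A f l)"
    by (rule lwhisker_closed[OF L.obs k(1) L.ones(2)])
  interpret L': lifting_data T C B A g f l' "vcomp T C A lam (lwhisker T C B A f \<kappa>)"
    using L.obs L.ones L.lam cells2_boundary[OF L.obs(1,2) k(1)] vcomp_closed[OF L.obs(1,3) fk L.lam]
    by unfold_locales auto
  have "lifts_at T C B A g f l' (vcomp T C A lam (lwhisker T C B A f \<kappa>)) X c b"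
    if X: "X \<in> ob2 T" and c: "c \<in> cells1 T X C" and b: "b \<in> cells1 T X B" for X c b
  proof -
    \<comment> \<open>\<open>conjugate_bij\<close> conjugates at both ends; taking the identity at
      \<open>b\<close> leaves that end unchanged.\<close>
    have i: "inverse2 T X B b b (id2 T X B b) (id2 T X B b)"
      using id2_closed[OF X L.obs(2) b] vcomp_id_left[OF X L.obs(2)] by (auto simp: inverse2_def)
    have "bij_betw (\<lambda>\<zeta>. vcomp T X B (rwhisker T X C B \<kappa> c) (vcomp T X B \<zeta> (id2 T X B b)))
       (cells2 T X B b (comp1 T X C B l' c)) (cells2 T X B b (comp1 T X C B l c))"
      by (rule conjugate_bij[OF X L.obs(2) i inverse2_rwhisker[OF X L.obs(1,2) \<kappa> c]])
    moreover have "lifts_at T C B A g f l lam X c b"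
      using L L.absolute_right_lifting_iff X c b by blast
    ultimately have 1: "bij_betw (L.lift X c \<circ> (\<lambda>\<zeta>. vcomp T X B (rwhisker T X C B \<kappa> c) (vcomp T X B \<zeta> (id2 T X B b))))
       (cells2 T X B b (comp1 T X C B l' c)) (cells2 T X A (comp1 T X B A f b) (comp1 T X C A g c))"
      unfolding lifts_at_def by (rule bij_betw_trans)
    have "(L.lift X c \<circ> (\<lambda>\<zeta>. vcomp T X B (rwhisker T X C B \<kappa> c) (vcomp T X B \<zeta> (id2 T X B b)))) \<zeta>
        = L'.lift X c \<zeta>" if \<zeta>: "\<zeta> \<in> cells2 T X B b (comp1 T X C B l' c)" for \<zeta>
    proof -
      note kc = rwhisker_closed[OF X L.obs(1,2) k(1) c]
      show ?thesis
        by (simp add: vcomp_id_right[OF X L.obs(2) \<zeta>] lift_map_def lwhisker_vcomp[OF X L.obs(2,3) L.ones(2) \<zeta> kc]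
            rwhisker_vcomp[OF X L.obs(1,3) c fk L.lam] lwhisker_rwhisker[OF X L.obs k(1) c L.ones(2), symmetric])
         (rule vcomp_assoc[OF X L.obs(3) lwhisker_closed[OF X L.obs(2,3) \<zeta> L.ones(2)]
            lwhisker_closed[OF X L.obs(2,3) kc L.ones(2)] L.lam_whisker[OF X c]])
    qed
    with 1 show ?thesis
      unfolding lifts_at_def by (rule bij_betw_cong[THEN iffD1, rotated])
  qed
  then show ?thesis using L'.absolute_right_lifting_iff by blast
qed

text \<open>This is where absoluteness enters: a test pair \<open>(c, b)\<close> for the restricted
  data is the test pair \<open>(t c, b)\<close> for the original.\<close>

lemma absolute_right_lifting_precomp:
  assumes L: "absolute_right_lifting T C B A g f l lam" and C': "C' \<in> ob2 T" and t: "t \<in> cells1 T C' C"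
  shows "absolute_right_lifting T C' B A (comp1 T C' C A g t) f (comp1 T C' C B l t) (rwhisker T C' C A lam t)"
proof -
  interpret L: lifting_data T C B A g f l lam using L by (rule lifting_dataI)
  interpret L': lifting_data T C' B A "comp1 T C' C A g t" f "comp1 T C' C B l t" "rwhisker T C' C A lam t"
    using L.obs L.ones C' t comp1_closed L.lam_whisker[OF C' t]
    by unfold_locales auto
  have "lifts_at T C' B A (comp1 T C' C A g t) f (comp1 T C' C B l t) (rwhisker T C' C A lam t) X c b"
    if X: "X \<in> ob2 T" and c: "c \<in> cells1 T X C'" and b: "b \<in> cells1 T X B" for X c b
  proof -
    have "lifts_at T C B A g f l lam X (comp1 T X C' C t c) b"
      using L L.absolute_right_lifting_iff X comp1_closed[OF X C' L.obs(1) c t] b by blast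
    then show ?thesis
      by (simp add: lifts_at_def lift_map_def[abs_def] comp1_assoc[OF X C' L.obs(1,2) c t L.ones(3)]
         comp1_assoc[OF X C' L.obs(1,3) c t L.ones(1)] rwhisker_comp[OF X C' L.obs(1,3) L.lam c t])
  qed
  then show ?thesis using L'.absolute_right_lifting_iff by blast
qed

text \<open>\<open>s\<close> and \<open>s'\<close> are inverse on the nose, so whiskering by
  \<open>s'\<close> returns to the original boundary 1-cells and undoes whiskering by
  \<open>s\<close>.\<close>

lemma lwhisker_iso_bij:
  assumes "X \<in> ob2 T" "A \<in> ob2 T" "A' \<in> ob2 T" "s \<in> cells1 T A A'" "s' \<in> cells1 T A' A"
    and s's: "comp1 T A A' A s' s = id1 T A" and ss': "comp1 T A' A A' s s' = id1 T A'"
    and "p \<in> cells1 T X A" "q \<in> cells1 T X A"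
  shows "bij_betw (lwhisker T X A A' s) (cells2 T X A p q) (cells2 T X A' (comp1 T X A A' s p) (comp1 T X A A' s q))"
proof (rule bij_betwI[where g = "lwhisker T X A' A s'"])
  have sp: "comp1 T X A' A s' (comp1 T X A A' s p) = p" "comp1 T X A' A s' (comp1 T X A A' s q) = q"
    using assms by (simp_all add: comp1_assoc comp1_id_left)
  show "lwhisker T X A A' s \<in> cells2 T X A p q \<rightarrow> cells2 T X A' (comp1 T X A A' s p) (comp1 T X A A' s q)"
    using assms lwhisker_closed by blast
  show "lwhisker T X A' A s' \<in> cells2 T X A' (comp1 T X A A' s p) (comp1 T X A A' s q) \<rightarrow> cells2 T X A p q"
    using assms sp lwhisker_closed by fastforce
  show "lwhisker T X A' A s' (lwhisker T X A A' s \<alpha>) = \<alpha>" if "\<alpha> \<in> cells2 T X A p q" for \<alpha>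
    using lwhisker_comp[OF assms(1-3,2) that assms(4,5)] lwhisker_id1[OF assms(1,2) that] s's by simp
  show "lwhisker T X A A' s (lwhisker T X A' A s' \<alpha>) = \<alpha>"
    if "\<alpha> \<in> cells2 T X A' (comp1 T X A A' s p) (comp1 T X A A' s q)" for \<alpha>
    using lwhisker_comp[OF assms(1,3,2,3) that assms(5,4)] lwhisker_id1[OF assms(1,3) that] ss' by simp
qed

text \<open>Whiskering by the isomorphism \<open>s\<close> is bijective on 2-cells and carries
  pasting with \<open>lam\<close> to pasting with the whiskered \<open>lam\<close>.\<close>

lemma absolute_right_lifting_postcomp_iso:
  assumes L: "absolute_right_lifting T C B A g f l lam"
    and A': "A' \<in> ob2 T" and s: "s \<in> cells1 T A A'" "s' \<in> cells1 T A' A"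
      "comp1 T A A' A s' s = id1 T A" "comp1 T A' A A' s s' = id1 T A'"
  shows "absolute_right_lifting T C B A' (comp1 T C A A' s g) (comp1 T B A A' s f) l (lwhisker T C A A' s lam)"
proof -
  interpret L: lifting_data T C B A g f l lam using L by (rule lifting_dataI)
  interpret L': lifting_data T C B A' "comp1 T C A A' s g" "comp1 T B A A' s f" l "lwhisker T C A A' s lam"
    using L.obs L.ones A' s comp1_closed lwhisker_closed[OF L.obs(1,3) A' L.lam s(1)]
      comp1_assoc[OF L.obs(1,2,3) A' L.ones(3,2) s(1)]
    by unfold_locales auto
  have "lifts_at T C B A' (comp1 T C A A' s g) (comp1 T B A A' s f) l (lwhisker T C A A' s lam) X c b"
    if X: "X \<in> ob2 T" and c: "c \<in> cells1 T X C" and b: "b \<in> cells1 T X B" for X c b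
  proof -
    have fb: "comp1 T X B A f b \<in> cells1 T X A" and gc: "comp1 T X C A g c \<in> cells1 T X A"
      using comp1_closed X c b L.obs L.ones by auto
    have "lifts_at T C B A g f l lam X c b"
      using L L.absolute_right_lifting_iff X c b by blast
    then have 1: "bij_betw (lwhisker T X A A' s \<circ> L.lift X c)
       (cells2 T X B b (comp1 T X C B l c)) (cells2 T X A' (comp1 T X A A' s (comp1 T X B A f b)) (comp1 T X A A' s (comp1 T X C A g c)))"
      unfolding lifts_at_def by (rule bij_betw_trans[OF _ lwhisker_iso_bij[OF X L.obs(3) A' s fb gc]])
    have "(lwhisker T X A A' s \<circ> L.lift X c) \<zeta> = L'.lift X c \<zeta>"
      if \<zeta>: "\<zeta> \<in> cells2 T X B b (comp1 T X C B l c)" for \<zeta>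
      by (simp add: lift_map_def lwhisker_vcomp[OF X L.obs(3) A' s(1) lwhisker_closed[OF X L.obs(2,3) \<zeta> L.ones(2)] L.lam_whisker[OF X c]]
         lwhisker_rwhisker[OF X L.obs(1,3) A' L.lam c s(1)] lwhisker_comp[OF X L.obs(2,3) A' \<zeta> L.ones(2) s(1)])
    with 1 show ?thesis
      unfolding lifts_at_def comp1_assoc[OF X L.obs(2,3) A' b L.ones(2) s(1)] comp1_assoc[OF X L.obs(1,3) A' c L.ones(1) s(1)]
      by (rule bij_betw_cong[THEN iffD1, rotated])
  qed
  then show ?thesis using L'.absolute_right_lifting_iff by blast
qed

text \<open>Unit and counit are conjugated by \<open>\<kappa>\<close> with \<open>u\<close> kept
  fixed. In the triangle at \<open>f'\<close>, interchange slides \<open>\<kappa>\<close> and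
  \<open>\<kappa>'\<close> apart until they enclose the old triangle; in the triangle at
  \<open>u\<close> they meet and cancel.\<close>

lemma left_adjoint_to_iso:
  assumes adj: "left_adjoint_to T A B f u" and \<kappa>: "inverse2 T B A f f' \<kappa> \<kappa>'"
  shows "left_adjoint_to T A B f' u"
proof -
  obtain \<eta> \<epsilon> where "is_adjunction T A B f u \<eta> \<epsilon>" using adj by (auto simp: left_adjoint_to_def)
  then have A: "A \<in> ob2 T" and B: "B \<in> ob2 T" and f: "f \<in> cells1 T B A" and u: "u \<in> cells1 T A B"
    and \<eta>: "\<eta> \<in> cells2 T B B (id1 T B) (comp1 T B A B u f)"
    and \<epsilon>: "\<epsilon> \<in> cells2 T A A (comp1 T A B A f u) (id1 T A)"
    and t1: "vcomp T B A (rwhisker T B A A \<epsilon> f) (lwhisker T B B A f \<eta>) = id2 T B A f"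
    and t2: "vcomp T A B (lwhisker T A A B u \<epsilon>) (rwhisker T A B B \<eta> u) = id2 T A B u"
    by (auto simp: is_adjunction_def)
  have k: "\<kappa> \<in> cells2 T B A f f'" "\<kappa>' \<in> cells2 T B A f' f"
    and kk: "vcomp T B A \<kappa>' \<kappa> = id2 T B A f" "vcomp T B A \<kappa> \<kappa>' = id2 T B A f'"
    using \<kappa> by (auto simp: inverse2_def)
  have f': "f' \<in> cells1 T B A" using cells2_boundary[OF B A k(1)] by auto
  let ?uf = "comp1 T B A B u f" and ?uf' = "comp1 T B A B u f'"
  let ?fu = "comp1 T A B A f u" and ?f'u = "comp1 T A B A f' u"
  note 1 = comp1_closed[OF B A B f u] comp1_closed[OF B A B f' u]
  note u\<kappa> = lwhisker_closed[OF B A B k(1) u] and \<kappa>u = rwhisker_closed[OF A B A k(2) u]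
  define \<eta>' where "\<eta>' = vcomp T B B (lwhisker T B A B u \<kappa>) \<eta>"
  define \<epsilon>' where "\<epsilon>' = vcomp T A A \<epsilon> (rwhisker T A B A \<kappa>' u)"
  have \<eta>': "\<eta>' \<in> cells2 T B B (id1 T B) ?uf'" unfolding \<eta>'_def by (rule vcomp_closed[OF B B \<eta> u\<kappa>])
  have \<epsilon>': "\<epsilon>' \<in> cells2 T A A ?f'u (id1 T A)" unfolding \<epsilon>'_def by (rule vcomp_closed[OF A A \<kappa>u \<epsilon>])
  let ?v = "vcomp T B A"
  have assoc: "comp1 T B B A h (comp1 T B A B u g) = comp1 T B A A (comp1 T A B A h u) g"
    if "h \<in> cells1 T B A" "g \<in> cells1 T B A" for h g using comp1_assoc[OF B A B A that(2) u that(1)] .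
  note \<epsilon>f' = rwhisker_closed[OF B A A \<epsilon> f', unfolded comp1_id_left[OF B A f']]
  note \<epsilon>f = rwhisker_closed[OF B A A \<epsilon> f, unfolded comp1_id_left[OF B A f]]
  note \<kappa>uf' = rwhisker_closed[OF B A A \<kappa>u f', folded assoc[OF f' f'] assoc[OF f f']]
  note \<kappa>uf = rwhisker_closed[OF B A A \<kappa>u f, folded assoc[OF f f] assoc[OF f' f]]
  note f'u\<kappa> = lwhisker_closed[OF B B A u\<kappa> f'] and fu\<kappa> = lwhisker_closed[OF B B A u\<kappa> f]
  note f'\<eta> = lwhisker_closed[OF B B A \<eta> f', unfolded comp1_id_right[OF B A f']]
  note f\<eta> = lwhisker_closed[OF B B A \<eta> f, unfolded comp1_id_right[OF B A f]]
  have "?v (rwhisker T B A A \<epsilon>' f') (lwhisker T B B A f' \<eta>')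
    = ?v (?v (rwhisker T B A A \<epsilon> f') (rwhisker T B A A (rwhisker T A B A \<kappa>' u) f'))
        (?v (lwhisker T B B A f' (lwhisker T B A B u \<kappa>)) (lwhisker T B B A f' \<eta>))"
    unfolding \<eta>'_def \<epsilon>'_def by (simp add: rwhisker_vcomp[OF B A A f' \<kappa>u \<epsilon>] lwhisker_vcomp[OF B B A f' \<eta> u\<kappa>])
  also have "\<dots> = ?v (rwhisker T B A A \<epsilon> f') (?v (rwhisker T B A A (rwhisker T A B A \<kappa>' u) f')
        (?v (lwhisker T B B A f' (lwhisker T B A B u \<kappa>)) (lwhisker T B B A f' \<eta>)))"
    by (rule vcomp_assoc[symmetric, OF B A vcomp_closed[OF B A f'\<eta> f'u\<kappa>] \<kappa>uf' \<epsilon>f'[folded assoc[OF f f']]])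
  also have "?v (rwhisker T B A A (rwhisker T A B A \<kappa>' u) f') (?v (lwhisker T B B A f' (lwhisker T B A B u \<kappa>)) (lwhisker T B B A f' \<eta>))
     = ?v (?v (rwhisker T B A A (rwhisker T A B A \<kappa>' u) f') (lwhisker T B B A f' (lwhisker T B A B u \<kappa>))) (lwhisker T B B A f' \<eta>)"
    by (rule vcomp_assoc[OF B A f'\<eta> f'u\<kappa> \<kappa>uf'])
  \<comment> \<open>The first of three interchanges: \<open>\<kappa>\<close> and
    \<open>\<kappa>'\<close> pass each other, then \<open>\<kappa>'\<close> passes
    \<open>\<eta>\<close> and \<open>\<kappa>\<close> passes \<open>\<epsilon>\<close>, which leaves
    the triangle at \<open>f\<close> between them.\<close>
  also have "?v (rwhisker T B A A (rwhisker T A B A \<kappa>' u) f') (lwhisker T B B A f' (lwhisker T B A B u \<kappa>))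
     = ?v (lwhisker T B B A f (lwhisker T B A B u \<kappa>)) (rwhisker T B A A (rwhisker T A B A \<kappa>' u) f)"
    using interchange[OF B A A k(1) \<kappa>u] by (simp add: lwhisker_comp[OF B A B A k(1) u f'] lwhisker_comp[OF B A B A k(1) u f])
  also have "?v \<dots> (lwhisker T B B A f' \<eta>) = ?v (lwhisker T B B A f (lwhisker T B A B u \<kappa>)) (?v (rwhisker T B A A (rwhisker T A B A \<kappa>' u) f) (lwhisker T B B A f' \<eta>))"
    by (rule vcomp_assoc[symmetric, OF B A f'\<eta> \<kappa>uf fu\<kappa>])
  also have "?v (rwhisker T B A A (rwhisker T A B A \<kappa>' u) f) (lwhisker T B B A f' \<eta>) = ?v (lwhisker T B B A f \<eta>) \<kappa>'"
    using interchange[OF B B A \<eta> k(2)] by (simp add: rwhisker_id1[OF B A k(2)] rwhisker_comp[OF B A B A k(2) f u])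
  also have "?v (rwhisker T B A A \<epsilon> f') (?v (lwhisker T B B A f (lwhisker T B A B u \<kappa>)) (?v (lwhisker T B B A f \<eta>) \<kappa>'))
    = ?v (?v (rwhisker T B A A \<epsilon> f') (lwhisker T B B A f (lwhisker T B A B u \<kappa>))) (?v (lwhisker T B B A f \<eta>) \<kappa>')"
    by (rule vcomp_assoc[OF B A vcomp_closed[OF B A k(2) f\<eta>] fu\<kappa> \<epsilon>f'[folded assoc[OF f f']]])
  also have "?v (rwhisker T B A A \<epsilon> f') (lwhisker T B B A f (lwhisker T B A B u \<kappa>)) = ?v \<kappa> (rwhisker T B A A \<epsilon> f)"
    using interchange[OF B A A k(1) \<epsilon>] by (simp add: lwhisker_id1[OF B A k(1)] lwhisker_comp[OF B A B A k(1) u f])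
  also have "?v (?v \<kappa> (rwhisker T B A A \<epsilon> f)) (?v (lwhisker T B B A f \<eta>) \<kappa>')
     = ?v \<kappa> (?v (rwhisker T B A A \<epsilon> f) (?v (lwhisker T B B A f \<eta>) \<kappa>'))"
    by (rule vcomp_assoc[symmetric, OF B A vcomp_closed[OF B A k(2) f\<eta>] \<epsilon>f[folded assoc[OF f f]] k(1)])
  also have "?v (rwhisker T B A A \<epsilon> f) (?v (lwhisker T B B A f \<eta>) \<kappa>') = ?v (id2 T B A f) \<kappa>'"
    using vcomp_assoc[OF B A k(2) f\<eta> \<epsilon>f[folded assoc[OF f f]]] t1 by simp
  also have "?v \<kappa> \<dots> = id2 T B A f'" by (simp add: vcomp_id_left[OF B A k(2)] kk)
  finally have t1': "?v (rwhisker T B A A \<epsilon>' f') (lwhisker T B B A f' \<eta>') = id2 T B A f'" .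
  let ?w = "vcomp T A B"
  note assoc' = comp1_assoc[OF A B A B u f u] comp1_assoc[OF A B A B u f' u]
  note u\<epsilon> = lwhisker_closed[OF A A B \<epsilon> u, unfolded comp1_id_right[OF A B u]]
  note u\<kappa>u = lwhisker_closed[OF A A B \<kappa>u u]
  note u\<kappa>u' = rwhisker_closed[OF A B B u\<kappa> u, folded assoc']
  note \<eta>u = rwhisker_closed[OF A B B \<eta> u, folded assoc', unfolded comp1_id_left[OF A B u]]
  have "?w (lwhisker T A A B u \<epsilon>') (rwhisker T A B B \<eta>' u)
    = ?w (?w (lwhisker T A A B u \<epsilon>) (lwhisker T A A B u (rwhisker T A B A \<kappa>' u)))
       (?w (rwhisker T A B B (lwhisker T B A B u \<kappa>) u) (rwhisker T A B B \<eta> u))"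
    unfolding \<eta>'_def \<epsilon>'_def by (simp add: lwhisker_vcomp[OF A A B u \<kappa>u \<epsilon>] rwhisker_vcomp[OF A B B u \<eta> u\<kappa>])
  also have "\<dots> = ?w (lwhisker T A A B u \<epsilon>) (?w (lwhisker T A A B u (rwhisker T A B A \<kappa>' u))
       (?w (rwhisker T A B B (lwhisker T B A B u \<kappa>) u) (rwhisker T A B B \<eta> u)))"
    by (rule vcomp_assoc[symmetric, OF A B vcomp_closed[OF A B \<eta>u u\<kappa>u'] u\<kappa>u u\<epsilon>])
  also have "?w (lwhisker T A A B u (rwhisker T A B A \<kappa>' u)) (?w (rwhisker T A B B (lwhisker T B A B u \<kappa>) u) (rwhisker T A B B \<eta> u))
    = rwhisker T A B B \<eta> u"
    unfolding lwhisker_rwhisker[OF A B A B k(2) u u]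
    by (rule inverse2_cancel(1)[OF A B inverse2_rwhisker[OF A B B inverse2_lwhisker[OF B A B \<kappa> u] u, folded assoc'] \<eta>u])
  also have "?w (lwhisker T A A B u \<epsilon>) \<dots> = id2 T A B u" by (rule t2)
  finally have t2': "?w (lwhisker T A A B u \<epsilon>') (rwhisker T A B B \<eta>' u) = id2 T A B u" .
  have "is_adjunction T A B f' u \<eta>' \<epsilon>'"
    using A B f' u \<eta>' \<epsilon>' t1' t2' by (simp add: is_adjunction_def)
  then show ?thesis by (auto simp: left_adjoint_to_def)
qed

end

section \<open>Biequivalences\<close>

text \<open>On objects the requirement is a one-sided inverse up to an invertible 2-cell, since this
  is the form that \<open>lifts_at_retract\<close> consumes.\<close>

locale biequivalence = S: two_category S + T: two_category T
  for S :: "('o, 'f, 'c) two_cat" and T :: "('p, 'g, 'd) two_cat" +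
  fixes map0 :: "'o \<Rightarrow> 'p" and map1 :: "'o \<Rightarrow> 'o \<Rightarrow> 'f \<Rightarrow> 'g" and map2 :: "'o \<Rightarrow> 'o \<Rightarrow> 'c \<Rightarrow> 'd"
  assumes map0_closed: "A \<in> ob2 S \<Longrightarrow> map0 A \<in> ob2 T"
    and map1_closed: "\<lbrakk>A \<in> ob2 S; B \<in> ob2 S; f \<in> cells1 S A B\<rbrakk>
      \<Longrightarrow> map1 A B f \<in> cells1 T (map0 A) (map0 B)"
    and map1_id: "A \<in> ob2 S \<Longrightarrow> map1 A A (id1 S A) = id1 T (map0 A)"
    and map1_comp: "\<lbrakk>A \<in> ob2 S; B \<in> ob2 S; C \<in> ob2 S; f \<in> cells1 S A B; g \<in> cells1 S B C\<rbrakk>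
      \<Longrightarrow> map1 A C (comp1 S A B C g f) =
          comp1 T (map0 A) (map0 B) (map0 C) (map1 B C g) (map1 A B f)"
    and map2_id: "\<lbrakk>A \<in> ob2 S; B \<in> ob2 S; f \<in> cells1 S A B\<rbrakk>
      \<Longrightarrow> map2 A B (id2 S A B f) = id2 T (map0 A) (map0 B) (map1 A B f)"
    and map2_vcomp: "\<lbrakk>A \<in> ob2 S; B \<in> ob2 S; \<alpha> \<in> cells2 S A B f g; \<beta> \<in> cells2 S A B g h\<rbrakk>
      \<Longrightarrow> map2 A B (vcomp S A B \<beta> \<alpha>) = vcomp T (map0 A) (map0 B) (map2 A B \<beta>) (map2 A B \<alpha>)"
    and map2_lwhisker: "\<lbrakk>A \<in> ob2 S; B \<in> ob2 S; C \<in> ob2 S; \<alpha> \<in> cells2 S A B f g; h \<in> cells1 S B C\<rbrakk>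
      \<Longrightarrow> map2 A C (lwhisker S A B C h \<alpha>) =
          lwhisker T (map0 A) (map0 B) (map0 C) (map1 B C h) (map2 A B \<alpha>)"
    and map2_rwhisker: "\<lbrakk>A \<in> ob2 S; B \<in> ob2 S; C \<in> ob2 S; \<alpha> \<in> cells2 S B C f g; h \<in> cells1 S A B\<rbrakk>
      \<Longrightarrow> map2 A C (rwhisker S A B C \<alpha> h) =
          rwhisker T (map0 A) (map0 B) (map0 C) (map2 B C \<alpha>) (map1 A B h)"
    and map2_bij: "\<lbrakk>A \<in> ob2 S; B \<in> ob2 S; f \<in> cells1 S A B; g \<in> cells1 S A B\<rbrakk>
      \<Longrightarrow> bij_betw (map2 A B) (cells2 S A B f g)
            (cells2 T (map0 A) (map0 B) (map1 A B f) (map1 A B g))"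
    and map1_essentially_surjective: "\<lbrakk>A \<in> ob2 S; B \<in> ob2 S; k \<in> cells1 T (map0 A) (map0 B)\<rbrakk>
      \<Longrightarrow> \<exists>f\<in>cells1 S A B. \<exists>\<kappa> \<kappa>'. inverse2 T (map0 A) (map0 B) (map1 A B f) k \<kappa> \<kappa>'"
    and map0_retract: "X \<in> ob2 T \<Longrightarrow> \<exists>A\<in>ob2 S. \<exists>e\<in>cells1 T (map0 A) X. \<exists>e'\<in>cells1 T X (map0 A).
      \<exists>\<theta> \<theta>'. inverse2 T X X (comp1 T X (map0 A) X e e') (id1 T X) \<theta> \<theta>'"
begin

lemma biequivalence_co_dual: "biequivalence (co_dual S) (co_dual T) map0 map1 map2"
proof -
  interpret S': two_category "co_dual S" by (rule two_category_co_dual) (rule S.two_category_axioms)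
  interpret T': two_category "co_dual T" by (rule two_category_co_dual) (rule T.two_category_axioms)
  show ?thesis
  proof unfold_locales
    fix X assume "X \<in> ob2 (co_dual T)"
    then show "\<exists>A\<in>ob2 (co_dual S). \<exists>e\<in>cells1 (co_dual T) (map0 A) X. \<exists>e'\<in>cells1 (co_dual T) X (map0 A).
      \<exists>\<theta> \<theta>'. inverse2 (co_dual T) X X (comp1 (co_dual T) X (map0 A) X e e') (id1 (co_dual T) X) \<theta> \<theta>'"
      using map0_retract[of X] by (simp add: inverse2_co_dual) blast
  next
    fix A B h assume "A \<in> ob2 (co_dual S)" "B \<in> ob2 (co_dual S)" "h \<in> cells1 (co_dual T) (map0 A) (map0 B)"
    then show "\<exists>f\<in>cells1 (co_dual S) A B. \<exists>\<kappa> \<kappa>'. inverse2 (co_dual T) (map0 A) (map0 B) (map1 A B f) h \<kappa> \<kappa>'"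
      using map1_essentially_surjective[of A B h] by (simp add: inverse2_co_dual) blast
  qed (auto intro: map0_closed map1_closed map1_id map1_comp map2_id map2_vcomp map2_lwhisker
       map2_rwhisker map2_bij)
qed

lemma map2_closed:
  "\<lbrakk>A \<in> ob2 S; B \<in> ob2 S; \<alpha> \<in> cells2 S A B f g\<rbrakk>
    \<Longrightarrow> map2 A B \<alpha> \<in> cells2 T (map0 A) (map0 B) (map1 A B f) (map1 A B g)"
  using map2_bij[of A B f g] S.cells2_boundary[of A B \<alpha> f g] by (auto simp: bij_betw_def)

lemma map2_full:
  assumes "A \<in> ob2 S" "B \<in> ob2 S" "f \<in> cells1 S A B" "g \<in> cells1 S A B"
    and "\<beta> \<in> cells2 T (map0 A) (map0 B) (map1 A B f) (map1 A B g)"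
  obtains \<alpha> where "\<alpha> \<in> cells2 S A B f g" "map2 A B \<alpha> = \<beta>"
  using map2_bij[OF assms(1-4)] assms(5) that by (metis bij_betw_imp_surj_on imageE)

lemma map2_faithful:
  "\<lbrakk>A \<in> ob2 S; B \<in> ob2 S; \<alpha> \<in> cells2 S A B f g; \<beta> \<in> cells2 S A B f g\<rbrakk>
    \<Longrightarrow> map2 A B \<alpha> = map2 A B \<beta> \<longleftrightarrow> \<alpha> = \<beta>"
  using map2_bij[of A B f g] S.cells2_boundary[of A B \<alpha> f g] by (auto simp: bij_betw_def inj_on_def)

text \<open>\<open>map2\<close> is bijective on the source and the target of the pasting map and
  commutes with pasting, so either pasting map is bijective iff the other is.\<close>

lemma lifts_at_map:
  assumes "lifting_data S C B A g f l lam" and X: "X \<in> ob2 S"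
    and c: "c \<in> cells1 S X C" and b: "b \<in> cells1 S X B"
  shows "lifts_at S C B A g f l lam X c b \<longleftrightarrow>
    lifts_at T (map0 C) (map0 B) (map0 A) (map1 C A g) (map1 B A f) (map1 C B l) (map2 C A lam)
      (map0 X) (map1 X C c) (map1 X B b)"
proof -
  interpret L: lifting_data S C B A g f l lam by fact
  note lc = S.comp1_closed[OF X L.obs(1,2) c L.ones(3)]
  note fb = S.comp1_closed[OF X L.obs(2,3) b L.ones(2)]
  note gc = S.comp1_closed[OF X L.obs(1,3) c L.ones(1)]
  let ?l = "lift_map T (map0 X) (map0 C) (map0 B) (map0 A) (map1 B A f) (map2 C A lam) (map1 X C c)"
  have "(map2 X A \<circ> L.lift X c) \<zeta> = (?l \<circ> map2 X B) \<zeta>"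
    if \<zeta>: "\<zeta> \<in> cells2 S X B b (comp1 S X C B l c)" for \<zeta>
    by (simp add: lift_map_def map2_rwhisker[OF X L.obs(1,3) L.lam c] map2_lwhisker[OF X L.obs(2,3) \<zeta> L.ones(2)]
      map2_vcomp[OF X L.obs(3) S.lwhisker_closed[OF X L.obs(2,3) \<zeta> L.ones(2)] L.lam_whisker[OF X c]])
  then have "bij_betw (map2 X A \<circ> L.lift X c) (cells2 S X B b (comp1 S X C B l c)) R
    \<longleftrightarrow> bij_betw (?l \<circ> map2 X B) (cells2 S X B b (comp1 S X C B l c)) R" for R
    by (rule bij_betw_cong)
  note comp_eq = this
  have "L.lift X c ` cells2 S X B b (comp1 S X C B l c) \<subseteq> cells2 S X A (comp1 S X B A f b) (comp1 S X C A g c)"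
    using L.lift_closed[OF X c] by blast
  from bij_betw_comp_iff2[OF map2_bij[OF X L.obs(3) fb gc] this]
  show ?thesis
    unfolding lifts_at_def comp_eq bij_betw_comp_iff[OF map2_bij[OF X L.obs(2) b lc], symmetric]
    by (simp add: map1_comp[OF X L.obs(1,2) c L.ones(3)] map1_comp[OF X L.obs(2,3) b L.ones(2)]
      map1_comp[OF X L.obs(1,3) c L.ones(1)])
qed

lemma lifting_data_map:
  assumes "lifting_data S C B A g f l lam"
  shows "lifting_data T (map0 C) (map0 B) (map0 A) (map1 C A g) (map1 B A f) (map1 C B l) (map2 C A lam)"
proof -
  interpret L: lifting_data S C B A g f l lam by fact
  show ?thesis
    using L.obs L.ones map2_closed[OF L.obs(1,3) L.lam]
    by unfold_locales (auto simp: map1_comp intro: map0_closed map1_closed)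
qed

lemma absolute_right_lifting_map:
  assumes "lifting_data S C B A g f l lam"
  shows "absolute_right_lifting S C B A g f l lam \<longleftrightarrow>
    absolute_right_lifting T (map0 C) (map0 B) (map0 A) (map1 C A g) (map1 B A f) (map1 C B l) (map2 C A lam)"
proof -
  interpret L: lifting_data S C B A g f l lam by fact
  interpret L': lifting_data T "map0 C" "map0 B" "map0 A" "map1 C A g" "map1 B A f" "map1 C B l" "map2 C A lam"
    by (rule lifting_data_map[OF assms])
  show ?thesis
    unfolding L.absolute_right_lifting_iff L'.absolute_right_lifting_iff
  proof (intro iffI ballI)
    fix X c b assume L: "\<forall>X\<in>ob2 S. \<forall>c\<in>cells1 S X C. \<forall>b\<in>cells1 S X B. lifts_at S C B A g f l lam X c b"
      and X: "X \<in> ob2 T" and c: "c \<in> cells1 T X (map0 C)" and b: "b \<in> cells1 T X (map0 B)"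
    \<comment> \<open>An arbitrary test pair over \<open>X\<close> is restricted to some
      \<open>map0 Y\<close>, where \<open>c e\<close> and \<open>b e\<close> are isomorphic to
      images of 1-cells of \<open>S\<close>. The lifting property then climbs back by
      \<open>lifts_at_iso\<close> and \<open>lifts_at_retract\<close>.\<close>
    obtain Y e e' \<theta> \<theta>' where Y: "Y \<in> ob2 S" and e: "e \<in> cells1 T (map0 Y) X" "e' \<in> cells1 T X (map0 Y)"
      and \<theta>: "inverse2 T X X (comp1 T X (map0 Y) X e e') (id1 T X) \<theta> \<theta>'"
      using map0_retract[OF X] by blast
    note Y' = map0_closed[OF Y]
    obtain c0 \<gamma> \<gamma>' where c0: "c0 \<in> cells1 S Y C" "inverse2 T (map0 Y) (map0 C) (map1 Y C c0) (comp1 T (map0 Y) X (map0 C) c e) \<gamma> \<gamma>'"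
      using map1_essentially_surjective[OF Y L.obs(1) T.comp1_closed[OF Y' X L'.obs(1) e(1) c]] by blast
    obtain b0 \<delta> \<delta>' where b0: "b0 \<in> cells1 S Y B" "inverse2 T (map0 Y) (map0 B) (map1 Y B b0) (comp1 T (map0 Y) X (map0 B) b e) \<delta> \<delta>'"
      using map1_essentially_surjective[OF Y L.obs(2) T.comp1_closed[OF Y' X L'.obs(2) e(1) b]] by blast
    have "lifts_at S C B A g f l lam Y c0 b0" using L Y c0(1) b0(1) by blast
    then show "lifts_at T (map0 C) (map0 B) (map0 A) (map1 C A g) (map1 B A f) (map1 C B l) (map2 C A lam) X c b"
      unfolding lifts_at_map[OF assms Y c0(1) b0(1)]
      by (intro L'.lifts_at_retract[OF X Y' e \<theta> c b] L'.lifts_at_iso[OF Y' c0(2) b0(2)])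
  qed (simp add: lifts_at_map[OF assms] map0_closed map1_closed L.obs)
qed

text \<open>A lifting 2-cell in \<open>T\<close> has a preimage, because its boundary consists of
  images and \<open>map2\<close> is full.\<close>

lemma ex_absolute_right_lifting_map:
  assumes o: "C \<in> ob2 S" "B \<in> ob2 S" "A \<in> ob2 S"
    and f: "g \<in> cells1 S C A" "f \<in> cells1 S B A" "l \<in> cells1 S C B"
  shows "(\<exists>lam. absolute_right_lifting S C B A g f l lam) \<longleftrightarrow>
    (\<exists>lam. absolute_right_lifting T (map0 C) (map0 B) (map0 A) (map1 C A g) (map1 B A f) (map1 C B l) lam)"
proof
  assume "\<exists>lam. absolute_right_lifting S C B A g f l lam"
  then show "\<exists>lam. absolute_right_lifting T (map0 C) (map0 B) (map0 A) (map1 C A g) (map1 B A f) (map1 C B l) lam"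
    using absolute_right_lifting_map S.lifting_dataI by blast
next
  assume "\<exists>lam. absolute_right_lifting T (map0 C) (map0 B) (map0 A) (map1 C A g) (map1 B A f) (map1 C B l) lam"
  then obtain lam' where L: "absolute_right_lifting T (map0 C) (map0 B) (map0 A) (map1 C A g) (map1 B A f) (map1 C B l) lam'" ..
  then have "lam' \<in> cells2 T (map0 C) (map0 A) (map1 C A (comp1 S C B A f l)) (map1 C A g)"
    by (simp add: absolute_right_lifting_def map1_comp o f)
  then obtain lam where lam: "lam \<in> cells2 S C A (comp1 S C B A f l) g" "map2 C A lam = lam'"
    by (rule map2_full[OF o(1,3) S.comp1_closed[OF o f(3,2)] f(1)])
  then have "lifting_data S C B A g f l lam" using o f by unfold_locales auto
  then show "\<exists>lam. absolute_right_lifting S C B A g f l lam"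
    using absolute_right_lifting_map L lam(2) by blast
qed

text \<open>A lifting 1-cell in \<open>T\<close> is only isomorphic to an image;
  \<open>absolute_right_lifting_iso\<close> replaces it by that image before the
  fixed-\<open>l\<close> version is applied.\<close>

lemma ex_absolute_right_lifting_map_ex:
  assumes o: "C \<in> ob2 S" "B \<in> ob2 S" "A \<in> ob2 S" and f: "g \<in> cells1 S C A" "f \<in> cells1 S B A"
  shows "(\<exists>l\<in>cells1 S C B. \<exists>lam. absolute_right_lifting S C B A g f l lam) \<longleftrightarrow>
    (\<exists>l\<in>cells1 T (map0 C) (map0 B). \<exists>lam. 
      absolute_right_lifting T (map0 C) (map0 B) (map0 A) (map1 C A g) (map1 B A f) l lam)"
proof
  assume "\<exists>l\<in>cells1 T (map0 C) (map0 B). \<exists>lam. 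
      absolute_right_lifting T (map0 C) (map0 B) (map0 A) (map1 C A g) (map1 B A f) l lam"
  then obtain l' lam where l': "l' \<in> cells1 T (map0 C) (map0 B)"
    "absolute_right_lifting T (map0 C) (map0 B) (map0 A) (map1 C A g) (map1 B A f) l' lam" by blast
  obtain l \<kappa> \<kappa>' where l: "l \<in> cells1 S C B" "inverse2 T (map0 C) (map0 B) (map1 C B l) l' \<kappa> \<kappa>'"
    using map1_essentially_surjective[OF o(1,2) l'(1)] by blast
  show "\<exists>l\<in>cells1 S C B. \<exists>lam. absolute_right_lifting S C B A g f l lam"
    using ex_absolute_right_lifting_map[OF o f l(1)] T.absolute_right_lifting_iso[OF l'(2) l(2)] l(1) by blast
qed (use ex_absolute_right_lifting_map[OF o f] map1_closed[OF o(1,2)] in blast)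

text \<open>Fullness supplies preimages of unit and counit, and faithfulness reflects the triangle
  identities, which are equations between parallel 2-cells.\<close>

lemma left_adjoint_to_map:
  assumes A: "A \<in> ob2 S" and B: "B \<in> ob2 S" and f: "f \<in> cells1 S B A" and u: "u \<in> cells1 S A B"
  shows "left_adjoint_to S A B f u \<longleftrightarrow> left_adjoint_to T (map0 A) (map0 B) (map1 B A f) (map1 A B u)"
proof -
  note uf = S.comp1_closed[OF B A B f u] and fu = S.comp1_closed[OF A B A u f]
  note i = S.id1_closed[OF A] S.id1_closed[OF B]
  have map_iff: "is_adjunction S A B f u \<eta> \<epsilon> \<longleftrightarrow>
     is_adjunction T (map0 A) (map0 B) (map1 B A f) (map1 A B u) (map2 B B \<eta>) (map2 A A \<epsilon>)"
    if \<eta>: "\<eta> \<in> cells2 S B B (id1 S B) (comp1 S B A B u f)" and \<epsilon>: "\<epsilon> \<in> cells2 S A A (comp1 S A B A f u) (id1 S A)" for \<eta> \<epsilon>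
  proof -
    note \<epsilon>f = S.rwhisker_closed[OF B A A \<epsilon> f, unfolded S.comp1_id_left[OF B A f]]
    note f\<eta> = S.lwhisker_closed[OF B B A \<eta> f, unfolded S.comp1_id_right[OF B A f] S.comp1_assoc[OF B A B A f u f]]
    note u\<epsilon> = S.lwhisker_closed[OF A A B \<epsilon> u, unfolded S.comp1_id_right[OF A B u] S.comp1_assoc[OF A B A B u f u]]
    note \<eta>u = S.rwhisker_closed[OF A B B \<eta> u, unfolded S.comp1_id_left[OF A B u]]
    have "vcomp S B A (rwhisker S B A A \<epsilon> f) (lwhisker S B B A f \<eta>) = id2 S B A f \<longleftrightarrow>
      map2 B A (vcomp S B A (rwhisker S B A A \<epsilon> f) (lwhisker S B B A f \<eta>)) = map2 B A (id2 S B A f)"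
      by (rule map2_faithful[symmetric, OF B A S.vcomp_closed[OF B A f\<eta> \<epsilon>f] S.id2_closed[OF B A f]])
    moreover have "vcomp S A B (lwhisker S A A B u \<epsilon>) (rwhisker S A B B \<eta> u) = id2 S A B u \<longleftrightarrow>
      map2 A B (vcomp S A B (lwhisker S A A B u \<epsilon>) (rwhisker S A B B \<eta> u)) = map2 A B (id2 S A B u)"
      by (rule map2_faithful[symmetric, OF A B S.vcomp_closed[OF A B \<eta>u u\<epsilon>] S.id2_closed[OF A B u]])
    ultimately show ?thesis
      using A B f u map0_closed map1_closed \<eta> \<epsilon> map2_closed[OF B B \<eta>] map2_closed[OF A A \<epsilon>]
      by (simp add: is_adjunction_def map2_vcomp[OF B A f\<eta> \<epsilon>f] map2_vcomp[OF A B \<eta>u u\<epsilon>] map2_id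
        map2_rwhisker[OF B A A \<epsilon> f] map2_lwhisker[OF B B A \<eta> f] map2_lwhisker[OF A A B \<epsilon> u] map2_rwhisker[OF A B B \<eta> u]
        map1_id map1_comp)
  qed
  show ?thesis
  proof
    assume "left_adjoint_to S A B f u"
    then obtain \<eta> \<epsilon> where "is_adjunction S A B f u \<eta> \<epsilon>" by (auto simp: left_adjoint_to_def)
    with map_iff[of \<eta> \<epsilon>] show "left_adjoint_to T (map0 A) (map0 B) (map1 B A f) (map1 A B u)"
      unfolding left_adjoint_to_def is_adjunction_def[of S] by blast
  next
    assume "left_adjoint_to T (map0 A) (map0 B) (map1 B A f) (map1 A B u)"
    then obtain \<eta>' \<epsilon>' where adj: "is_adjunction T (map0 A) (map0 B) (map1 B A f) (map1 A B u) \<eta>' \<epsilon>'"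
      by (auto simp: left_adjoint_to_def)
    then have *: "\<eta>' \<in> cells2 T (map0 B) (map0 B) (map1 B B (id1 S B)) (map1 B B (comp1 S B A B u f))"
      "\<epsilon>' \<in> cells2 T (map0 A) (map0 A) (map1 A A (comp1 S A B A f u)) (map1 A A (id1 S A))"
      using A B f u by (simp_all add: is_adjunction_def map1_id map1_comp)
    obtain \<eta> where \<eta>: "\<eta> \<in> cells2 S B B (id1 S B) (comp1 S B A B u f)" "map2 B B \<eta> = \<eta>'"
      by (rule map2_full[OF B B i(2) uf *(1)])
    obtain \<epsilon> where \<epsilon>: "\<epsilon> \<in> cells2 S A A (comp1 S A B A f u) (id1 S A)" "map2 A A \<epsilon> = \<epsilon>'"
      by (rule map2_full[OF A A fu i(1) *(2)])
    have "is_adjunction S A B f u \<eta> \<epsilon>"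
      using adj unfolding map_iff[OF \<eta>(1) \<epsilon>(1)] \<eta>(2) \<epsilon>(2) .
    then show "left_adjoint_to S A B f u" by (auto simp: left_adjoint_to_def)
  qed
qed

text \<open>An adjoint found in \<open>T\<close> is isomorphic to an image, and
  \<open>left_adjoint_to_iso\<close> moves the adjunction to that image.\<close>

lemma admits_left_adjoint_map:
  assumes A: "A \<in> ob2 S" and B: "B \<in> ob2 S" and u: "u \<in> cells1 S A B"
  shows "admits_left_adjoint S A B u \<longleftrightarrow> admits_left_adjoint T (map0 A) (map0 B) (map1 A B u)"
proof
  assume "admits_left_adjoint T (map0 A) (map0 B) (map1 A B u)"
  then obtain f' where f': "f' \<in> cells1 T (map0 B) (map0 A)" "left_adjoint_to T (map0 A) (map0 B) f' (map1 A B u)"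
    by (auto simp: admits_left_adjoint_def)
  obtain f \<kappa> \<kappa>' where f: "f \<in> cells1 S B A" "inverse2 T (map0 B) (map0 A) (map1 B A f) f' \<kappa> \<kappa>'"
    using map1_essentially_surjective[OF B A f'(1)] by blast
  have "left_adjoint_to T (map0 A) (map0 B) (map1 B A f) (map1 A B u)"
    using T.left_adjoint_to_iso[OF f'(2)] f(2) inverse2_sym by metis
  then show "admits_left_adjoint S A B u"
    using left_adjoint_to_map[OF A B f(1) u] f(1) by (auto simp: admits_left_adjoint_def)
qed (use left_adjoint_to_map[OF A B _ u] map1_closed[OF B A] in \<open>auto simp: admits_left_adjoint_def\<close>)

lemma admits_right_adjoint_map:
  assumes "A \<in> ob2 S" "B \<in> ob2 S" "u \<in> cells1 S A B"
  shows "admits_right_adjoint S A B u \<longleftrightarrow> admits_right_adjoint T (map0 A) (map0 B) (map1 A B u)"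
  unfolding admits_right_adjoint_co_dual
  using assms by (intro biequivalence.admits_left_adjoint_map[OF biequivalence_co_dual]) simp_all

end

section \<open>Equivalences of quasi-categories on homotopy categories\<close>

text \<open>The union over representatives avoids a choice; by \<open>ho_map_class\<close> all of
  them contribute the same class.\<close>

definition ho_map :: "'b sset \<Rightarrow> (nat \<Rightarrow> 'a \<Rightarrow> 'b) \<Rightarrow> 'a set \<Rightarrow> 'b set" where
  "ho_map Y f \<alpha> = (\<Union>e\<in>\<alpha>. ho_class Y (f 1 e))"

lemma ho_map_class:
  assumes "quasi_category X" "quasi_category Y" "simplicial_map X Y f" "e \<in> edges X x y"
  shows "ho_map Y f (ho_class X e) = ho_class Y (f 1 e)"
proof -
  interpret X: quasi_category X by fact
  interpret Y: quasi_category Y by fact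
  have y: "y \<in> simplices X 0" using X.edges_vertices[OF assms(4)] by simp
  have "ho_class Y (f 1 e') = ho_class Y (f 1 e)" if "e' \<in> ho_class X e" for e'
  proof -
    have "tri X e (degen X 1 y) e'" using X.mem_ho_class assms(4) that by blast
    from simplicial_map_tri[OF assms(3) this]
    have "tri Y (f 1 e) (degen Y 1 (f 0 y)) (f 1 e')"
      using simplicial_map_degen[OF assms(3) y, of 1] by (simp only:)
    then show ?thesis
      by (rule Y.ho_class_eqI[OF simplicial_map_edges[OF assms(3,4)], symmetric])
  qed
  then show ?thesis unfolding ho_map_def using X.ho_class_self[OF assms(4)] by blast
qed

text \<open>An edge given by its two vertices, serving both \<open>Delta n\<close> and the nerve
  \<open>walking_iso\<close>.\<close>

definition pair_op :: "'a \<Rightarrow> 'a \<Rightarrow> nat \<Rightarrow> 'a" where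
  "pair_op a b = (\<lambda>i\<in>{..1}. if i = 0 then a else b)"

lemma tri_walking_iso: "tri walking_iso (pair_op a b) (pair_op b c) (pair_op a c)"
proof -
  let ?s = "\<lambda>i\<in>{..2::nat}. if i = 0 then a else if i = 1 then b else c"
  show ?thesis
    by (rule triI[of ?s]) (auto simp: walking_iso_def face_def pair_op_def compose_def fun_eq_iff)
qed

lemma tri_Delta: 
  assumes "i \<le> j" "j \<le> k" "k \<le> n"
  shows "tri (Delta n) (pair_op i j) (pair_op j k) (pair_op i k)"
proof -
  let ?s = "\<lambda>l\<in>{..2::nat}. if l = 0 then i else if l = 1 then j else k"
  have "?s \<in> Op 2 n" by (rule OpI) (use assms in auto)
  then show ?thesis
    by (intro triI[of ?s]) (auto simp: Delta_def face_def pair_op_def compose_def fun_eq_iff)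
qed

lemma edges_walking_iso: "pair_op a b \<in> edges walking_iso (\<lambda>i\<in>{..0}. a) (\<lambda>i\<in>{..0}. b)"
  by (auto simp: edges_def walking_iso_def face_def pair_op_def compose_def fun_eq_iff)

lemma edges_Delta: 
  assumes "i \<le> j" "j \<le> n" shows "pair_op i j \<in> edges (Delta n) (\<lambda>l\<in>{..0}. i) (\<lambda>l\<in>{..0}. j)"
proof -
  have "pair_op i j \<in> Op 1 n" unfolding pair_op_def by (rule OpI) (use assms in auto)
  then show ?thesis by (auto simp: edges_def Delta_def face_def pair_op_def compose_def fun_eq_iff)
qed

text \<open>What a homotopy over the walking isomorphism leaves behind on homotopy categories: an
  invertible natural transformation with components \<open>\<theta>\<close>.\<close>

definition naturally_iso :: "'a sset \<Rightarrow> 'b sset \<Rightarrow> (nat \<Rightarrow> 'a \<Rightarrow> 'b) \<Rightarrow> (nat \<Rightarrow> 'a \<Rightarrow> 'b) \<Rightarrow> bool" where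
  "naturally_iso X Y p q \<longleftrightarrow> (\<exists>\<theta> \<theta>'.
     (\<forall>x\<in>simplices X 0. \<theta> x \<in> ho_hom Y (p 0 x) (q 0 x) \<and> \<theta>' x \<in> ho_hom Y (q 0 x) (p 0 x) \<and>
        ho_comp Y (\<theta>' x) (\<theta> x) = ho_id Y (p 0 x) \<and> ho_comp Y (\<theta> x) (\<theta>' x) = ho_id Y (q 0 x)) \<and>
     (\<forall>x y. \<forall>e\<in>edges X x y.
        ho_comp Y (\<theta> y) (ho_class Y (p 1 e)) = ho_comp Y (ho_class Y (q 1 e)) (\<theta> x)))"

text \<open>A vertex gives a map to \<open>Y\<close> from \<open>walking_iso\<close> times
  \<open>Delta 0\<close>, which sends the two arrows of \<open>walking_iso\<close> to inverse
  classes. An edge gives a map from \<open>walking_iso\<close> times \<open>Delta 1\<close>, which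
  contains the naturality square.\<close>

lemma naturally_iso_sexp:
  assumes X: "quasi_category X" and Y: "quasi_category Y"
    and h: "simplicial_map X (sexp Y walking_iso) h"
    and ev: "\<And>n a. a \<in> simplices X n \<Longrightarrow> walking_iso_ev False n (h n a) = p n a"
      "\<And>n a. a \<in> simplices X n \<Longrightarrow> walking_iso_ev True n (h n a) = q n a"
  shows "naturally_iso X Y p q"
proof -
  interpret X: quasi_category X by fact
  interpret Y: quasi_category Y by fact
  \<comment> \<open>The image of the arrow from \<open>b\<close> to \<open>\<not> b\<close>: it runs
    from \<open>p\<close> to \<open>q\<close> for \<open>b = False\<close> and back for
    \<open>b = True\<close>.\<close>
  define \<theta> where "\<theta> b x = h 0 x 1 (pair_op b (\<not> b), pair_op 0 0)" for b x
  have smap: "simplicial_map (sprod walking_iso (Delta n)) Y (h n x)" if "x \<in> simplices X n" for n x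
    using simplicial_mapD(1)[OF h that] by (simp add: sexp_def)
  let ?w = "\<lambda>b. \<lambda>i\<in>{..0::nat}. b :: bool" and ?d = "\<lambda>j. \<lambda>i\<in>{..0::nat}. j :: nat"
  let ?p = "\<lambda>b. if b then q else p"
  have p0: "h 0 x 0 (?w b, ?d 0) = ?p b 0 x" if "x \<in> simplices X 0" for x b
  proof -
    have "(\<lambda>i\<in>{..0::nat}. i) = ?d 0" by (auto simp: fun_eq_iff)
    then show ?thesis using ev[OF that] by (auto simp: walking_iso_ev_def walking_iso_vertex_def)
  qed
  have edge: "\<theta> b x \<in> edges Y (?p b 0 x) (?p (\<not> b) 0 x)" if x: "x \<in> simplices X 0" for x b
  proof -
    have "(pair_op b (\<not> b), pair_op 0 0) \<in> edges (sprod walking_iso (Delta 0)) (?w b, ?d 0) (?w (\<not> b), ?d 0)"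
      unfolding edges_sprod using edges_walking_iso edges_Delta by blast
    from simplicial_map_edges[OF smap[OF x] this] show ?thesis
      unfolding \<theta>_def p0[OF x] .
  qed
  have inv: "tri Y (\<theta> b x) (\<theta> (\<not> b) x) (degen Y 1 (?p b 0 x))" if x: "x \<in> simplices X 0" for x b
  proof -
    have v: "(?w b, ?d 0) \<in> simplices (sprod walking_iso (Delta 0)) 0"
      by (auto simp: sprod_def walking_iso_def Delta_def Op_def mono_on_def)
    have "degen (sprod walking_iso (Delta 0)) 1 (?w b, ?d 0) = (pair_op b b, pair_op 0 0)"
      unfolding degen_sprod by (auto simp: degen_def walking_iso_def Delta_def compose_def pair_op_def fun_eq_iff)
    then have "h 0 x 1 (pair_op b b, pair_op 0 0) = degen Y 1 (?p b 0 x)"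
      using simplicial_map_degen[OF smap[OF x] v, of 1] unfolding p0[OF x] by metis
    moreover have "tri (sprod walking_iso (Delta 0)) (pair_op b (\<not> b), pair_op 0 0) (pair_op (\<not> b) b, pair_op 0 0) (pair_op b b, pair_op 0 0)"
      by (intro tri_sprod tri_walking_iso tri_Delta) auto
    ultimately show ?thesis
      using simplicial_map_tri[OF smap[OF x], of "(pair_op b (\<not> b), pair_op 0 0)" "(pair_op (\<not> b) b, pair_op 0 0)"
          "(pair_op b b, pair_op 0 0)"]
      unfolding \<theta>_def by (cases b) simp_all
  qed
  \<comment> \<open>The naturality square is cut by the diagonal of \<open>walking_iso\<close> times
    \<open>Delta 1\<close> into two triangles; \<open>d\<close> is the image of the
    diagonal.\<close>
  have nat: "\<exists>d. tri Y (p 1 e) (\<theta> False y) d \<and> tri Y (\<theta> False x) (q 1 e) d" if e: "e \<in> edges X x y" for e x y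
  proof -
    have e': "e \<in> simplices X 1" "face X 1 1 e = x" "face X 1 0 e = y" using e by (auto simp: edges_def)
    have mem: "(pair_op False True, pair_op 0 0) \<in> simplices (sprod walking_iso (Delta 0)) 1"
      using edges_walking_iso edges_Delta[of 0 0 0] by (auto simp: simplices_sprod edges_def)
    \<comment> \<open>Compatibility of \<open>h\<close> with faces places the components at both
      endpoints of \<open>e\<close> inside the single map \<open>h 1 e\<close>, as the edges over
      the vertices 0 and 1 of \<open>Delta 1\<close>.\<close>
    have res: "\<theta> False (face X 1 i e) = h 1 e 1 (pair_op False True, compose {..1} (coface 0 i) (pair_op 0 0))" for i
      using simplicial_mapD(2)[OF h _ e'(1), of "coface 0 i" 0] coface_Op[of 0 i] mem
      by (simp add: \<theta>_def face_Suc sexp_def)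
    have "compose {..1} (coface 0 1) (pair_op 0 0) = pair_op 0 0" "compose {..1} (coface 0 0) (pair_op 0 0) = pair_op 1 1"
      by (auto simp: compose_def coface_def pair_op_def fun_eq_iff)
    then have \<theta>: "\<theta> False x = h 1 e 1 (pair_op False True, pair_op 0 0)" "\<theta> False y = h 1 e 1 (pair_op False True, pair_op 1 1)"
      using res[of 1] res[of 0] e' by simp_all
    have "(\<lambda>i\<in>{..1}. i) = pair_op 0 (1::nat)" "walking_iso_vertex b 1 = pair_op b b" for b
      by (auto simp: pair_op_def walking_iso_vertex_def fun_eq_iff)
    then have pq: "p 1 e = h 1 e 1 (pair_op False False, pair_op 0 1)" "q 1 e = h 1 e 1 (pair_op True True, pair_op 0 1)"
      using ev[OF e'(1)] by (simp_all add: walking_iso_ev_def)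
    have "tri (sprod walking_iso (Delta 1)) (pair_op False False, pair_op 0 1) (pair_op False True, pair_op 1 1) (pair_op False True, pair_op 0 1)"
      "tri (sprod walking_iso (Delta 1)) (pair_op False True, pair_op 0 0) (pair_op True True, pair_op 0 1) (pair_op False True, pair_op 0 1)"
      by (intro tri_sprod tri_walking_iso tri_Delta; simp)+
    from this[THEN simplicial_map_tri[OF smap[OF e'(1)]]] show ?thesis
      unfolding \<theta> pq by blast
  qed
  show ?thesis
    unfolding naturally_iso_def
  proof (rule exI[of _ "\<lambda>x. ho_class Y (\<theta> False x)"], rule exI[of _ "\<lambda>x. ho_class Y (\<theta> True x)"],
      intro conjI ballI allI)
    fix x assume x: "x \<in> simplices X 0"
    have e: "\<theta> False x \<in> edges Y (p 0 x) (q 0 x)" "\<theta> True x \<in> edges Y (q 0 x) (p 0 x)"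
      using edge[OF x, of False] edge[OF x, of True] by simp_all
    show "ho_class Y (\<theta> False x) \<in> ho_hom Y (p 0 x) (q 0 x)" "ho_class Y (\<theta> True x) \<in> ho_hom Y (q 0 x) (p 0 x)"
      using e by (auto intro: Y.ho_homI)
    show "ho_comp Y (ho_class Y (\<theta> True x)) (ho_class Y (\<theta> False x)) = ho_id Y (p 0 x)"
      unfolding ho_id_def using Y.ho_comp_class[OF e] inv[OF x, of False] by simp
    show "ho_comp Y (ho_class Y (\<theta> False x)) (ho_class Y (\<theta> True x)) = ho_id Y (q 0 x)"
      unfolding ho_id_def using Y.ho_comp_class[OF e(2,1)] inv[OF x, of True] by simp
  next
    fix x y e assume e: "e \<in> edges X x y"
    then have xy: "x \<in> simplices X 0" "y \<in> simplices X 0" "e \<in> simplices X 1" "face X 1 1 e = x" "face X 1 0 e = y"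
      using X.edges_vertices by (auto simp: edges_def)
    obtain d where d: "tri Y (p 1 e) (\<theta> False y) d" "tri Y (\<theta> False x) (q 1 e) d" using nat[OF e] by blast
    have t: "\<theta> False x \<in> edges Y (p 0 x) (q 0 x)" "\<theta> False y \<in> edges Y (p 0 y) (q 0 y)"
      using edge[OF xy(1), of False] edge[OF xy(2), of False] by simp_all
    obtain z where z: "q 1 e \<in> edges Y (q 0 x) z" "d \<in> edges Y (p 0 x) z"
      by (rule Y.tri_edges[OF d(2) t(1)])
    \<comment> \<open>\<open>p\<close> is known only through \<open>ev\<close>, not as a simplicial
      map, so the boundary of \<open>p 1 e\<close> is read off the triangle.\<close>
    have d0: "p 1 e \<in> simplices Y 1"
      using d(1) Y.face_closed[of _ 1 2, unfolded Suc_1] unfolding tri_def by metis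
    have "face Y 1 0 (p 1 e) = face Y 1 1 (\<theta> False y)" "face Y 1 1 (p 1 e) = face Y 1 1 d"
      using d(1) Y.face_face_2 unfolding tri_def by metis+
    then have "p 1 e \<in> edges Y (p 0 x) (p 0 y)"
      using t z d0 by (auto simp: edges_def)
    then show "ho_comp Y (ho_class Y (\<theta> False y)) (ho_class Y (p 1 e)) = ho_comp Y (ho_class Y (q 1 e)) (ho_class Y (\<theta> False x))"
      using Y.ho_comp_class[OF _ t(2) d(1)] Y.ho_comp_class[OF t(1) z(1) d(2)] by simp
  qed
qed

section \<open>Full faithfulness and essential surjectivity of equivalences\<close>

definition ho_faithful :: "'a sset \<Rightarrow> 'b sset \<Rightarrow> (nat \<Rightarrow> 'a \<Rightarrow> 'b) \<Rightarrow> bool" where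
  "ho_faithful X Y f \<longleftrightarrow> (\<forall>x y. \<forall>e\<in>edges X x y. \<forall>e'\<in>edges X x y.
     ho_class Y (f 1 e) = ho_class Y (f 1 e') \<longrightarrow> ho_class X e = ho_class X e')"

context quasi_category
begin

lemma ho_cancel:
  assumes "\<theta> \<in> ho_hom X x y" "\<theta>' \<in> ho_hom X y x" "ho_comp X \<theta>' \<theta> = ho_id X x"
  shows "\<alpha> \<in> ho_hom X z x \<Longrightarrow> ho_comp X \<theta>' (ho_comp X \<theta> \<alpha>) = \<alpha>"
    and "\<beta> \<in> ho_hom X x z \<Longrightarrow> ho_comp X (ho_comp X \<beta> \<theta>') \<theta> = \<beta>"
  using assms ho_comp_assoc[of \<alpha> z x \<theta> y \<theta>' x] ho_comp_id_left[of \<alpha> z x]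
    ho_comp_assoc[of \<theta> x y \<theta>' x \<beta> z] ho_comp_id_right[of \<beta> x z] by simp_all

end

text \<open>Naturality of the inverse components follows by composing the square with
  \<open>\<theta>'\<close> at both ends. The two homotopies of an equivalence have the identity at
  opposite ends, while faithfulness is transported only forwards; this lemma reverses the second
  one.\<close>

lemma naturally_iso_sym:
  assumes X: "quasi_category X" and Y: "quasi_category Y"
    and p: "simplicial_map X Y p" and q: "simplicial_map X Y q" and "naturally_iso X Y p q"
  shows "naturally_iso X Y q p"
proof -
  interpret X: quasi_category X by fact
  interpret Y: quasi_category Y by fact
  obtain \<theta> \<theta>' where \<theta>: "\<And>x. x\<in>simplices X 0 \<Longrightarrow> \<theta> x \<in> ho_hom Y (p 0 x) (q 0 x) \<and> \<theta>' x \<in> ho_hom Y (q 0 x) (p 0 x) \<and>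
        ho_comp Y (\<theta>' x) (\<theta> x) = ho_id Y (p 0 x) \<and> ho_comp Y (\<theta> x) (\<theta>' x) = ho_id Y (q 0 x)"
    and nat: "\<And>x y e. e\<in>edges X x y \<Longrightarrow> ho_comp Y (\<theta> y) (ho_class Y (p 1 e)) = ho_comp Y (ho_class Y (q 1 e)) (\<theta> x)"
    using assms(5) unfolding naturally_iso_def by blast
  have "ho_comp Y (\<theta>' y) (ho_class Y (q 1 e)) = ho_comp Y (ho_class Y (p 1 e)) (\<theta>' x)" if e: "e \<in> edges X x y" for x y e
  proof -
    have xy: "x \<in> simplices X 0" "y \<in> simplices X 0" using X.edges_vertices[OF e] by auto
    have pe: "ho_class Y (p 1 e) \<in> ho_hom Y (p 0 x) (p 0 y)" and qe: "ho_class Y (q 1 e) \<in> ho_hom Y (q 0 x) (q 0 y)"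
      using simplicial_map_edges[OF p e] simplicial_map_edges[OF q e] by (auto intro: Y.ho_homI)
    note x = \<theta>[OF xy(1)] and y = \<theta>[OF xy(2)]
    have "ho_comp Y (\<theta>' y) (ho_class Y (q 1 e))
        = ho_comp Y (\<theta>' y) (ho_comp Y (ho_comp Y (ho_class Y (q 1 e)) (\<theta> x)) (\<theta>' x))"
      using Y.ho_cancel(2)[of "\<theta>' x" "q 0 x" "p 0 x" "\<theta> x" "ho_class Y (q 1 e)"] x qe by simp
    also have "\<dots> = ho_comp Y (\<theta>' y) (ho_comp Y (ho_comp Y (\<theta> y) (ho_class Y (p 1 e))) (\<theta>' x))"
      using nat[OF e] by simp
    also have "\<dots> = ho_comp Y (\<theta>' y) (ho_comp Y (\<theta> y) (ho_comp Y (ho_class Y (p 1 e)) (\<theta>' x)))"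
      using Y.ho_comp_assoc[of "\<theta>' x" "q 0 x" "p 0 x" "ho_class Y (p 1 e)" "p 0 y" "\<theta> y" "q 0 y"] x y pe by simp
    also have "\<dots> = ho_comp Y (ho_class Y (p 1 e)) (\<theta>' x)"
      using Y.ho_cancel(1)[of "\<theta> y" _ _ "\<theta>' y"] x y pe Y.ho_comp_closed by blast
    finally show ?thesis .
  qed
  with \<theta> show ?thesis unfolding naturally_iso_def by blast
qed

text \<open>Naturality turns equal values under \<open>q\<close> into equal composites of
  \<open>\<theta> y\<close> with the values under \<open>p\<close>, and \<open>\<theta> y\<close> is
  cancelled.\<close>

lemma ho_faithful_naturally_iso:
  assumes X: "quasi_category X" and Y: "quasi_category Y" and p: "simplicial_map X Y p"
    and iso: "naturally_iso X Y p q" and f: "ho_faithful X Y p"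
  shows "ho_faithful X Y q"
  unfolding ho_faithful_def
proof (intro allI ballI impI)
  interpret X: quasi_category X by fact
  interpret Y: quasi_category Y by fact
  fix x y e e' assume e: "e \<in> edges X x y" "e' \<in> edges X x y" and q: "ho_class Y (q 1 e) = ho_class Y (q 1 e')"
  obtain \<theta> \<theta>' where \<theta>: "\<And>x. x\<in>simplices X 0 \<Longrightarrow> \<theta> x \<in> ho_hom Y (p 0 x) (q 0 x) \<and> \<theta>' x \<in> ho_hom Y (q 0 x) (p 0 x) \<and>
        ho_comp Y (\<theta>' x) (\<theta> x) = ho_id Y (p 0 x) \<and> ho_comp Y (\<theta> x) (\<theta>' x) = ho_id Y (q 0 x)"
    and nat: "\<And>x y e. e\<in>edges X x y \<Longrightarrow> ho_comp Y (\<theta> y) (ho_class Y (p 1 e)) = ho_comp Y (ho_class Y (q 1 e)) (\<theta> x)"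
    using iso unfolding naturally_iso_def by blast
  have y: "y \<in> simplices X 0" using X.edges_vertices[OF e(1)] by auto
  have pe: "ho_class Y (p 1 e) \<in> ho_hom Y (p 0 x) (p 0 y)" "ho_class Y (p 1 e') \<in> ho_hom Y (p 0 x) (p 0 y)"
    using simplicial_map_edges[OF p e(1)] simplicial_map_edges[OF p e(2)] by (auto intro: Y.ho_homI)
  have eq: "ho_comp Y (\<theta> y) (ho_class Y (p 1 e)) = ho_comp Y (\<theta> y) (ho_class Y (p 1 e'))"
    using nat[OF e(1)] nat[OF e(2)] q by simp
  have "ho_comp Y (\<theta>' y) (ho_comp Y (\<theta> y) \<alpha>) = \<alpha>" if "\<alpha> \<in> ho_hom Y (p 0 x) (p 0 y)" for \<alpha>
    using Y.ho_cancel(1)[of "\<theta> y" _ _ "\<theta>' y"] \<theta>[OF y] that by blast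
  from this[OF pe(1)] this[OF pe(2)] have "ho_class Y (p 1 e) = ho_class Y (p 1 e')" unfolding eq by (rule trans[OF sym])
  then show "ho_class X e = ho_class X e'" using f e unfolding ho_faithful_def by blast
qed

text \<open>Faithfulness of \<open>f\<close> and of \<open>g\<close> comes from that of
  \<open>g f\<close> and \<open>f g\<close>, each isomorphic to an identity. For fullness,
  conjugating \<open>g e\<close> by \<open>\<theta>\<close> gives \<open>a\<close> such that
  \<open>g f a\<close> and \<open>g e\<close> agree by naturality, and faithfulness of
  \<open>g\<close> then removes \<open>g\<close>.\<close>

lemma qcat_equivalence_ho_map_bij:
  assumes A: "quasi_category A" and B: "quasi_category B" and eq: "qcat_equivalence A B f"
    and x: "x \<in> simplices A 0" and y: "y \<in> simplices A 0"
  shows "bij_betw (ho_map B f) (ho_hom A x y) (ho_hom B (f 0 x) (f 0 y))"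
proof -
  interpret A: quasi_category A by fact
  interpret B: quasi_category B by fact
  obtain g h k where f: "simplicial_map A B f" and g: "simplicial_map B A g"
    and h: "simplicial_map A (sexp A walking_iso) h"
      "\<And>n a. a\<in>simplices A n \<Longrightarrow> walking_iso_ev False n (h n a) = a"
      "\<And>n a. a\<in>simplices A n \<Longrightarrow> walking_iso_ev True n (h n a) = g n (f n a)"
    and k: "simplicial_map B (sexp B walking_iso) k"
      "\<And>n b. b\<in>simplices B n \<Longrightarrow> walking_iso_ev False n (k n b) = f n (g n b)"
      "\<And>n b. b\<in>simplices B n \<Longrightarrow> walking_iso_ev True n (k n b) = b"
    using eq unfolding qcat_equivalence_def by blast
  have idA: "simplicial_map A A (\<lambda>n a. a)" and idB: "simplicial_map B B (\<lambda>n a. a)"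
    by (auto simp: simplicial_map_def)
  note gf = simplicial_map_comp[OF f g] and fg = simplicial_map_comp[OF g f]
  have nA: "naturally_iso A A (\<lambda>n a. a) (\<lambda>n a. g n (f n a))" by (rule naturally_iso_sexp[OF A A h])
  have nB: "naturally_iso B B (\<lambda>n a. f n (g n a)) (\<lambda>n a. a)" by (rule naturally_iso_sexp[OF B B k])
  have fA: "ho_faithful A A (\<lambda>n a. g n (f n a))"
    by (rule ho_faithful_naturally_iso[OF A A idA nA]) (auto simp: ho_faithful_def)
  have fB: "ho_faithful B B (\<lambda>n a. f n (g n a))"
    by (rule ho_faithful_naturally_iso[OF B B idB naturally_iso_sym[OF B B fg idB nB]]) (auto simp: ho_faithful_def)
  have f_faithful: "ho_class A e = ho_class A e'"
    if "e \<in> edges A u v" "e' \<in> edges A u v" "ho_class B (f 1 e) = ho_class B (f 1 e')" for e e' u v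
    using fA that ho_map_class[OF B A g simplicial_map_edges[OF f that(1)]] ho_map_class[OF B A g simplicial_map_edges[OF f that(2)]]
    unfolding ho_faithful_def by metis
  have g_faithful: "ho_class B e = ho_class B e'"
    if "e \<in> edges B u v" "e' \<in> edges B u v" "ho_class A (g 1 e) = ho_class A (g 1 e')" for e e' u v
    using fB that ho_map_class[OF A B f simplicial_map_edges[OF g that(1)]] ho_map_class[OF A B f simplicial_map_edges[OF g that(2)]]
    unfolding ho_faithful_def by metis
  have f_full: "\<exists>a\<in>edges A x y. ho_class B (f 1 a) = ho_class B e" if e: "e \<in> edges B (f 0 x) (f 0 y)" for e
  proof -
    obtain \<theta> \<theta>' where \<theta>: "\<And>x. x\<in>simplices A 0 \<Longrightarrow> \<theta> x \<in> ho_hom A x (g 0 (f 0 x)) \<and> \<theta>' x \<in> ho_hom A (g 0 (f 0 x)) x \<and>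
        ho_comp A (\<theta>' x) (\<theta> x) = ho_id A x \<and> ho_comp A (\<theta> x) (\<theta>' x) = ho_id A (g 0 (f 0 x))"
      and nat: "\<And>x y e. e\<in>edges A x y \<Longrightarrow> ho_comp A (\<theta> y) (ho_class A e) = ho_comp A (ho_class A (g 1 (f 1 e))) (\<theta> x)"
      using nA unfolding naturally_iso_def by blast
    note x' = \<theta>[OF x] and y' = \<theta>[OF y]
    have ge: "ho_class A (g 1 e) \<in> ho_hom A (g 0 (f 0 x)) (g 0 (f 0 y))"
      using simplicial_map_edges[OF g e] by (rule A.ho_homI)
    have ge\<theta>: "ho_comp A (ho_class A (g 1 e)) (\<theta> x) \<in> ho_hom A x (g 0 (f 0 y))"
      using A.ho_comp_closed x' ge by blast
    then have "ho_comp A (\<theta>' y) (ho_comp A (ho_class A (g 1 e)) (\<theta> x)) \<in> ho_hom A x y"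
      using A.ho_comp_closed y' by blast
    then obtain a where a: "a \<in> edges A x y" "ho_comp A (\<theta>' y) (ho_comp A (ho_class A (g 1 e)) (\<theta> x)) = ho_class A a"
      by (rule A.ho_homE)
    have gfa: "ho_class A (g 1 (f 1 a)) \<in> ho_hom A (g 0 (f 0 x)) (g 0 (f 0 y))"
      using simplicial_map_edges[OF gf a(1)] by (rule A.ho_homI)
    have "ho_comp A (ho_class A (g 1 (f 1 a))) (\<theta> x) = ho_comp A (\<theta> y) (ho_class A a)"
      by (rule nat[OF a(1), symmetric])
    also have "\<dots> = ho_comp A (ho_class A (g 1 e)) (\<theta> x)"
      unfolding a(2)[symmetric] using A.ho_cancel(1)[of "\<theta>' y" _ _ "\<theta> y"] y' ge\<theta> by blast
    finally have "ho_comp A (ho_comp A (ho_class A (g 1 (f 1 a))) (\<theta> x)) (\<theta>' x)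
        = ho_comp A (ho_comp A (ho_class A (g 1 e)) (\<theta> x)) (\<theta>' x)" by simp
    moreover have "ho_comp A (ho_comp A \<alpha> (\<theta> x)) (\<theta>' x) = \<alpha>" if "\<alpha> \<in> ho_hom A (g 0 (f 0 x)) (g 0 (f 0 y))" for \<alpha>
      using A.ho_cancel(2)[of "\<theta>' x" _ _ "\<theta> x"] x' that by blast
    ultimately have "ho_class A (g 1 (f 1 a)) = ho_class A (g 1 e)" using ge gfa by metis
    then show ?thesis using g_faithful[OF simplicial_map_edges[OF f a(1)] e] a(1) by blast
  qed
  show ?thesis
    unfolding bij_betw_def
  proof (rule conjI[OF inj_onI set_eqI[OF iffI]])
    fix \<alpha> \<beta> assume "\<alpha> \<in> ho_hom A x y" "\<beta> \<in> ho_hom A x y" and eq: "ho_map B f \<alpha> = ho_map B f \<beta>"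
    then obtain a b where ab: "a \<in> edges A x y" "\<alpha> = ho_class A a" "b \<in> edges A x y" "\<beta> = ho_class A b"
      by (meson A.ho_homE)
    then show "\<alpha> = \<beta>"
      using f_faithful[OF ab(1,3)] eq ho_map_class[OF A B f ab(1)] ho_map_class[OF A B f ab(3)] by simp
  next
    fix \<beta> assume "\<beta> \<in> ho_map B f ` ho_hom A x y"
    then obtain a where "a \<in> edges A x y" "\<beta> = ho_map B f (ho_class A a)" by (auto elim: A.ho_homE)
    then show "\<beta> \<in> ho_hom B (f 0 x) (f 0 y)"
      using ho_map_class[OF A B f] simplicial_map_edges[OF f] by (auto intro: B.ho_homI)
  next
    fix \<beta> assume "\<beta> \<in> ho_hom B (f 0 x) (f 0 y)"
    then obtain e where e: "e \<in> edges B (f 0 x) (f 0 y)" "\<beta> = ho_class B e" by (rule B.ho_homE)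
    then obtain a where a: "a \<in> edges A x y" "ho_class B (f 1 a) = ho_class B e" using f_full by blast
    then have "\<beta> = ho_map B f (ho_class A a)" using e ho_map_class[OF A B f a(1)] by simp
    then show "\<beta> \<in> ho_map B f ` ho_hom A x y" using A.ho_homI[OF a(1)] by blast
  qed
qed

text \<open>The preimage is \<open>g 0 b\<close>, and the isomorphism is the component at
  \<open>b\<close> of the homotopy from \<open>f g\<close> to the identity.\<close>

lemma qcat_equivalence_essentially_surjective:
  assumes B: "quasi_category B" and eq: "qcat_equivalence A B f" and b: "b \<in> simplices B 0"
  shows "\<exists>a\<in>simplices A 0. \<exists>\<theta>\<in>ho_hom B (f 0 a) b. \<exists>\<theta>'\<in>ho_hom B b (f 0 a).
    ho_comp B \<theta>' \<theta> = ho_id B (f 0 a) \<and> ho_comp B \<theta> \<theta>' = ho_id B b"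
proof -
  obtain g k where f: "simplicial_map A B f" and g: "simplicial_map B A g"
    and k: "simplicial_map B (sexp B walking_iso) k"
      "\<And>n b. b\<in>simplices B n \<Longrightarrow> walking_iso_ev False n (k n b) = f n (g n b)"
      "\<And>n b. b\<in>simplices B n \<Longrightarrow> walking_iso_ev True n (k n b) = b"
    using eq unfolding qcat_equivalence_def by blast
  have "naturally_iso B B (\<lambda>n a. f n (g n a)) (\<lambda>n a. a)" by (rule naturally_iso_sexp[OF B B k])
  then show ?thesis
    unfolding naturally_iso_def using simplicial_mapD(1)[OF g b] b by blast
qed

section \<open>The homotopy 2-category\<close>

context simplicial_category
begin

lemma cmp_closed:
  "\<lbrakk>A \<in> ob K; B \<in> ob K; C \<in> ob K; f \<in> simplices (Fun K A B) n; g \<in> simplices (Fun K B C) n\<rbrakk>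
    \<Longrightarrow> cmp K A B C n g f \<in> simplices (Fun K A C) n"
  using simplicial_mapD(1)[OF cmp_simplicial[of A B C], of "(g, f)" n] by (simp add: simplices_sprod)

lemma cmp_act:
  "\<lbrakk>A \<in> ob K; B \<in> ob K; C \<in> ob K; f \<in> simplices (Fun K A B) n; g \<in> simplices (Fun K B C) n; \<alpha> \<in> Op m n\<rbrakk>
    \<Longrightarrow> act (Fun K A C) m n \<alpha> (cmp K A B C n g f) = cmp K A B C m (act (Fun K B C) m n \<alpha> g) (act (Fun K A B) m n \<alpha> f)"
  using simplicial_mapD(2)[OF cmp_simplicial[of A B C], of \<alpha> m n "(g, f)"] by (simp add: simplices_sprod act_sprod)

lemma cmp_degen:
  "\<lbrakk>A \<in> ob K; B \<in> ob K; C \<in> ob K; f \<in> functors K A B; g \<in> functors K B C\<rbrakk>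
    \<Longrightarrow> cmp K A B C n (degen (Fun K B C) n g) (degen (Fun K A B) n f) = degen (Fun K A C) n (cmp K A B C 0 g f)"
  by (simp add: degen_def cmp_act zero_Op)

lemma cmp_edges:
  "\<lbrakk>A \<in> ob K; B \<in> ob K; C \<in> ob K; \<alpha> \<in> edges (Fun K A B) f g; \<beta> \<in> edges (Fun K B C) h k\<rbrakk>
    \<Longrightarrow> cmp K A B C 1 \<beta> \<alpha> \<in> edges (Fun K A C) (cmp K A B C 0 h f) (cmp K A B C 0 k g)"
  using simplicial_map_edges[OF cmp_simplicial[of A B C], of "(\<beta>, \<alpha>)" "(h, f)" "(k, g)"]
  by (simp add: edges_sprod)

text \<open>Composition is a simplicial map on a product, so pairs of triangles compose.
  Functoriality of whiskering and interchange both rest on this.\<close>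

lemma cmp_tri:
  "\<lbrakk>A \<in> ob K; B \<in> ob K; C \<in> ob K; tri (Fun K A B) a b c; tri (Fun K B C) a' b' c'\<rbrakk>
    \<Longrightarrow> tri (Fun K A C) (cmp K A B C 1 a' a) (cmp K A B C 1 b' b) (cmp K A B C 1 c' c)"
  using simplicial_map_tri[OF cmp_simplicial[of A B C] tri_sprod, of a' b' c' a b c] by simp

end

lemma homotopy_2_category_simps:
  "ob2 (homotopy_2_category K) = ob K"
  "cells1 (homotopy_2_category K) A B = functors K A B"
  "cells2 (homotopy_2_category K) A B f g = ho_hom (Fun K A B) f g"
  "id1 (homotopy_2_category K) A = idn K A"
  "comp1 (homotopy_2_category K) A B C = cmp K A B C 0"
  "id2 (homotopy_2_category K) A B = ho_id (Fun K A B)"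
  "vcomp (homotopy_2_category K) A B = ho_comp (Fun K A B)"
  by (simp_all add: homotopy_2_category_def)

context infinity_cosmos
begin

text \<open>Composing the two homotopy triangles gives a triangle from the composite of
  \<open>a\<close> and \<open>b\<close> to that of \<open>a'\<close> and \<open>b'\<close>, with a
  degenerate side because composition respects degeneracies. Hence the union in \<open>hcomp\<close>
  collapses to one class.\<close>

lemma hcomp_class:
  assumes A: "A \<in> ob K" and B: "B \<in> ob K" and C: "C \<in> ob K"
    and a: "a \<in> edges (Fun K A B) f g" and b: "b \<in> edges (Fun K B C) h k"
  shows "hcomp (homotopy_2_category K) A B C (ho_class (Fun K B C) b) (ho_class (Fun K A B) a)
    = ho_class (Fun K A C) (cmp K A B C 1 b a)"
proof -
  interpret AB: quasi_category "Fun K A B" by (rule Fun_qcat[OF A B])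
  interpret BC: quasi_category "Fun K B C" by (rule Fun_qcat[OF B C])
  interpret AC: quasi_category "Fun K A C" by (rule Fun_qcat[OF A C])
  have v: "g \<in> functors K A B" "k \<in> functors K B C" using AB.edges_vertices[OF a] BC.edges_vertices[OF b] by auto
  have "ho_class (Fun K A C) (cmp K A B C 1 b' a') = ho_class (Fun K A C) (cmp K A B C 1 b a)"
    if "a' \<in> ho_class (Fun K A B) a" "b' \<in> ho_class (Fun K B C) b" for a' b'
  proof -
    have "tri (Fun K A B) a (degen (Fun K A B) 1 g) a'" "tri (Fun K B C) b (degen (Fun K B C) 1 k) b'"
      using that AB.mem_ho_class[OF a] BC.mem_ho_class[OF b] by auto
    from cmp_tri[OF A B C this] have "tri (Fun K A C) (cmp K A B C 1 b a) (degen (Fun K A C) 1 (cmp K A B C 0 k g)) (cmp K A B C 1 b' a')"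
      unfolding cmp_degen[OF A B C v] .
    then show ?thesis by (rule AC.ho_class_eqI[OF cmp_edges[OF A B C a b], symmetric])
  qed
  note eq = this
  show ?thesis
    unfolding homotopy_2_category_def two_cat.simps
    using eq AB.ho_class_self[OF a] BC.ho_class_self[OF b] by blast
qed

lemma lwhisker_class:
  assumes "A \<in> ob K" "B \<in> ob K" "C \<in> ob K" "a \<in> edges (Fun K A B) f g" "h \<in> functors K B C"
  shows "lwhisker (homotopy_2_category K) A B C h (ho_class (Fun K A B) a)
    = ho_class (Fun K A C) (cmp K A B C 1 (degen (Fun K B C) 1 h) a)"
  unfolding lwhisker_def homotopy_2_category_simps ho_id_def
  by (rule hcomp_class[OF assms(1-4) simplicial_set.degen_edge[OF Fun_sset[OF assms(2,3)] assms(5)]])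

lemma rwhisker_class:
  assumes "A \<in> ob K" "B \<in> ob K" "C \<in> ob K" "b \<in> edges (Fun K B C) f g" "h \<in> functors K A B"
  shows "rwhisker (homotopy_2_category K) A B C (ho_class (Fun K B C) b) h
    = ho_class (Fun K A C) (cmp K A B C 1 b (degen (Fun K A B) 1 h))"
  unfolding rwhisker_def homotopy_2_category_simps ho_id_def
  by (rule hcomp_class[OF assms(1-3) simplicial_set.degen_edge[OF Fun_sset[OF assms(1,2)] assms(5)] assms(4)])

lemma degen_edge_Fun:
  "\<lbrakk>A \<in> ob K; B \<in> ob K; f \<in> functors K A B\<rbrakk> \<Longrightarrow> degen (Fun K A B) 1 f \<in> edges (Fun K A B) f f"
  by (rule simplicial_set.degen_edge[OF Fun_sset])

lemma lwhisker_edge: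
  assumes "A \<in> ob K" "B \<in> ob K" "C \<in> ob K" "a \<in> edges (Fun K A B) f g" "h \<in> functors K B C"
  shows "cmp K A B C 1 (degen (Fun K B C) 1 h) a \<in> edges (Fun K A C) (cmp K A B C 0 h f) (cmp K A B C 0 h g)"
  using assms by (intro cmp_edges degen_edge_Fun)

lemma rwhisker_edge:
  assumes "A \<in> ob K" "B \<in> ob K" "C \<in> ob K" "b \<in> edges (Fun K B C) f g" "h \<in> functors K A B"
  shows "cmp K A B C 1 b (degen (Fun K A B) 1 h) \<in> edges (Fun K A C) (cmp K A B C 0 f h) (cmp K A B C 0 g h)"
  using assms by (intro cmp_edges degen_edge_Fun)

lemma tri_degen_Fun:
  assumes "A \<in> ob K" "B \<in> ob K" "e \<in> edges (Fun K A B) f g"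
  shows "tri (Fun K A B) (degen (Fun K A B) 1 f) e e" "tri (Fun K A B) e (degen (Fun K A B) 1 g) e"
  using assms simplicial_set.tri_degen[OF Fun_sset] by blast+

lemma tri_degen_Fun_0:
  "\<lbrakk>A \<in> ob K; B \<in> ob K; f \<in> functors K A B\<rbrakk>
    \<Longrightarrow> tri (Fun K A B) (degen (Fun K A B) 1 f) (degen (Fun K A B) 1 f) (degen (Fun K A B) 1 f)"
  by (rule tri_degen_Fun(1)[OF _ _ degen_edge_Fun])

lemma ho_homE_Fun:
  assumes "\<alpha> \<in> ho_hom (Fun K A B) f g"
  obtains a where "a \<in> edges (Fun K A B) f g" "\<alpha> = ho_class (Fun K A B) a"
  using assms by (auto simp: ho_hom_def)

lemma edge_1: "a \<in> edges X f g \<Longrightarrow> a \<in> simplices X 1"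
  by (simp add: edges_def)

lemma degen_closed_Fun: "\<lbrakk>A \<in> ob K; B \<in> ob K; f \<in> functors K A B\<rbrakk> \<Longrightarrow> degen (Fun K A B) n f \<in> simplices (Fun K A B) n"
  by (rule simplicial_set.degen_closed[OF Fun_sset])

lemma cmp_assoc_0: "\<lbrakk>A \<in> ob K; B \<in> ob K; C \<in> ob K; D \<in> ob K;
    f \<in> functors K A B; g \<in> functors K B C; h \<in> functors K C D\<rbrakk>
    \<Longrightarrow> cmp K A C D 0 h (cmp K A B C 0 g f) = cmp K A B D 0 (cmp K B C D 0 h g) f"
  by (rule cmp_assoc)

lemma cmp_id_0:
  assumes "A \<in> ob K" "B \<in> ob K" "f \<in> functors K A B"
  shows "cmp K A B B 0 (idn K B) f = f" "cmp K A A B 0 f (idn K A) = f"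
  using cmp_idn_left[OF assms] cmp_idn_right[OF assms] assms idn_closed
    simplicial_set.degen_0[OF Fun_sset] by simp_all

text \<open>1-cells enter whiskerings as degenerate edges, so the strict laws of \<open>cmp\<close>
  in dimension 1 give the laws of whiskering on representatives; laws involving vertical composition
  choose a triangle and apply \<open>cmp_tri\<close>.\<close>

lemma two_category_homotopy: "two_category (homotopy_2_category K)"
proof (unfold_locales, unfold homotopy_2_category_simps)
  fix A assume "A \<in> ob K" then show "idn K A \<in> functors K A A" by (rule idn_closed)
next
  fix A B C f g assume "A \<in> ob K" "B \<in> ob K" "C \<in> ob K" "f \<in> functors K A B" "g \<in> functors K B C"
  then show "cmp K A B C 0 g f \<in> functors K A C" by (rule cmp_closed)
next
  fix A B C D f g h assume "A \<in> ob K" "B \<in> ob K" "C \<in> ob K" "D \<in> ob K" 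
    "f \<in> functors K A B" "g \<in> functors K B C" "h \<in> functors K C D"
  then show "cmp K A C D 0 h (cmp K A B C 0 g f) = cmp K A B D 0 (cmp K B C D 0 h g) f" by (rule cmp_assoc_0)
next
  fix A B f assume "A \<in> ob K" "B \<in> ob K" "f \<in> functors K A B"
  then show "cmp K A B B 0 (idn K B) f = f" "cmp K A A B 0 f (idn K A) = f" by (rule cmp_id_0)+
next
  fix A B \<alpha> f g assume "A \<in> ob K" "B \<in> ob K" "\<alpha> \<in> ho_hom (Fun K A B) f g"
  then show "f \<in> functors K A B \<and> g \<in> functors K A B"
    using simplicial_set.edges_vertices[OF Fun_sset] by (auto simp: ho_hom_def)
next
  fix A B f assume A: "A \<in> ob K" and B: "B \<in> ob K" and f: "f \<in> functors K A B"
  interpret quasi_category "Fun K A B" by (rule Fun_qcat[OF A B])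
  show "ho_id (Fun K A B) f \<in> ho_hom (Fun K A B) f f" by (rule ho_id_closed[OF f])
next
  fix A B \<alpha> f g \<beta> h
  assume A: "A \<in> ob K" and B: "B \<in> ob K" and *: "\<alpha> \<in> ho_hom (Fun K A B) f g" "\<beta> \<in> ho_hom (Fun K A B) g h"
  interpret quasi_category "Fun K A B" by (rule Fun_qcat[OF A B])
  show "ho_comp (Fun K A B) \<beta> \<alpha> \<in> ho_hom (Fun K A B) f h" by (rule ho_comp_closed[OF *])
next
  fix A B \<alpha> f g \<beta> h \<gamma> k
  assume A: "A \<in> ob K" and B: "B \<in> ob K"
    and *: "\<alpha> \<in> ho_hom (Fun K A B) f g" "\<beta> \<in> ho_hom (Fun K A B) g h" "\<gamma> \<in> ho_hom (Fun K A B) h k"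
  interpret quasi_category "Fun K A B" by (rule Fun_qcat[OF A B])
  show "ho_comp (Fun K A B) \<gamma> (ho_comp (Fun K A B) \<beta> \<alpha>) = ho_comp (Fun K A B) (ho_comp (Fun K A B) \<gamma> \<beta>) \<alpha>"
    by (rule ho_comp_assoc[OF *])
next
  fix A B \<alpha> f g
  assume A: "A \<in> ob K" and B: "B \<in> ob K" and *: "\<alpha> \<in> ho_hom (Fun K A B) f g"
  interpret quasi_category "Fun K A B" by (rule Fun_qcat[OF A B])
  show "ho_comp (Fun K A B) (ho_id (Fun K A B) g) \<alpha> = \<alpha>" by (rule ho_comp_id_left[OF *])
  show "ho_comp (Fun K A B) \<alpha> (ho_id (Fun K A B) f) = \<alpha>" by (rule ho_comp_id_right[OF *])
next
  fix A B C \<alpha> f g h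
  assume o: "A \<in> ob K" "B \<in> ob K" "C \<in> ob K" and \<alpha>: "\<alpha> \<in> ho_hom (Fun K A B) f g" and h: "h \<in> functors K B C"
  obtain a where a: "a \<in> edges (Fun K A B) f g" "\<alpha> = ho_class (Fun K A B) a" using \<alpha> by (rule ho_homE_Fun)
  show "lwhisker (homotopy_2_category K) A B C h \<alpha> \<in> ho_hom (Fun K A C) (cmp K A B C 0 h f) (cmp K A B C 0 h g)"
    unfolding a lwhisker_class[OF o a(1) h] ho_hom_def using lwhisker_edge[OF o a(1) h] by blast
next
  fix A B C f h
  assume o: "A \<in> ob K" "B \<in> ob K" "C \<in> ob K" and f: "f \<in> functors K A B" and h: "h \<in> functors K B C"
  show "lwhisker (homotopy_2_category K) A B C h (ho_id (Fun K A B) f) = ho_id (Fun K A C) (cmp K A B C 0 h f)"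
    unfolding ho_id_def lwhisker_class[OF o degen_edge_Fun[OF o(1,2) f] h] cmp_degen[OF o f h] ..
next
  fix A B C h \<alpha> f g \<beta> k
  assume o: "A \<in> ob K" "B \<in> ob K" "C \<in> ob K" and h: "h \<in> functors K B C"
    and \<alpha>: "\<alpha> \<in> ho_hom (Fun K A B) f g" and \<beta>: "\<beta> \<in> ho_hom (Fun K A B) g k"
  interpret AB: quasi_category "Fun K A B" by (rule Fun_qcat[OF o(1,2)])
  interpret AC: quasi_category "Fun K A C" by (rule Fun_qcat[OF o(1,3)])
  obtain a where a: "a \<in> edges (Fun K A B) f g" "\<alpha> = ho_class (Fun K A B) a" using \<alpha> by (rule ho_homE_Fun)
  obtain b where b: "b \<in> edges (Fun K A B) g k" "\<beta> = ho_class (Fun K A B) b" using \<beta> by (rule ho_homE_Fun)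
  obtain c where c: "tri (Fun K A B) a b c" "c \<in> edges (Fun K A B) f k" by (rule AB.tri_fill[OF a(1) b(1)])
  show "lwhisker (homotopy_2_category K) A B C h (ho_comp (Fun K A B) \<beta> \<alpha>)
     = ho_comp (Fun K A C) (lwhisker (homotopy_2_category K) A B C h \<beta>) (lwhisker (homotopy_2_category K) A B C h \<alpha>)"
    unfolding a b AB.ho_comp_class[OF a(1) b(1) c(1)] lwhisker_class[OF o a(1) h] lwhisker_class[OF o b(1) h] lwhisker_class[OF o c(2) h]
    by (rule AC.ho_comp_class[OF lwhisker_edge[OF o a(1) h] lwhisker_edge[OF o b(1) h] cmp_tri[OF o c(1) tri_degen_Fun_0[OF o(2,3) h]], symmetric])
next
  fix A B C D \<alpha> f g h k
  assume o: "A \<in> ob K" "B \<in> ob K" "C \<in> ob K" and D: "D \<in> ob K"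
    and \<alpha>: "\<alpha> \<in> ho_hom (Fun K A B) f g" and h: "h \<in> functors K B C" and k: "k \<in> functors K C D"
  obtain a where a: "a \<in> edges (Fun K A B) f g" "\<alpha> = ho_class (Fun K A B) a" using \<alpha> by (rule ho_homE_Fun)
  have kh: "cmp K B C D 0 k h \<in> functors K B D" by (rule cmp_closed[OF o(2,3) D h k])
  show "lwhisker (homotopy_2_category K) A B D (cmp K B C D 0 k h) \<alpha> =
        lwhisker (homotopy_2_category K) A C D k (lwhisker (homotopy_2_category K) A B C h \<alpha>)"
    unfolding a lwhisker_class[OF o a(1) h] lwhisker_class[OF o(1,2) D a(1) kh] lwhisker_class[OF o(1,3) D lwhisker_edge[OF o a(1) h] k]
      cmp_degen[OF o(2,3) D h k, symmetric] cmp_assoc[OF o D edge_1[OF a(1)] degen_closed_Fun[OF o(2,3) h] degen_closed_Fun[OF o(3) D k]] ..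
next
  fix A B \<alpha> f g
  assume A: "A \<in> ob K" and B: "B \<in> ob K" and \<alpha>: "\<alpha> \<in> ho_hom (Fun K A B) f g"
  obtain a where a: "a \<in> edges (Fun K A B) f g" "\<alpha> = ho_class (Fun K A B) a" using \<alpha> by (rule ho_homE_Fun)
  show "lwhisker (homotopy_2_category K) A B B (idn K B) \<alpha> = \<alpha>"
    unfolding a lwhisker_class[OF A B B a(1) idn_closed[OF B]] cmp_idn_left[OF A B edge_1[OF a(1)]] ..
  show "rwhisker (homotopy_2_category K) A A B \<alpha> (idn K A) = \<alpha>"
    unfolding a rwhisker_class[OF A A B a(1) idn_closed[OF A]] cmp_idn_right[OF A B edge_1[OF a(1)]] ..
next
  fix A B C \<alpha> f g h
  assume o: "A \<in> ob K" "B \<in> ob K" "C \<in> ob K" and \<alpha>: "\<alpha> \<in> ho_hom (Fun K B C) f g" and h: "h \<in> functors K A B"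
  obtain a where a: "a \<in> edges (Fun K B C) f g" "\<alpha> = ho_class (Fun K B C) a" using \<alpha> by (rule ho_homE_Fun)
  show "rwhisker (homotopy_2_category K) A B C \<alpha> h \<in> ho_hom (Fun K A C) (cmp K A B C 0 f h) (cmp K A B C 0 g h)"
    unfolding a rwhisker_class[OF o a(1) h] ho_hom_def using rwhisker_edge[OF o a(1) h] by blast
next
  fix A B C f h
  assume o: "A \<in> ob K" "B \<in> ob K" "C \<in> ob K" and f: "f \<in> functors K B C" and h: "h \<in> functors K A B"
  show "rwhisker (homotopy_2_category K) A B C (ho_id (Fun K B C) f) h = ho_id (Fun K A C) (cmp K A B C 0 f h)"
    unfolding ho_id_def rwhisker_class[OF o degen_edge_Fun[OF o(2,3) f] h] cmp_degen[OF o h f] ..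
next
  fix A B C h \<alpha> f g \<beta> k
  assume o: "A \<in> ob K" "B \<in> ob K" "C \<in> ob K" and h: "h \<in> functors K A B"
    and \<alpha>: "\<alpha> \<in> ho_hom (Fun K B C) f g" and \<beta>: "\<beta> \<in> ho_hom (Fun K B C) g k"
  interpret BC: quasi_category "Fun K B C" by (rule Fun_qcat[OF o(2,3)])
  interpret AC: quasi_category "Fun K A C" by (rule Fun_qcat[OF o(1,3)])
  obtain a where a: "a \<in> edges (Fun K B C) f g" "\<alpha> = ho_class (Fun K B C) a" using \<alpha> by (rule ho_homE_Fun)
  obtain b where b: "b \<in> edges (Fun K B C) g k" "\<beta> = ho_class (Fun K B C) b" using \<beta> by (rule ho_homE_Fun)
  obtain c where c: "tri (Fun K B C) a b c" "c \<in> edges (Fun K B C) f k" by (rule BC.tri_fill[OF a(1) b(1)])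
  show "rwhisker (homotopy_2_category K) A B C (ho_comp (Fun K B C) \<beta> \<alpha>) h
     = ho_comp (Fun K A C) (rwhisker (homotopy_2_category K) A B C \<beta> h) (rwhisker (homotopy_2_category K) A B C \<alpha> h)"
    unfolding a b BC.ho_comp_class[OF a(1) b(1) c(1)] rwhisker_class[OF o a(1) h] rwhisker_class[OF o b(1) h] rwhisker_class[OF o c(2) h]
    by (rule AC.ho_comp_class[OF rwhisker_edge[OF o a(1) h] rwhisker_edge[OF o b(1) h] cmp_tri[OF o tri_degen_Fun_0[OF o(1,2) h] c(1)], symmetric])
next
  fix A B C D \<alpha> f g k h
  assume o: "A \<in> ob K" "B \<in> ob K" "C \<in> ob K" and D: "D \<in> ob K"
    and \<alpha>: "\<alpha> \<in> ho_hom (Fun K C D) f g" and k: "k \<in> functors K A B" and h: "h \<in> functors K B C"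
  obtain a where a: "a \<in> edges (Fun K C D) f g" "\<alpha> = ho_class (Fun K C D) a" using \<alpha> by (rule ho_homE_Fun)
  have hk: "cmp K A B C 0 h k \<in> functors K A C" by (rule cmp_closed[OF o k h])
  show "rwhisker (homotopy_2_category K) A C D \<alpha> (cmp K A B C 0 h k) =
        rwhisker (homotopy_2_category K) A B D (rwhisker (homotopy_2_category K) B C D \<alpha> h) k"
    unfolding a rwhisker_class[OF o(2,3) D a(1) h] rwhisker_class[OF o(1,3) D a(1) hk] rwhisker_class[OF o(1,2) D rwhisker_edge[OF o(2,3) D a(1) h] k]
      cmp_degen[OF o k h, symmetric] cmp_assoc[OF o D degen_closed_Fun[OF o(1,2) k] degen_closed_Fun[OF o(2,3) h] edge_1[OF a(1)]] ..
next
  fix A B C D \<alpha> f g k h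
  assume o: "A \<in> ob K" "B \<in> ob K" "C \<in> ob K" and D: "D \<in> ob K"
    and \<alpha>: "\<alpha> \<in> ho_hom (Fun K B C) f g" and k: "k \<in> functors K A B" and h: "h \<in> functors K C D"
  obtain a where a: "a \<in> edges (Fun K B C) f g" "\<alpha> = ho_class (Fun K B C) a" using \<alpha> by (rule ho_homE_Fun)
  show "lwhisker (homotopy_2_category K) A C D h (rwhisker (homotopy_2_category K) A B C \<alpha> k) =
        rwhisker (homotopy_2_category K) A B D (lwhisker (homotopy_2_category K) B C D h \<alpha>) k"
    unfolding a rwhisker_class[OF o a(1) k] lwhisker_class[OF o(2,3) D a(1) h]
      rwhisker_class[OF o(1,2) D lwhisker_edge[OF o(2,3) D a(1) h] k] lwhisker_class[OF o(1,3) D rwhisker_edge[OF o a(1) k] h]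
      cmp_assoc[OF o D degen_closed_Fun[OF o(1,2) k] edge_1[OF a(1)] degen_closed_Fun[OF o(3) D h]] ..
next
  fix A B C \<alpha> h k \<beta> f g
  assume o: "A \<in> ob K" "B \<in> ob K" "C \<in> ob K"
    and \<alpha>: "\<alpha> \<in> ho_hom (Fun K A B) h k" and \<beta>: "\<beta> \<in> ho_hom (Fun K B C) f g"
  interpret AC: quasi_category "Fun K A C" by (rule Fun_qcat[OF o(1,3)])
  obtain a where a: "a \<in> edges (Fun K A B) h k" "\<alpha> = ho_class (Fun K A B) a" using \<alpha> by (rule ho_homE_Fun)
  obtain b where b: "b \<in> edges (Fun K B C) f g" "\<beta> = ho_class (Fun K B C) b" using \<beta> by (rule ho_homE_Fun)
  have v: "h \<in> functors K A B" "k \<in> functors K A B" "f \<in> functors K B C" "g \<in> functors K B C"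
    using simplicial_set.edges_vertices[OF Fun_sset] o a(1) b(1) by blast+
  \<comment> \<open>Both composites in \<open>interchange\<close> are represented by
    \<open>cmp K A B C 1 b a\<close>, the diagonal of the square; each half of the square is a
    composite of two degenerate triangles.\<close>
  have "ho_comp (Fun K A C) (rwhisker (homotopy_2_category K) A B C \<beta> k) (lwhisker (homotopy_2_category K) A B C f \<alpha>)
    = ho_class (Fun K A C) (cmp K A B C 1 b a)"
    unfolding a b rwhisker_class[OF o b(1) v(2)] lwhisker_class[OF o a(1) v(3)]
    by (rule AC.ho_comp_class[OF lwhisker_edge[OF o a(1) v(3)] rwhisker_edge[OF o b(1) v(2)]
        cmp_tri[OF o tri_degen_Fun(2)[OF o(1,2) a(1)] tri_degen_Fun(1)[OF o(2,3) b(1)]]])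
  moreover have "ho_comp (Fun K A C) (lwhisker (homotopy_2_category K) A B C g \<alpha>) (rwhisker (homotopy_2_category K) A B C \<beta> h)
    = ho_class (Fun K A C) (cmp K A B C 1 b a)"
    unfolding a b rwhisker_class[OF o b(1) v(1)] lwhisker_class[OF o a(1) v(4)]
    by (rule AC.ho_comp_class[OF rwhisker_edge[OF o b(1) v(1)] lwhisker_edge[OF o a(1) v(4)]
        cmp_tri[OF o tri_degen_Fun(1)[OF o(1,2) a(1)] tri_degen_Fun(2)[OF o(2,3) b(1)]]])
  ultimately show "ho_comp (Fun K A C) (rwhisker (homotopy_2_category K) A B C \<beta> k) (lwhisker (homotopy_2_category K) A B C f \<alpha>)
    = ho_comp (Fun K A C) (lwhisker (homotopy_2_category K) A B C g \<alpha>) (rwhisker (homotopy_2_category K) A B C \<beta> h)" by simp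
qed

end

section \<open>The biequivalence induced by a weak equivalence of cosmoi\<close>

context cosmos_weak_equivalence
begin

lemma hmap_closed: "\<lbrakk>A \<in> ob K; B \<in> ob K; f \<in> simplices (Fun K A B) n\<rbrakk>
    \<Longrightarrow> hmap F A B n f \<in> simplices (Fun L (omap F A) (omap F B)) n"
  using simplicial_mapD(1)[OF hmap_simplicial] .

lemma hmap_degen: "\<lbrakk>A \<in> ob K; B \<in> ob K; f \<in> functors K A B\<rbrakk>
    \<Longrightarrow> hmap F A B n (degen (Fun K A B) n f) = degen (Fun L (omap F A) (omap F B)) n (hmap F A B 0 f)"
  using simplicial_map_degen[OF hmap_simplicial] .

lemma hmap_edges: "\<lbrakk>A \<in> ob K; B \<in> ob K; a \<in> edges (Fun K A B) f g\<rbrakk>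
    \<Longrightarrow> hmap F A B 1 a \<in> edges (Fun L (omap F A) (omap F B)) (hmap F A B 0 f) (hmap F A B 0 g)"
  using simplicial_map_edges[OF hmap_simplicial] .

definition ho_hmap :: "'k \<Rightarrow> 'k \<Rightarrow> 's set \<Rightarrow> 't set" where
  "ho_hmap A B = ho_map (Fun L (omap F A) (omap F B)) (hmap F A B)"

lemma ho_hmap_class:
  assumes "A \<in> ob K" "B \<in> ob K" "a \<in> edges (Fun K A B) f g"
  shows "ho_hmap A B (ho_class (Fun K A B) a) = ho_class (Fun L (omap F A) (omap F B)) (hmap F A B 1 a)"
  unfolding ho_hmap_def using assms
  by (intro ho_map_class K.Fun_qcat L.Fun_qcat hmap_simplicial omap_closed)

lemma biequivalence_homotopy:
  "biequivalence (homotopy_2_category K) (homotopy_2_category L) (omap F) (\<lambda>A B. hmap F A B 0) ho_hmap"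
proof -
  interpret S: two_category "homotopy_2_category K" by (rule K.two_category_homotopy)
  interpret T: two_category "homotopy_2_category L" by (rule L.two_category_homotopy)
  show ?thesis
  proof (unfold_locales, unfold homotopy_2_category_simps)
    fix A assume "A \<in> ob K" then show "omap F A \<in> ob L" by (rule omap_closed)
  next
    fix A B f assume "A \<in> ob K" "B \<in> ob K" "f \<in> functors K A B"
    then show "hmap F A B 0 f \<in> functors L (omap F A) (omap F B)" by (rule hmap_closed)
  next
    fix A assume "A \<in> ob K" then show "hmap F A A 0 (idn K A) = idn L (omap F A)" by (rule hmap_idn)
  next
    fix A B C f g assume "A \<in> ob K" "B \<in> ob K" "C \<in> ob K" "f \<in> functors K A B" "g \<in> functors K B C"
    then show "hmap F A C 0 (cmp K A B C 0 g f) = cmp L (omap F A) (omap F B) (omap F C) 0 (hmap F B C 0 g) (hmap F A B 0 f)"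
      by (rule hmap_cmp)
  next
    fix A B f assume *: "A \<in> ob K" "B \<in> ob K" "f \<in> functors K A B"
    show "ho_hmap A B (ho_id (Fun K A B) f) = ho_id (Fun L (omap F A) (omap F B)) (hmap F A B 0 f)"
      unfolding ho_id_def ho_hmap_class[OF *(1,2) K.degen_edge_Fun[OF *]] hmap_degen[OF *] ..
  next
    fix A B \<alpha> f g \<beta> h
    assume o: "A \<in> ob K" "B \<in> ob K" and \<alpha>: "\<alpha> \<in> ho_hom (Fun K A B) f g" and \<beta>: "\<beta> \<in> ho_hom (Fun K A B) g h"
    interpret AB: quasi_category "Fun K A B" by (rule K.Fun_qcat[OF o])
    interpret FAB: quasi_category "Fun L (omap F A) (omap F B)" by (rule L.Fun_qcat[OF o[THEN omap_closed]])
    obtain a where a: "a \<in> edges (Fun K A B) f g" "\<alpha> = ho_class (Fun K A B) a" using \<alpha> by (rule K.ho_homE_Fun)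
    obtain b where b: "b \<in> edges (Fun K A B) g h" "\<beta> = ho_class (Fun K A B) b" using \<beta> by (rule K.ho_homE_Fun)
    obtain c where c: "tri (Fun K A B) a b c" "c \<in> edges (Fun K A B) f h" by (rule AB.tri_fill[OF a(1) b(1)])
    show "ho_hmap A B (ho_comp (Fun K A B) \<beta> \<alpha>) = ho_comp (Fun L (omap F A) (omap F B)) (ho_hmap A B \<beta>) (ho_hmap A B \<alpha>)"
      unfolding a b AB.ho_comp_class[OF a(1) b(1) c(1)] ho_hmap_class[OF o a(1)] ho_hmap_class[OF o b(1)] ho_hmap_class[OF o c(2)]
      by (rule FAB.ho_comp_class[OF hmap_edges[OF o a(1)] hmap_edges[OF o b(1)] simplicial_map_tri[OF hmap_simplicial[OF o] c(1)], symmetric])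
  next
    fix A B C \<alpha> f g h
    assume o: "A \<in> ob K" "B \<in> ob K" "C \<in> ob K" and \<alpha>: "\<alpha> \<in> ho_hom (Fun K A B) f g" and h: "h \<in> functors K B C"
    obtain a where a: "a \<in> edges (Fun K A B) f g" "\<alpha> = ho_class (Fun K A B) a" using \<alpha> by (rule K.ho_homE_Fun)
    show "ho_hmap A C (lwhisker (homotopy_2_category K) A B C h \<alpha>) =
        lwhisker (homotopy_2_category L) (omap F A) (omap F B) (omap F C) (hmap F B C 0 h) (ho_hmap A B \<alpha>)"
      unfolding a K.lwhisker_class[OF o a(1) h] ho_hmap_class[OF o(1,3) K.lwhisker_edge[OF o a(1) h]] ho_hmap_class[OF o(1,2) a(1)]
        L.lwhisker_class[OF o[THEN omap_closed] hmap_edges[OF o(1,2) a(1)] hmap_closed[OF o(2,3) h]]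
        hmap_cmp[OF o K.edge_1[OF a(1)] K.degen_closed_Fun[OF o(2,3) h]] hmap_degen[OF o(2,3) h] ..
  next
    fix A B C \<alpha> f g h
    assume o: "A \<in> ob K" "B \<in> ob K" "C \<in> ob K" and \<alpha>: "\<alpha> \<in> ho_hom (Fun K B C) f g" and h: "h \<in> functors K A B"
    obtain a where a: "a \<in> edges (Fun K B C) f g" "\<alpha> = ho_class (Fun K B C) a" using \<alpha> by (rule K.ho_homE_Fun)
    show "ho_hmap A C (rwhisker (homotopy_2_category K) A B C \<alpha> h) =
        rwhisker (homotopy_2_category L) (omap F A) (omap F B) (omap F C) (ho_hmap B C \<alpha>) (hmap F A B 0 h)"
      unfolding a K.rwhisker_class[OF o a(1) h] ho_hmap_class[OF o(1,3) K.rwhisker_edge[OF o a(1) h]] ho_hmap_class[OF o(2,3) a(1)]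
        L.rwhisker_class[OF o[THEN omap_closed] hmap_edges[OF o(2,3) a(1)] hmap_closed[OF o(1,2) h]]
        hmap_cmp[OF o K.degen_closed_Fun[OF o(1,2) h] K.edge_1[OF a(1)]] hmap_degen[OF o(1,2) h] ..
  next
    fix A B f g assume o: "A \<in> ob K" "B \<in> ob K" "f \<in> functors K A B" "g \<in> functors K A B"
    then show "bij_betw (ho_hmap A B) (ho_hom (Fun K A B) f g)
          (ho_hom (Fun L (omap F A) (omap F B)) (hmap F A B 0 f) (hmap F A B 0 g))"
      unfolding ho_hmap_def
      by (intro qcat_equivalence_ho_map_bij K.Fun_qcat L.Fun_qcat local_equivalence omap_closed)
  next
    fix A B k assume o: "A \<in> ob K" "B \<in> ob K" "k \<in> functors L (omap F A) (omap F B)"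
    show "\<exists>f\<in>functors K A B. \<exists>\<kappa> \<kappa>'. inverse2 (homotopy_2_category L) (omap F A) (omap F B) (hmap F A B 0 f) k \<kappa> \<kappa>'"
      using qcat_equivalence_essentially_surjective[OF L.Fun_qcat[OF o(1,2)[THEN omap_closed]] local_equivalence[OF o(1,2)] o(3)]
      unfolding inverse2_def homotopy_2_category_simps by blast
  next
    fix X assume X: "X \<in> ob L"
    then obtain A e where A: "A \<in> ob K" and e: "is_equivalence L (omap F A) X e"
      using essentially_surjective by blast
    \<comment> \<open>The equivalence is evaluated at the test object \<open>X\<close> itself,
      because there \<open>idn L X\<close> is a vertex of the target; a preimage of it up to
      isomorphism is the section \<open>e'\<close>.\<close>
    have e': "e \<in> functors L (omap F A) X" "qcat_equivalence (Fun L X (omap F A)) (Fun L X X) (postcomp L X (omap F A) X e)"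
      using e X by (auto simp: is_equivalence_def)
    have "postcomp L X (omap F A) X e 0 g = cmp L X (omap F A) X 0 e g" for g
      using simplicial_set.degen_0[OF L.Fun_sset[OF omap_closed[OF A] X] e'(1)] by (simp add: postcomp_def)
    then show "\<exists>A\<in>ob K. \<exists>e\<in>functors L (omap F A) X. \<exists>e'\<in>functors L X (omap F A). 
       \<exists>\<theta> \<theta>'. inverse2 (homotopy_2_category L) X X (cmp L X (omap F A) X 0 e e') (idn L X) \<theta> \<theta>'"
      using qcat_equivalence_essentially_surjective[OF L.Fun_qcat[OF X X] e'(2) L.idn_closed[OF X]] A e'(1)
      unfolding inverse2_def homotopy_2_category_simps by (simp only:) blast
  qed
qed

end

section \<open>Limits and colimits\<close>

lemma restrict_eq_iff:
  "(\<lambda>m. restrict (f m) (S m)) = (\<lambda>m. restrict (g m) (S m)) \<longleftrightarrow> (\<forall>m. \<forall>x\<in>S m. f m x = g m x)"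
  unfolding fun_eq_iff restrict_def by auto

section \<open>Transport of liftings along strict isomorphisms\<close>

context two_category
begin

text \<open>Transport along \<open>t\<close> and \<open>s\<close> is undone by transport along
  \<open>t'\<close> and \<open>s'\<close>: the strict identities bring all 1-cells back, and the
  lifting 2-cell may change since it is quantified.\<close>

lemma absolute_right_lifting_transport:
  assumes o: "C \<in> ob2 T" "C' \<in> ob2 T" "A \<in> ob2 T" "A' \<in> ob2 T" "B \<in> ob2 T"
    and t: "t \<in> cells1 T C' C" "t' \<in> cells1 T C C'" "comp1 T C C' C t t' = id1 T C"
    and s: "s \<in> cells1 T A A'" "s' \<in> cells1 T A' A"
      "comp1 T A A' A s' s = id1 T A" "comp1 T A' A A' s s' = id1 T A'"
    and g: "g \<in> cells1 T C A" and f: "f \<in> cells1 T B A" and l: "l \<in> cells1 T C B"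
  shows "(\<exists>lam. absolute_right_lifting T C B A g f l lam) \<longleftrightarrow>
    (\<exists>lam. absolute_right_lifting T C' B A' (comp1 T C' A A' s (comp1 T C' C A g t))
       (comp1 T B A A' s f) (comp1 T C' C B l t) lam)"
proof
  assume "\<exists>lam. absolute_right_lifting T C B A g f l lam"
  then show "\<exists>lam. absolute_right_lifting T C' B A' (comp1 T C' A A' s (comp1 T C' C A g t))
       (comp1 T B A A' s f) (comp1 T C' C B l t) lam"
    using absolute_right_lifting_postcomp_iso[OF absolute_right_lifting_precomp[OF _ o(2) t(1)] o(4) s] by blast
next
  assume "\<exists>lam. absolute_right_lifting T C' B A' (comp1 T C' A A' s (comp1 T C' C A g t))
       (comp1 T B A A' s f) (comp1 T C' C B l t) lam"
  then obtain lam where "absolute_right_lifting T C B A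
     (comp1 T C C' A (comp1 T C' A' A s' (comp1 T C' A A' s (comp1 T C' C A g t))) t')
     (comp1 T B A' A s' (comp1 T B A A' s f)) (comp1 T C C' B (comp1 T C' C B l t) t') lam"
    using absolute_right_lifting_precomp[OF absolute_right_lifting_postcomp_iso[OF _ o(3) s(2,1,4,3)] o(1) t(2)] by blast
  moreover have gt: "comp1 T C' C A g t \<in> cells1 T C' A" by (rule comp1_closed[OF o(2,1,3) t(1) g])
  have "comp1 T C' A' A s' (comp1 T C' A A' s (comp1 T C' C A g t)) = comp1 T C' C A g t"
    by (simp add: comp1_assoc[OF o(2,3,4,3) gt s(1,2)] s(3) comp1_id_left[OF o(2,3) gt])
  moreover have "comp1 T C C' A (comp1 T C' C A g t) t' = g"
    by (simp add: comp1_assoc[OF o(1,2,1,3) t(2,1) g, symmetric] t(3) comp1_id_right[OF o(1,3) g])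
  moreover have "comp1 T B A' A s' (comp1 T B A A' s f) = f"
    by (simp add: comp1_assoc[OF o(5,3,4,3) f s(1,2)] s(3) comp1_id_left[OF o(5,3) f])
  moreover have "comp1 T C C' B (comp1 T C' C B l t) t' = l"
    by (simp add: comp1_assoc[OF o(1,2,1,5) t(2,1) l, symmetric] t(3) comp1_id_right[OF o(1,5) l])
  ultimately show "\<exists>lam. absolute_right_lifting T C B A g f l lam" by auto
qed

lemma ex_absolute_right_lifting_transport:
  assumes o: "C \<in> ob2 T" "C' \<in> ob2 T" "A \<in> ob2 T" "A' \<in> ob2 T" "B \<in> ob2 T"
    and t: "t \<in> cells1 T C' C" "t' \<in> cells1 T C C'" "comp1 T C C' C t t' = id1 T C" "comp1 T C' C C' t' t = id1 T C'"
    and s: "s \<in> cells1 T A A'" "s' \<in> cells1 T A' A"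
      "comp1 T A A' A s' s = id1 T A" "comp1 T A' A A' s s' = id1 T A'"
    and g: "g \<in> cells1 T C A" and f: "f \<in> cells1 T B A"
  shows "(\<exists>l\<in>cells1 T C B. \<exists>lam. absolute_right_lifting T C B A g f l lam) \<longleftrightarrow>
    (\<exists>l\<in>cells1 T C' B. \<exists>lam. absolute_right_lifting T C' B A' (comp1 T C' A A' s (comp1 T C' C A g t))
       (comp1 T B A A' s f) l lam)"
proof
  note iff = absolute_right_lifting_transport[OF o t(1-3) s g f]
  assume "\<exists>l\<in>cells1 T C' B. \<exists>lam. absolute_right_lifting T C' B A' (comp1 T C' A A' s (comp1 T C' C A g t))
       (comp1 T B A A' s f) l lam"
  then obtain l' where l': "l' \<in> cells1 T C' B" "\<exists>lam. absolute_right_lifting T C' B A' (comp1 T C' A A' s (comp1 T C' C A g t))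
       (comp1 T B A A' s f) l' lam" by blast
  \<comment> \<open>The candidate is \<open>l'\<close> restricted along \<open>t'\<close>;
    restricting it further along \<open>t\<close> returns \<open>l'\<close>, so the version with
    fixed \<open>l\<close> applies.\<close>
  have lt: "comp1 T C C' B l' t' \<in> cells1 T C B" by (rule comp1_closed[OF o(1,2,5) t(2) l'(1)])
  have "comp1 T C' C B (comp1 T C C' B l' t') t = l'"
    by (simp add: comp1_assoc[OF o(2,1,2,5) t(1,2) l'(1), symmetric] t(4) comp1_id_right[OF o(2,5) l'(1)])
  then show "\<exists>l\<in>cells1 T C B. \<exists>lam. absolute_right_lifting T C B A g f l lam"
    using iff[OF lt] l'(2) lt by auto
qed (use absolute_right_lifting_transport[OF o t(1-3) s g f] comp1_closed[OF o(2,1,5) t(1)] in blast)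

end

section \<open>Universal properties of cotensors and terminal objects\<close>

context simplicial_category
begin

text \<open>Dimension 0 of the isomorphism \<open>cotensor_transpose\<close>: as
  \<open>Delta 0\<close> is a point, vertices of the exponential amount to simplicial maps out of
  \<open>U\<close>.\<close>

lemma cotensor_universal:
  assumes P: "is_cotensor K U A P \<kappa>" and U: "simplicial_set U" and X: "X \<in> ob K"
    and \<phi>: "simplicial_map U (Fun K X A) \<phi>"
  shows "\<exists>!h. h \<in> functors K X P \<and>
    (\<forall>n. \<forall>u\<in>simplices U n. cmp K X P A n (\<kappa> n u) (degen (Fun K X P) n h) = \<phi> n u)"
proof -
  interpret U: simplicial_set U by fact
  let ?D = "sprod U (Delta 0)"
  \<comment> \<open>\<open>\<phi>\<close> as a vertex of \<open>sexp\<close>: the unique coordinate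
    in \<open>Delta 0\<close> is ignored, and the restricted lambda makes it extensional as
    \<open>sexp\<close> demands.\<close>
  define \<Phi> where "\<Phi> = (\<lambda>m. \<lambda>(u, \<alpha>)\<in>simplices ?D m. \<phi> m u)"
  have D: "(u, \<alpha>) \<in> simplices ?D m \<longleftrightarrow> u \<in> simplices U m \<and> \<alpha> = (\<lambda>i\<in>{..m}. 0)" for u \<alpha> m
    using Op_0 zero_Op by (auto simp: simplices_sprod Delta_def)
  have "simplicial_map ?D (Fun K X A) \<Phi>"
    unfolding simplicial_map_def
  proof (intro conjI allI ballI)
    fix n show "\<Phi> n \<in> simplices ?D n \<rightarrow> simplices (Fun K X A) n"
      using simplicial_mapD(1)[OF \<phi>] by (auto simp: \<Phi>_def D)
  next
    fix m n \<alpha> x assume \<alpha>: "\<alpha> \<in> Op m n" and x: "x \<in> simplices ?D n"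
    then obtain u where u: "u \<in> simplices U n" "x = (u, \<lambda>i\<in>{..n}. 0)" by (cases x) (auto simp: D)
    have "act ?D m n \<alpha> x = (act U m n \<alpha> u, compose {..m} (\<lambda>i\<in>{..n}. 0) \<alpha>)"
      unfolding u act_sprod by (simp add: Delta_def)
    also have "compose {..m} (\<lambda>i\<in>{..n}. 0 :: nat) \<alpha> = (\<lambda>i\<in>{..m}. 0)"
      by (rule Op_0[OF compose_Op[OF zero_Op \<alpha>]])
    finally have act: "act ?D m n \<alpha> x = (act U m n \<alpha> u, \<lambda>i\<in>{..m}. 0)" .
    have "\<Phi> m (act ?D m n \<alpha> x) = \<phi> m (act U m n \<alpha> u)"
      unfolding act using U.act_closed[OF \<alpha> u(1)] by (simp add: \<Phi>_def D)
    then show "\<Phi> m (act ?D m n \<alpha> x) = act (Fun K X A) m n \<alpha> (\<Phi> n x)"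
      using simplicial_mapD(2)[OF \<phi> \<alpha> u(1)] u x by (simp add: \<Phi>_def)
  qed
  then have \<Phi>: "\<Phi> \<in> simplices (sexp (Fun K X A) U) 0"
    by (auto simp: sexp_def \<Phi>_def)
  have iff: "cotensor_transpose K U A P \<kappa> X 0 h = \<Phi> \<longleftrightarrow>
    (\<forall>n. \<forall>u\<in>simplices U n. cmp K X P A n (\<kappa> n u) (degen (Fun K X P) n h) = \<phi> n u)" for h
  proof -
    have "cotensor_transpose K U A P \<kappa> X 0 h = \<Phi> \<longleftrightarrow>
      (\<forall>m. \<forall>x\<in>simplices ?D m. (case x of (u, \<alpha>) \<Rightarrow> cmp K X P A m (\<kappa> m u) (act (Fun K X P) m 0 \<alpha> h)) = (case x of (u, \<alpha>) \<Rightarrow> \<phi> m u))"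
      unfolding cotensor_transpose_def \<Phi>_def by (rule restrict_eq_iff)
    also have "\<dots> \<longleftrightarrow> (\<forall>n. \<forall>u\<in>simplices U n. cmp K X P A n (\<kappa> n u) (degen (Fun K X P) n h) = \<phi> n u)"
    proof -
      have "simplices ?D m = simplices U m \<times> {\<lambda>i\<in>{..m}. 0}" for m by (auto simp: D)
      then show ?thesis by (simp add: split_paired_Ball_Sigma degen_def)
    qed
    finally show ?thesis .
  qed
  have b: "bij_betw (cotensor_transpose K U A P \<kappa> X 0) (functors K X P) (simplices (sexp (Fun K X A) U) 0)"
    using P X by (auto simp: is_cotensor_def sset_iso_def)
  have "\<exists>!h. h \<in> functors K X P \<and> \<Phi> = cotensor_transpose K U A P \<kappa> X 0 h"
    using bij_betw_iff_ex1[OF bij_betw_imp_funcset[OF b]] b \<Phi> by simp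
  then show ?thesis unfolding iff[symmetric] eq_commute[of \<Phi>] .
qed

text \<open>Restricting an induced functor along \<open>f\<close> restricts its cone: split the
  degeneracy of the composite, then reassociate.\<close>

lemma cotensor_induced_comp:
  assumes o: "X \<in> ob K" "Y \<in> ob K" "P \<in> ob K" "A \<in> ob K"
    and k: "\<kappa> n u \<in> simplices (Fun K P A) n" and f: "f \<in> functors K X Y" and g: "g \<in> functors K Y P"
    and eq: "cmp K Y P A n (\<kappa> n u) (degen (Fun K Y P) n g) = \<phi>"
  shows "cmp K X P A n (\<kappa> n u) (degen (Fun K X P) n (cmp K X Y P 0 g f)) = cmp K X Y A n \<phi> (degen (Fun K X Y) n f)"
  unfolding cmp_degen[OF o(1-3) f g, symmetric] eq[symmetric]
  using f g by (intro cmp_assoc o k simplicial_set.degen_closed Fun_sset)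

text \<open>\<open>s' s\<close> and the identity are both induced by the cone
  \<open>\<kappa>\<close>. Used twice with exchanged roles, this makes two cotensors strictly
  isomorphic.\<close>

lemma cotensor_unique:
  assumes P: "is_cotensor K U A P \<kappa>" and Q: "is_cotensor K U A Q \<mu>" and U: "simplicial_set U"
    and s: "s \<in> functors K P Q" "\<And>n u. u \<in> simplices U n \<Longrightarrow> cmp K P Q A n (\<mu> n u) (degen (Fun K P Q) n s) = \<kappa> n u"
    and s': "s' \<in> functors K Q P" "\<And>n u. u \<in> simplices U n \<Longrightarrow> cmp K Q P A n (\<kappa> n u) (degen (Fun K Q P) n s') = \<mu> n u"
  shows "cmp K P Q P 0 s' s = idn K P"
proof -
  have o: "A \<in> ob K" "P \<in> ob K" "Q \<in> ob K" and \<kappa>: "simplicial_map U (Fun K P A) \<kappa>"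
    using P Q by (auto simp: is_cotensor_def)
  have k: "\<kappa> n u \<in> simplices (Fun K P A) n" if "u \<in> simplices U n" for n u
    using simplicial_mapD(1)[OF \<kappa> that] .
  have "cmp K P P A n (\<kappa> n u) (degen (Fun K P P) n (cmp K P Q P 0 s' s)) = \<kappa> n u" if "u \<in> simplices U n" for n u
    using cotensor_induced_comp[where \<kappa> = \<kappa> and n = n and u = u, OF o(2,3,2,1) k[OF that] s(1) s'(1) s'(2)[OF that]] s(2)[OF that] by simp
  moreover have "cmp K P P A n (\<kappa> n u) (degen (Fun K P P) n (idn K P)) = \<kappa> n u" if "u \<in> simplices U n" for n u
    using cmp_idn_right[OF o(2,1) k[OF that]] .
  ultimately show ?thesis
    using cotensor_universal[OF P U o(2) \<kappa>] cmp_closed[OF o(2,3,2) s(1) s'(1)] idn_closed[OF o(2)] by blast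
qed

lemma terminal_unique:
  assumes "is_terminal K T" "X \<in> ob K"
  shows "\<exists>!t. t \<in> functors K X T"
proof -
  have "bij_betw (\<lambda>x. \<lambda>i\<in>{..0::nat}. 0::nat) (functors K X T) (simplices (Delta 0) 0)"
    using assms unfolding is_terminal_def sset_iso_def by blast
  moreover have "simplices (Delta 0) 0 = {\<lambda>i\<in>{..0}. 0}"
    unfolding Delta_def sset.simps using Op_0 zero_Op by blast
  ultimately have "bij_betw (\<lambda>x. \<lambda>i\<in>{..0::nat}. 0::nat) (functors K X T) {\<lambda>i\<in>{..0}. 0}" by simp
  then show ?thesis by (auto simp: bij_betw_def inj_on_def)
qed

lemma terminal_iso:
  assumes "is_terminal K T" "is_terminal K T'" "t \<in> functors K T T'" "t' \<in> functors K T' T"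
  shows "cmp K T T' T 0 t' t = idn K T"
proof -
  have "T \<in> ob K" "T' \<in> ob K" using assms by (auto simp: is_terminal_def)
  then show ?thesis
    using terminal_unique[OF assms(1)] cmp_closed[of T T' T t 0 t'] idn_closed assms(3,4) by blast
qed

end

context infinity_cosmos
begin

text \<open>Discharges the definite description in \<open>cot_ind\<close>.\<close>

lemma cot_ind:
  assumes "A \<in> ob K" "X \<in> ob K" "simplicial_set U" "simplicial_map U (Fun K X A) \<phi>"
  shows "cot_ind K X A U \<phi> \<in> functors K X (cotensor K A U)"
    and "u \<in> simplices U n \<Longrightarrow> cmp K X (cotensor K A U) A n (cone K A U n u)
           (degen (Fun K X (cotensor K A U)) n (cot_ind K X A U \<phi>)) = \<phi> n u"
  using theI'[OF cotensor_universal[OF cot_cotensor[OF assms(1,3)] assms(3,2,4)], folded cot_ind_def] by blast+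

lemma cot_ind_eqI:
  assumes "A \<in> ob K" "X \<in> ob K" "simplicial_set U" "simplicial_map U (Fun K X A) \<phi>"
    and "h \<in> functors K X (cotensor K A U)"
    and "\<And>n u. u \<in> simplices U n \<Longrightarrow> cmp K X (cotensor K A U) A n (cone K A U n u)
           (degen (Fun K X (cotensor K A U)) n h) = \<phi> n u"
  shows "cot_ind K X A U \<phi> = h"
  using cotensor_universal[OF cot_cotensor[OF assms(1,3)] assms(3,2,4)] cot_ind[OF assms(1-4)] assms(5,6) by blast

lemma cotensor_closed: "A \<in> ob K \<Longrightarrow> simplicial_set U \<Longrightarrow> cotensor K A U \<in> ob K"
  using cot_cotensor by (auto simp: is_cotensor_def)

lemma one_closed: "one K \<in> ob K"
  using one_terminal by (auto simp: is_terminal_def)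

lemma cone_simplicial: "A \<in> ob K \<Longrightarrow> simplicial_set U \<Longrightarrow> simplicial_map U (Fun K (cotensor K A U) A) (cone K A U)"
  using cot_cotensor by (auto simp: is_cotensor_def)

lemma const_simplicial:
  assumes "A \<in> ob K" "simplicial_set U"
  shows "simplicial_map U (Fun K A A) (\<lambda>n u. degen (Fun K A A) n (idn K A))"
proof -
  interpret AA: simplicial_set "Fun K A A" by (rule Fun_sset[OF assms(1,1)])
  show ?thesis
    using AA.degen_closed[OF idn_closed[OF assms(1)]] AA.act_degen[OF _ idn_closed[OF assms(1)]]
    by (auto simp: simplicial_map_def)
qed

lemma const_diagram:
  assumes "A \<in> ob K" "simplicial_set J"
  shows "const_diagram K J A \<in> functors K A (cotensor K A J)"
    and "u \<in> simplices J n \<Longrightarrow> cmp K A (cotensor K A J) A n (cone K A J n u)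
      (degen (Fun K A (cotensor K A J)) n (const_diagram K J A)) = degen (Fun K A A) n (idn K A)"
  unfolding const_diagram_def
  using cot_ind[OF assms(1,1,2) const_simplicial[OF assms]] by auto

end

section \<open>The canonical comparisons and the transfer of limits\<close>

context cosmos_weak_equivalence
begin

text \<open>\<open>F\<close> preserves cotensors, so its value on the cotensor in \<open>K\<close>
  and the cotensor in \<open>L\<close> have the same universal property and are strictly isomorphic.
  The constant diagrams match because both are induced by the constant cone at the identity.\<close>

lemma cot_comparison:
  assumes A: "A \<in> ob K" and J: "simplicial_set J"
  defines "s \<equiv> cot_comparison K L F J A"
  shows "s \<in> functors L (omap F (cotensor K A J)) (cotensor L (omap F A) J)"
    and "\<exists>s'\<in>functors L (cotensor L (omap F A) J) (omap F (cotensor K A J)).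
      cmp L (omap F (cotensor K A J)) (cotensor L (omap F A) J) (omap F (cotensor K A J)) 0 s' s
        = idn L (omap F (cotensor K A J)) \<and>
      cmp L (cotensor L (omap F A) J) (omap F (cotensor K A J)) (cotensor L (omap F A) J) 0 s s'
        = idn L (cotensor L (omap F A) J)"
    and "cmp L (omap F A) (omap F (cotensor K A J)) (cotensor L (omap F A) J) 0 s
        (hmap F A (cotensor K A J) 0 (const_diagram K J A)) = const_diagram L J (omap F A)"
proof -
  let ?P = "omap F (cotensor K A J)" and ?Q = "cotensor L (omap F A) J"
  let ?\<kappa> = "\<lambda>n u. hmap F (cotensor K A J) A n (cone K A J n u)"
  note AJ = K.cotensor_closed[OF A J]
  note FA = omap_closed[OF A] and P = omap_closed[OF AJ]
  note Q = L.cotensor_closed[OF FA J]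
  note cP = preserves_cotensor[OF A J] and cQ = L.cot_cotensor[OF FA J]
  have \<kappa>: "simplicial_map J (Fun L ?P (omap F A)) ?\<kappa>" using cP by (simp add: is_cotensor_def)
  have s: "s \<in> functors L ?P ?Q" "\<And>n u. u \<in> simplices J n \<Longrightarrow>
      cmp L ?P ?Q (omap F A) n (cone L (omap F A) J n u) (degen (Fun L ?P ?Q) n s) = ?\<kappa> n u"
    unfolding s_def cot_comparison_def using L.cot_ind[OF FA P J \<kappa>] by auto
  then show "s \<in> functors L ?P ?Q" by simp
  obtain s' where s': "s' \<in> functors L ?Q ?P" "\<And>n u. u \<in> simplices J n \<Longrightarrow>
      cmp L ?Q ?P (omap F A) n (?\<kappa> n u) (degen (Fun L ?Q ?P) n s') = cone L (omap F A) J n u"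
    using L.cotensor_universal[OF cP J Q L.cone_simplicial[OF FA J]] by blast
  show "\<exists>s'\<in>functors L ?Q ?P. cmp L ?P ?Q ?P 0 s' s = idn L ?P \<and> cmp L ?Q ?P ?Q 0 s s' = idn L ?Q"
    using L.cotensor_unique[OF cP cQ J s s'] L.cotensor_unique[OF cQ cP J s' s] s'(1) by blast
  let ?\<Delta> = "hmap F A (cotensor K A J) 0 (const_diagram K J A)"
  note \<Delta> = K.const_diagram[OF A J]
  note F\<Delta> = hmap_closed[OF A AJ \<Delta>(1)]
  have "cmp L (omap F A) ?Q (omap F A) n (cone L (omap F A) J n u)
      (degen (Fun L (omap F A) ?Q) n (cmp L (omap F A) ?P ?Q 0 s ?\<Delta>)) = degen (Fun L (omap F A) (omap F A)) n (idn L (omap F A))"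
    if u: "u \<in> simplices J n" for n u
  proof -
    have cu: "cone L (omap F A) J n u \<in> simplices (Fun L ?Q (omap F A)) n"
      using simplicial_mapD(1)[OF L.cone_simplicial[OF FA J] u] .
    have cu': "cone K A J n u \<in> simplices (Fun K (cotensor K A J) A) n"
      using simplicial_mapD(1)[OF K.cone_simplicial[OF A J] u] .
    have "cmp L (omap F A) ?Q (omap F A) n (cone L (omap F A) J n u)
      (degen (Fun L (omap F A) ?Q) n (cmp L (omap F A) ?P ?Q 0 s ?\<Delta>))
      = cmp L (omap F A) ?P (omap F A) n (?\<kappa> n u) (degen (Fun L (omap F A) ?P) n ?\<Delta>)"
      by (rule L.cotensor_induced_comp[where \<kappa> = "cone L (omap F A) J" and n = n and u = u, OF FA P Q FA cu F\<Delta> s(1) s(2)[OF u]])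
    also have "\<dots> = hmap F A A n (cmp K A (cotensor K A J) A n (cone K A J n u) (degen (Fun K A (cotensor K A J)) n (const_diagram K J A)))"
      unfolding hmap_degen[OF A AJ \<Delta>(1), symmetric]
      by (rule hmap_cmp[OF A AJ A K.degen_closed_Fun[OF A AJ \<Delta>(1)] cu', symmetric])
    also have "\<dots> = degen (Fun L (omap F A) (omap F A)) n (idn L (omap F A))"
      unfolding \<Delta>(2)[OF u] hmap_degen[OF A A K.idn_closed[OF A]] hmap_idn[OF A] ..
    finally show ?thesis .
  qed
  then show "cmp L (omap F A) ?P ?Q 0 s ?\<Delta> = const_diagram L J (omap F A)"
    unfolding const_diagram_def[of L]
    by (intro L.cot_ind_eqI[OF FA FA J L.const_simplicial[OF FA J], symmetric] L.cmp_closed[OF FA P Q F\<Delta> s(1)])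
qed

text \<open>\<open>one L\<close> and the image of \<open>one K\<close> are both terminal, so the
  unique maps between them are inverse to each other.\<close>

lemma one_comparison:
  defines "t \<equiv> one_comparison K L F"
  shows "t \<in> functors L (one L) (omap F (one K))"
    and "\<exists>t'\<in>functors L (omap F (one K)) (one L).
      cmp L (omap F (one K)) (one L) (omap F (one K)) 0 t t' = idn L (omap F (one K)) \<and>
      cmp L (one L) (omap F (one K)) (one L) 0 t' t = idn L (one L)"
proof -
  show t: "t \<in> functors L (one L) (omap F (one K))"
    unfolding t_def one_comparison_def by (rule theI'[OF L.terminal_unique[OF preserves_terminal L.one_closed]])
  obtain t' where t': "t' \<in> functors L (omap F (one K)) (one L)"
    using L.terminal_unique[OF L.one_terminal omap_closed[OF K.one_closed]] by blast
  show "\<exists>t'\<in>functors L (omap F (one K)) (one L).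
      cmp L (omap F (one K)) (one L) (omap F (one K)) 0 t t' = idn L (omap F (one K)) \<and>
      cmp L (one L) (omap F (one K)) (one L) 0 t' t = idn L (one L)"
    using L.terminal_iso[OF preserves_terminal L.one_terminal t' t] L.terminal_iso[OF L.one_terminal preserves_terminal t t'] t'
    by blast
qed

text \<open>Stated for any pair \<open>S\<close>, \<open>T\<close> with the 1-cells of the homotopy 2-categories, so that it also
  applies to their duals, which turn limits into colimits.\<close>

lemma absolute_right_lifting_image:
  fixes S :: "('k, 's, 's set) two_cat" and T :: "('l, 't, 't set) two_cat"
  assumes FST: "biequivalence S T (omap F) (\<lambda>A B. hmap F A B 0) m"
    and S: "ob2 S = ob K" "cells1 S = functors K"
    and T: "ob2 T = ob L" "cells1 T = functors L" "id1 T = idn L" "comp1 T = (\<lambda>A B C. cmp L A B C 0)"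
    and A: "A \<in> ob K" and J: "simplicial_set J" and d: "d \<in> functors K (one K) (cotensor K A J)"
  shows "l \<in> functors K (one K) A \<Longrightarrow>
    (\<exists>lam. absolute_right_lifting S (one K) A (cotensor K A J) d (const_diagram K J A) l lam) \<longleftrightarrow>
    (\<exists>lam. absolute_right_lifting T (one L) (omap F A) (cotensor L (omap F A) J)
       (diagram_image K L F J A d) (const_diagram L J (omap F A)) (element_image K L F A l) lam)"
    and "(\<exists>l\<in>functors K (one K) A. \<exists>lam. absolute_right_lifting S (one K) A (cotensor K A J) d (const_diagram K J A) l lam) \<longleftrightarrow>
    (\<exists>l\<in>functors L (one L) (omap F A). \<exists>lam. absolute_right_lifting T (one L) (omap F A) (cotensor L (omap F A) J)
       (diagram_image K L F J A d) (const_diagram L J (omap F A)) l lam)"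
proof -
  interpret B: biequivalence S T "omap F" "\<lambda>A B. hmap F A B 0" m by fact
  note AJ = K.cotensor_closed[OF A J]
  note FA = omap_closed[OF A] and P = omap_closed[OF AJ]
  note Q = L.cotensor_closed[OF FA J] and FO = omap_closed[OF K.one_closed]
  note \<Delta> = K.const_diagram(1)[OF A J]
  note s = cot_comparison(1)[OF A J] and t = one_comparison(1)
  obtain s' where s': "s' \<in> functors L (cotensor L (omap F A) J) (omap F (cotensor K A J))"
     "cmp L (omap F (cotensor K A J)) (cotensor L (omap F A) J) (omap F (cotensor K A J)) 0 s' (cot_comparison K L F J A)
        = idn L (omap F (cotensor K A J))"
     "cmp L (cotensor L (omap F A) J) (omap F (cotensor K A J)) (cotensor L (omap F A) J) 0 (cot_comparison K L F J A) s'
        = idn L (cotensor L (omap F A) J)"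
    using cot_comparison(2)[OF A J] by blast
  obtain t' where t': "t' \<in> functors L (omap F (one K)) (one L)"
      "cmp L (omap F (one K)) (one L) (omap F (one K)) 0 (one_comparison K L F) t' = idn L (omap F (one K))"
      "cmp L (one L) (omap F (one K)) (one L) 0 t' (one_comparison K L F) = idn L (one L)"
    using one_comparison(2) by blast
  note obs = FO L.one_closed P Q FA
  note closed = hmap_closed[OF K.one_closed AJ d] hmap_closed[OF A AJ \<Delta>]
  \<comment> \<open>Liftings pass first from \<open>S\<close> to their images in \<open>T\<close>,
    then along the comparisons inside \<open>T\<close>; these equations identify the transported
    1-cells with the diagrams and elements of the theorem.\<close>
  note images = cot_comparison(3)[OF A J] element_image_def[symmetric] diagram_image_def[symmetric]
  show "(\<exists>lam. absolute_right_lifting S (one K) A (cotensor K A J) d (const_diagram K J A) l lam) \<longleftrightarrow>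
    (\<exists>lam. absolute_right_lifting T (one L) (omap F A) (cotensor L (omap F A) J)
       (diagram_image K L F J A d) (const_diagram L J (omap F A)) (element_image K L F A l) lam)"
    if l: "l \<in> functors K (one K) A"
    using B.ex_absolute_right_lifting_map[unfolded S T, OF K.one_closed A AJ d \<Delta> l]
      B.T.absolute_right_lifting_transport[unfolded T, OF obs t t'(1,2) s s' closed hmap_closed[OF K.one_closed A l]]
    unfolding images by (rule trans)
  show "(\<exists>l\<in>functors K (one K) A. \<exists>lam. absolute_right_lifting S (one K) A (cotensor K A J) d (const_diagram K J A) l lam) \<longleftrightarrow>
    (\<exists>l\<in>functors L (one L) (omap F A). \<exists>lam. absolute_right_lifting T (one L) (omap F A) (cotensor L (omap F A) J)
       (diagram_image K L F J A d) (const_diagram L J (omap F A)) l lam)"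
    using B.ex_absolute_right_lifting_map_ex[unfolded S T, OF K.one_closed A AJ d \<Delta>]
      B.T.ex_absolute_right_lifting_transport[unfolded T, OF obs t t' s s' closed]
    unfolding images by (rule trans)
qed

end

theorem theorem3p6p6:
  fixes K :: "('k, 's, 'u :: infinite) cosmos"
    and L :: "('l, 't, 'u) cosmos"
    and F :: "('k, 'l, 's, 't) sfunctor"
  assumes "infinity_cosmos K" and "infinity_cosmos L"
    and "cosmos_weak_equivalence K L F"
  shows
    "(\<forall>A\<in>ob K. \<forall>B\<in>ob K. \<forall>f\<in>functors K B A. \<forall>u\<in>functors K A B.
        left_adjoint_to (homotopy_2_category K) A B f u \<longleftrightarrow>
        left_adjoint_to (homotopy_2_category L) (omap F A) (omap F B)
          (hmap F B A 0 f) (hmap F A B 0 u)) \<and>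
     (\<forall>A\<in>ob K. \<forall>B\<in>ob K. \<forall>u\<in>functors K A B.
        (admits_left_adjoint (homotopy_2_category K) A B u \<longleftrightarrow>
         admits_left_adjoint (homotopy_2_category L) (omap F A) (omap F B) (hmap F A B 0 u)) \<and>
        (admits_right_adjoint (homotopy_2_category K) A B u \<longleftrightarrow>
         admits_right_adjoint (homotopy_2_category L) (omap F A) (omap F B) (hmap F A B 0 u))) \<and>
     (\<forall>J :: 'u sset. simplicial_set J \<longrightarrow>
        (\<forall>A\<in>ob K. \<forall>d\<in>functors K (one K) (cotensor K A J). \<forall>l\<in>functors K (one K) A.
           (defines_limit K J A d l \<longleftrightarrow>
            defines_limit L J (omap F A) (diagram_image K L F J A d) (element_image K L F A l)) \<and>
           (defines_colimit K J A d l \<longleftrightarrow>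
            defines_colimit L J (omap F A) (diagram_image K L F J A d) (element_image K L F A l)))) \<and>
     (\<forall>J :: 'u sset. simplicial_set J \<longrightarrow>
        (\<forall>A\<in>ob K. \<forall>d\<in>functors K (one K) (cotensor K A J).
           (admits_limit K J A d \<longleftrightarrow>
            admits_limit L J (omap F A) (diagram_image K L F J A d)) \<and>
           (admits_colimit K J A d \<longleftrightarrow>
            admits_colimit L J (omap F A) (diagram_image K L F J A d))))"
proof -
  interpret cosmos_weak_equivalence K L F by fact
  note B = biequivalence_homotopy
  note image = absolute_right_lifting_image[OF B]
    absolute_right_lifting_image[OF biequivalence.biequivalence_co_dual[OF B]]
  note defs = defines_limit_def defines_colimit_def admits_limit_def admits_colimit_def absolute_left_lifting_def
  show ?thesis
    unfolding defs
    using biequivalence.left_adjoint_to_map[OF B] biequivalence.admits_left_adjoint_map[OF B]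
      biequivalence.admits_right_adjoint_map[OF B]
    \<comment> \<open>\<open>image\<close> matches the limit goals through the homotopy 2-categories
      and the colimit goals through their duals; left over are the adjunction statements and the
      agreement of objects and 1-cells.\<close>
    by (intro conjI ballI allI impI image) (simp_all add: homotopy_2_category_def)
qed

end
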